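(* Let $\nu\ge-\tfrac14$, $\mu>-\tfrac12$, and $z\in\mathbb{C}\setminus(-\infty,0]$. Then $$\int_0^\infty J_{2\nu}(cz)\,J_\nu\left(\frac{c^2}{4}\right)c\,dc=2\,J_\nu\left(z^2\right)$$ and $$\int_0^\infty J_\mu(cz)\,J_\mu\left(\frac{1}{4c}\right)dc=z^{-1}J_{2\mu}\left(\sqrt{z}\right).$$
   Context: $J_\nu$ is the Bessel function of the first kind of order $\nu$.
   Formalization: For non-real z both integrals diverge, so there the integral means the analytic continuation in z of the convergent improper integral from z > 0, and J_ν(z²) is taken with log(z²) = 2 Log z (the principal value when Re z > 0). *)

theory Defs
  imports "HOL-Complex_Analysis.Complex_Analysis"
begin

(* J_nu as a function on the Riemann surface of the logarithm: the argument is given through its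
   logarithm w, and exp w / 2 is raised to the power nu with the branch exp (nu * (w - ln 2)).
   rGamma = 1 / Gamma vanishes at the poles of Gamma, so every real order is covered. *)
definition besselJ_log :: "real \<Rightarrow> complex \<Rightarrow> complex" where
  "besselJ_log \<nu> w = exp (of_real \<nu> * (w - of_real (ln 2))) *
     (\<Sum>k. (-1) ^ k / fact k * rGamma (of_real \<nu> + of_nat k + 1) * (exp w / 2) ^ (2 * k))"

(* Principal branch. 0 powr 0 = 0 in the library, hence the separate value at 0
   (for nu < 0 not an integer, J_nu is singular at 0 and the value there is a dummy). *)
definition besselJ :: "real \<Rightarrow> complex \<Rightarrow> complex" where
  "besselJ \<nu> z = (if z = 0 then (if \<nu> = 0 then 1 else 0) else besselJ_log \<nu> (Ln z))"

(* The value I at z of the integral of f z c over 0 < c < infinity, as an analytic function of z on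
   the slit plane: for z > 0 it is the (conditionally convergent) improper integral, which the
   Henstock-Kurzweil integral over {0..} computes; for other z, where J_nu (c z) grows like
   exp (c |Im z|) and the integral diverges, it is its analytic continuation. *)
definition has_continued_integral ::
  "(complex \<Rightarrow> real \<Rightarrow> complex) \<Rightarrow> complex \<Rightarrow> complex \<Rightarrow> bool" where
  "has_continued_integral f z I \<longleftrightarrow>
     (\<exists>F. F holomorphic_on (- \<real>\<^sub>\<le>\<^sub>0) \<and>
          (\<forall>x::real. x > 0 \<longrightarrow> (f (of_real x) has_integral F (of_real x)) {0..}) \<and>
          F z = I)"

lemma besselJ_powr_series:
  assumes "z \<noteq> 0"
  shows "besselJ \<nu> z = (z / 2) powr (of_real \<nu>) *
     (\<Sum>k. (-1) ^ k / fact k * rGamma (of_real \<nu> + of_nat k + 1) * (z / 2) ^ (2 * k))"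
proof -
  have "Ln (z / 2) = Ln z - of_real (ln 2)"
    using Ln_divide_of_real[of 2 z] assms by simp
  then show ?thesis
    using assms by (simp add: besselJ_def besselJ_log_def powr_def)
qed

lemma besselJ_log_double:
  assumes "Re z > 0"
  shows "besselJ_log \<nu> (2 * Ln z) = besselJ \<nu> (z ^ 2)"
proof -
  have z: "z \<noteq> 0" using assms by auto
  have "\<bar>Im (Ln z)\<bar> < pi / 2"
    using assms Re_Ln_pos_lt[OF z] by simp
  then have "Ln (exp (2 * Ln z)) = 2 * Ln z"
    by (intro Ln_exp) auto
  moreover have "exp (2 * Ln z) = z ^ 2"
    using z by (simp add: exp_double)
  ultimately show ?thesis
    using z by (simp add: besselJ_def)
qed

lemma has_continued_integral_pos:
  assumes "has_continued_integral f (of_real x) I" "x > 0"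
  shows "(f (of_real x) has_integral I) {0..}"
  using assms unfolding has_continued_integral_def by auto

lemma has_continued_integral_unique:
  assumes "has_continued_integral f z I" "has_continued_integral f z I'" "z \<notin> \<real>\<^sub>\<le>\<^sub>0"
  shows "I = I'"
proof -
  obtain F where F: "F holomorphic_on (- \<real>\<^sub>\<le>\<^sub>0)" "F z = I"
    "\<And>x::real. x > 0 \<Longrightarrow> (f (of_real x) has_integral F (of_real x)) {0..}"
    using assms(1) unfolding has_continued_integral_def by blast
  obtain G where G: "G holomorphic_on (- \<real>\<^sub>\<le>\<^sub>0)" "G z = I'"
    "\<And>x::real. x > 0 \<Longrightarrow> (f (of_real x) has_integral G (of_real x)) {0..}"
    using assms(2) unfolding has_continued_integral_def by blast
  let ?U = "complex_of_real ` {0<..}"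
  have op: "open (- (\<real>\<^sub>\<le>\<^sub>0 :: complex set))" by (simp add: open_Compl)
  have con: "connected (- (\<real>\<^sub>\<le>\<^sub>0 :: complex set))"
  proof -
    have "(\<real>\<^sub>\<le>\<^sub>0 :: complex set) = complex_of_real ` {..0}"
      by (auto simp: nonpos_Reals_def)
    then show ?thesis
      using starlike_slotted_complex_plane_left[of 0] starlike_imp_connected by metis
  qed
  have lim: "1 islimpt ?U"
  proof -
    have "(\<lambda>n. complex_of_real (1 + 1 / real (Suc n))) \<longlonglongrightarrow> of_real (1 + 0)"
      by (intro tendsto_intros LIMSEQ_inverse_real_of_nat[unfolded inverse_eq_divide])
    then show ?thesis
      unfolding islimpt_sequential
      by (intro exI[of _ "\<lambda>n. complex_of_real (1 + 1 / real (Suc n))"])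
        (auto simp: complex_eq_iff add_pos_pos simp del: of_nat_Suc)
  qed
  have "(\<lambda>z. F z - G z) z = 0"
  proof (rule analytic_continuation[where f = "\<lambda>z. F z - G z" and w = z and S = "- \<real>\<^sub>\<le>\<^sub>0" and U = ?U and \<xi> = 1])
    show "(\<lambda>z. F z - G z) holomorphic_on (- \<real>\<^sub>\<le>\<^sub>0)"
      using F G by (intro holomorphic_on_diff)
    show "F w - G w = 0" if "w \<in> ?U" for w
    proof -
      from that obtain x :: real where x: "x > 0" "w = of_real x" by auto
      show ?thesis
        using has_integral_unique[OF F(3)[OF x(1)] G(3)[OF x(1)]] x(2) by simp
    qed
    show "?U \<subseteq> - \<real>\<^sub>\<le>\<^sub>0"
      by (auto simp: complex_nonpos_Reals_iff)
    show "(1::complex) \<in> - \<real>\<^sub>\<le>\<^sub>0"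
      by (simp add: complex_nonpos_Reals_iff)
    show "z \<in> - \<real>\<^sub>\<le>\<^sub>0"
      using assms(3) by simp
  qed (use op con lim in auto)
  then show ?thesis using F G by simp
qed

end

(* On the positive axis both integrals are computed from a Poisson-type integral for J_nu over the
   right half of the unit circle q = exp (i phi), in which exp (-t q) decays; the weight
   (2 cos phi)^(nu - 1/2) is integrable exactly for nu > -1/2, and the decay of J_nu is read off this representation.

   First integral: put t = c^2/4 and replace J_nu t by its integral representation.  The Laplace transform of
   t^nu J_{2 nu} (2 z sqrt t) at q is z^(2 nu) q^(-2 nu - 1) exp (-z^2/q), and q |-> 1/q maps the half circle
   to itself and turns this into the representation of J_nu (z^2).  The truncation error is
   controlled by one integration by parts, in the L^1 norm of the weight.

   Second integral: with j_alpha(x) = (x/2)^(-alpha) J_alpha(x) and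
   H_{alpha,beta}(y) = int_0^oo j_alpha(c) j_beta(y/c) dc, the relation j_beta' = -(x/2) j_{beta+1}, the
   substitution c -> y/c and Fubini give
   H_{alpha,beta}' = -1/2 H_{beta+1,alpha}.  Iterating from alpha = beta = mu determines all Taylor
   coefficients at 0, and only the very first integral converges conditionally. *)
theory Submission
  imports Defs
begin

section \<open>Weighted integration over the right half circle\<close>

text \<open>The representation is Poisson's integral of
  \<open>(1 - u^2)^(nu - 1/2) * exp (-i t u)\<close> over -1 < u < 1, carried from the segment
  between -i and i to the half circle. There 1 + q^2 = 2 cos \<phi> * q, which gives the weight, and
  together with dq the phase \<open>cis ((nu + 1/2) * phi)\<close>. Cauchy's theorem is used only
  for weight exponents a > 0, where (1 + q^2)^a is continuous up to the end points; recursions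
  between Fourier coefficients of the weight then reach a > -1. In the first integral, estimating
  the tail directly would give t^(\<nu> - 1/4) t^(-\<nu> - 1/2) = t^(-3/4), which is not integrable.
  One integration by parts gains t^(-1/2), and since |q| = 1 the division by q costs nothing, even
  near the ends of the arc where the damping disappears. In the second, the relation between H and
  H' is used in integrated form. Uniqueness is a Picard estimate: n steps produce a factor 2^n from
  the growth of the sequence and (y/2)^n / n! from the integrations. From the first iterate on, the
  first index exceeds 1/2, which is what absolute convergence requires.\<close>

lemma has_bochner_integral_Gamma:
  fixes a s :: real
  assumes a: "a > -1" and s: "s > 0"
  shows "has_bochner_integral lborel (\<lambda>t. indicator {0<..} t * (t powr a * exp (- (s * t))))
           (Gamma (a + 1) * s powr (- (a + 1)))"
proof -
  have "has_bochner_integral lborel (\<lambda>t. indicator {0..} t * t powr a / exp t) (Gamma (a + 1))"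
  proof (rule has_bochner_integral_nn_integral)
    show "(\<integral>\<^sup>+t. ennreal (indicator {0..} t * t powr a / exp t) \<partial>lborel) = ennreal (Gamma (a + 1))"
      using Gamma_conv_nn_integral_real[of "a + 1"] a nn_integral_has_integral_lebesgue[OF _ Gamma_integral_real[of "a + 1"]] by simp
    show "0 \<le> Gamma (a + 1)" using a by (intro less_imp_le Gamma_real_pos) simp
  qed auto
  then have "has_bochner_integral lborel (\<lambda>t. indicator {0..} (0 + s * t) * (0 + s * t) powr a / exp (0 + s * t)) (Gamma (a + 1) /\<^sub>R \<bar>s\<bar>)"
    by (subst lborel_has_bochner_integral_real_affine_iff[symmetric]) (use s in auto)
  then have "has_bochner_integral lborel (\<lambda>t. s powr (- a) * (indicator {0..} (0 + s * t) * (0 + s * t) powr a / exp (0 + s * t))) (s powr (- a) * (Gamma (a + 1) /\<^sub>R \<bar>s\<bar>))"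
    by (rule has_bochner_integral_mult_right)
  also have "(\<lambda>t. s powr (- a) * (indicator {0..} (0 + s * t) * (0 + s * t) powr a / exp (0 + s * t)))
      = (\<lambda>t. indicator {0<..} t * (t powr a * exp (- (s * t))))"
  proof
    fix t :: real
    consider "t < 0" | "t = 0" | "t > 0" by linarith
    then show "s powr (- a) * (indicator {0..} (0 + s * t) * (0 + s * t) powr a / exp (0 + s * t))
      = indicator {0<..} t * (t powr a * exp (- (s * t)))"
    proof cases
      case 1
      then have "s * t < 0" using s by (simp add: mult_pos_neg)
      then show ?thesis using 1 by simp
    next
      case 3
      have "s powr (- a) * s powr a = 1" using s by (simp flip: powr_add)
      then show ?thesis using 3 s by (simp add: powr_mult exp_minus field_simps)
    qed simp
  qed
  also have "s powr (- a) * (Gamma (a + 1) /\<^sub>R \<bar>s\<bar>) = Gamma (a + 1) * s powr (- (a + 1))"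
    using s by (simp add: powr_diff powr_minus field_simps)
  finally show ?thesis .
qed

abbreviation rarc :: "real set" where "rarc \<equiv> {-pi/2<..<pi/2}"

lemma cos_arc_pos: "\<phi> \<in> rarc \<Longrightarrow> cos \<phi> > 0"
  by (intro cos_gt_zero_pi) auto

text \<open>The cubic Taylor remainder is at most x^3/6, and x < 2 turns this into (2/3) x, leaving
  x/3.\<close>

lemma sin_lower_bound: "x / 3 \<le> sin x" if "0 \<le> x" "x \<le> pi / 2" for x :: real
proof -
  have "x < 2" using that pi_less_4 by simp
  then have "x\<^sup>2 \<le> 4" using that power_mono[of x 2 2] by simp
  have "\<bar>sin x - (\<Sum>m<3. sin_coeff m * x ^ m)\<bar> \<le> inverse (fact 3) * \<bar>x\<bar> ^ 3"
    by (rule Maclaurin_sin_bound)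
  then have "\<bar>sin x - x\<bar> \<le> x ^ 3 / 6"
    using that by (simp add: lessThan_nat_numeral sin_coeff_def fact_numeral)
  also have "x ^ 3 = x * x\<^sup>2" by (simp add: power3_eq_cube power2_eq_square)
  also have "x * x\<^sup>2 \<le> x * 4" using that \<open>x\<^sup>2 \<le> 4\<close> by (intro mult_left_mono) auto
  finally show ?thesis using abs_ge_minus_self[of "sin x - x"] by linarith
qed

text \<open>With \<psi> the distance to the nearer end of the arc, cos \<phi> = sin \<psi> lies
  between \<psi>/3 and \<psi>. The upper bound serves a \<ge> 0 and the lower one a < 0; the
  constant is the sum of the two resulting ones, so that no sign of a has to be fixed.\<close>

lemma cos_powr_exp_le:
  fixes a t \<phi> :: real
  assumes \<phi>: "\<phi> \<in> rarc" and t: "t > 0"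
  defines "\<psi> \<equiv> pi / 2 - \<bar>\<phi>\<bar>"
  shows "(2 * cos \<phi>) powr a * exp (- (t * cos \<phi>)) \<le> (2 powr a + (2/3) powr a) * (\<psi> powr a * exp (- (t / 3 * \<psi>)))"
proof -
  have p: "0 < \<psi>" "\<psi> \<le> pi / 2" using \<phi> by (auto simp: \<psi>_def)
  have c: "cos \<phi> = sin \<psi>"
    unfolding \<psi>_def by (cases "\<phi> \<ge> 0") (simp_all add: sin_diff sin_add)
  have lo: "\<psi> / 3 \<le> sin \<psi>" using p by (intro sin_lower_bound) auto
  have hi: "sin \<psi> \<le> \<psi>" using p by (intro sin_x_le_x) auto
  have "(2 * sin \<psi>) powr a \<le> (2 powr a + (2/3) powr a) * \<psi> powr a"
  proof (cases "a \<ge> 0")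
    case True
    have "(2 * sin \<psi>) powr a \<le> (2 * \<psi>) powr a" using True hi lo p by (intro powr_mono2) auto
    also have "\<dots> = 2 powr a * \<psi> powr a" using p by (simp add: powr_mult)
    also have "\<dots> \<le> (2 powr a + (2/3) powr a) * \<psi> powr a" by (intro mult_right_mono) auto
    finally show ?thesis .
  next
    case False
    have "(2 * sin \<psi>) powr a \<le> (2/3 * \<psi>) powr a" using False lo p by (intro powr_mono2') auto
    also have "\<dots> = (2/3) powr a * \<psi> powr a" using p by (subst powr_mult) auto
    also have "\<dots> \<le> (2 powr a + (2/3) powr a) * \<psi> powr a" by (intro mult_right_mono) auto
    finally show ?thesis .
  qed
  moreover have "exp (- (t * sin \<psi>)) \<le> exp (- (t / 3 * \<psi>))" using lo t by (simp add: field_simps)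
  ultimately have "(2 * sin \<psi>) powr a * exp (- (t * sin \<psi>)) \<le> (2 powr a + (2/3) powr a) * \<psi> powr a * exp (- (t / 3 * \<psi>))"
    by (intro mult_mono) auto
  then show ?thesis unfolding c by (simp add: mult.assoc)
qed

text \<open>Every weight \<open>a\<close> is a measure of its own, so that the singular factor at the end points never
  appears in dominated convergence or Fubini arguments: bounded functions are integrable.\<close>

definition arcm :: "real \<Rightarrow> real measure" where
  "arcm a = density lborel (\<lambda>\<phi>. ennreal (indicator rarc \<phi> * (2 * cos \<phi>) powr a))"

lemma sets_arcm [simp, measurable_cong]: "sets (arcm a) = sets borel"
  and space_arcm [simp]: "space (arcm a) = UNIV"
  by (simp_all add: arcm_def)

lemma AE_arcm: "AE \<phi> in arcm a. \<phi> \<in> rarc"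
proof -
  have "AE \<phi> in lborel. 0 < ennreal (indicator rarc \<phi> * (2 * cos \<phi>) powr a) \<longrightarrow> \<phi> \<in> rarc"
    by (auto intro!: AE_I2 split: split_indicator)
  then show ?thesis unfolding arcm_def by (subst AE_density) auto
qed

text \<open>The derivative of \<open>- \<i> (2 cos \<phi>)\<^sup>a\<^sup>+\<^sup>1 exp (\<i> m \<phi>)\<close>, which vanishes at both end points. It yields
  the recursion of the Fourier coefficients of the weight.\<close>

lemma cos_powr_has_integral:
  fixes a m :: real
  assumes "a > -1"
  shows "((\<lambda>\<phi>. (2 * cos \<phi>) powr a *\<^sub>R (of_real (a + 1 + m) * cis ((m + 1) * \<phi>)
           - of_real (a + 1 - m) * cis ((m - 1) * \<phi>))) has_integral 0) {-pi/2..pi/2}"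
proof -
  let ?G = "\<lambda>\<phi>. - \<i> * (of_real ((2 * cos \<phi>) powr (a + 1)) * cis (m * \<phi>))"
  have "((\<lambda>\<phi>. (2 * cos \<phi>) powr a *\<^sub>R (of_real (a + 1 + m) * cis ((m + 1) * \<phi>)
           - of_real (a + 1 - m) * cis ((m - 1) * \<phi>))) has_integral (?G (pi/2) - ?G (-pi/2))) {-pi/2..pi/2}"
  proof (rule fundamental_theorem_of_calculus_interior)
    have "continuous_on {-pi/2..pi/2} (\<lambda>\<phi>. (2 * cos \<phi>) powr (a + 1))"
      using assms by (intro continuous_on_powr' continuous_intros) (auto intro!: cos_ge_zero)
    then show "continuous_on {-pi/2..pi/2} ?G"
      by (rule continuous_on_mult[OF continuous_on_const continuous_on_mult[OF continuous_on_of_real]])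
         (intro continuous_intros)
    fix \<phi> :: real assume "\<phi> \<in> {-pi/2<..<pi/2}"
    then have c: "cos \<phi> > 0" by (rule cos_arc_pos)
    have 1: "((\<lambda>\<phi>. (2 * cos \<phi>) powr (a + 1)) has_real_derivative ((a + 1) * (2 * cos \<phi>) powr a * (- 2 * sin \<phi>))) (at \<phi>)"
    proof -
      have "((\<lambda>\<phi>. 2 * cos \<phi>) has_real_derivative (- 2 * sin \<phi>)) (at \<phi>)"
        by (auto intro!: derivative_eq_intros)
      from DERIV_fun_powr[OF this, of "a + 1"] c
      show "((\<lambda>\<phi>. (2 * cos \<phi>) powr (a + 1)) has_real_derivative ((a + 1) * (2 * cos \<phi>) powr a * (- 2 * sin \<phi>))) (at \<phi>)"
        by simp
    qed
    have 2: "((\<lambda>\<phi>. cis (m * \<phi>)) has_vector_derivative (m *\<^sub>R (\<i> * cis (m * \<phi>)))) (at \<phi>)"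
      by (auto intro!: derivative_eq_intros simp: has_vector_derivative_def scaleR_conv_of_real)
    have e: "(2 * cos \<phi>) powr (a + 1) = (2 * cos \<phi>) powr a * (2 * cos \<phi>)"
      using c by (simp add: powr_add)
    have s: "2 * complex_of_real (sin \<phi>) = - \<i> * (cis \<phi> - cis (-\<phi>))" "2 * complex_of_real (cos \<phi>) = cis \<phi> + cis (-\<phi>)"
      by (simp_all add: complex_eq_iff)
    have "(?G has_vector_derivative (- \<i> * (of_real ((2 * cos \<phi>) powr (a + 1)) * (m *\<^sub>R (\<i> * cis (m * \<phi>)))
        + of_real ((a + 1) * (2 * cos \<phi>) powr a * (- 2 * sin \<phi>)) * cis (m * \<phi>)))) (at \<phi>)"
      by (intro has_vector_derivative_mult_right has_vector_derivative_mult has_vector_derivative_of_real 1 2)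
    also have "(- \<i> * (of_real ((2 * cos \<phi>) powr (a + 1)) * (m *\<^sub>R (\<i> * cis (m * \<phi>)))
        + of_real ((a + 1) * (2 * cos \<phi>) powr a * (- 2 * sin \<phi>)) * cis (m * \<phi>)))
       = of_real ((2 * cos \<phi>) powr a) * cis (m * \<phi>) * (of_real m * (2 * of_real (cos \<phi>)) + \<i> * of_real (a + 1) * (2 * of_real (sin \<phi>)))"
      unfolding e by (simp add: scaleR_conv_of_real algebra_simps)
    also have "\<dots> = of_real ((2 * cos \<phi>) powr a) * cis (m * \<phi>) * (of_real (a+1+m) * cis \<phi> - of_real (a+1-m) * cis (-\<phi>))"
      unfolding s by (simp add: algebra_simps)
    also have "\<dots> = (2 * cos \<phi>) powr a *\<^sub>R (of_real (a + 1 + m) * cis ((m + 1) * \<phi>)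
           - of_real (a + 1 - m) * cis ((m - 1) * \<phi>))"
    proof -
      have "cis ((m + 1) * \<phi>) = cis (m * \<phi>) * cis \<phi>" "cis ((m - 1) * \<phi>) = cis (m * \<phi>) * cis (- \<phi>)"
        by (simp_all add: cis_mult algebra_simps)
      then show ?thesis by (simp only: scaleR_conv_of_real right_diff_distrib mult_ac)
    qed
    finally show "(?G has_vector_derivative (2 * cos \<phi>) powr a *\<^sub>R (of_real (a + 1 + m) * cis ((m + 1) * \<phi>)
           - of_real (a + 1 - m) * cis ((m - 1) * \<phi>))) (at \<phi>)" .
  qed simp
  moreover have "?G (pi/2) - ?G (-pi/2) = 0" using assms by simp
  ultimately show ?thesis by simp
qed

text \<open>Near an end point the integrand is comparable to \<psi>^a exp(-t \<psi>/3), whose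
  integral over the half line is a Gamma integral of size t^(-(a+1)). The constant \<open>K\<close>
  carries a factor 2 for the two ends and (1/3)^(-(a+1)) from the rate t/3.\<close>

lemma arc_exp_decay:
  fixes a :: real
  assumes a: "a > -1"
  shows "\<exists>K\<ge>0. \<forall>t>0. integrable lborel (\<lambda>\<phi>. indicator rarc \<phi> * (2 * cos \<phi>) powr a * exp (- (t * cos \<phi>))) \<and>
    (\<integral>\<phi>. indicator rarc \<phi> * (2 * cos \<phi>) powr a * exp (- (t * cos \<phi>)) \<partial>lborel) \<le> K * t powr (- (a + 1))"
proof (intro exI[of _ "2 * (2 powr a + (2/3) powr a) * Gamma (a + 1) * (1/3) powr (- (a + 1))"] conjI allI impI)
  let ?C = "2 powr a + (2/3) powr a :: real"
  show "0 \<le> 2 * ?C * Gamma (a + 1) * (1/3) powr (- (a + 1))"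
    using Gamma_real_pos[of "a + 1"] a by simp
  fix t :: real assume t: "t > 0"
  let ?f = "\<lambda>\<phi>. indicator rarc \<phi> * (2 * cos \<phi>) powr a * exp (- (t * cos \<phi>))"
  let ?I = "Gamma (a + 1) * (t / 3) powr (- (a + 1))"
  define h where "h \<psi> = indicator {0<..} \<psi> * (\<psi> powr a * exp (- (t / 3 * \<psi>)))" for \<psi> :: real
  \<comment> \<open>One copy of \<open>h\<close> for each end point. Both are nonnegative, so adding
    the copy belonging to the farther end does no harm to an upper bound.\<close>
  let ?g = "\<lambda>\<phi>. ?C * (h (pi / 2 + (-1) * \<phi>) + h (pi / 2 + 1 * \<phi>))"
  have h0: "h \<psi> \<ge> 0" for \<psi> by (simp add: h_def)
  have hb: "has_bochner_integral lborel h ?I"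
    unfolding h_def using a t by (intro has_bochner_integral_Gamma) auto
  have sc: "has_bochner_integral lborel (\<lambda>\<phi>. h (pi / 2 + c * \<phi>)) ?I" if "c = 1 \<or> c = -1" for c
    using lborel_has_bochner_integral_real_affine_iff[of c h ?I "pi / 2"] hb that by auto
  have g: "has_bochner_integral lborel ?g (?C * (?I + ?I))"
    by (intro has_bochner_integral_mult_right has_bochner_integral_add sc) auto
  have le: "?f \<phi> \<le> ?g \<phi>" for \<phi>
  proof (cases "\<phi> \<in> rarc")
    case True
    define \<psi> where "\<psi> = pi / 2 - \<bar>\<phi>\<bar>"
    have "\<psi> > 0" using True by (auto simp: \<psi>_def)
    then have "\<psi> powr a * exp (- (t / 3 * \<psi>)) = h \<psi>" by (simp add: h_def)
    also have "h \<psi> \<le> h (pi / 2 + (-1) * \<phi>) + h (pi / 2 + 1 * \<phi>)"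
      using h0 by (cases "\<phi> \<ge> 0") (simp_all add: \<psi>_def)
    finally have "?C * (\<psi> powr a * exp (- (t / 3 * \<psi>))) \<le> ?g \<phi>"
      by (intro mult_left_mono) auto
    then show ?thesis using cos_powr_exp_le[OF True t, of a] True unfolding \<psi>_def by simp
  qed (use h0 in simp)
  have f0: "?f \<phi> \<ge> 0" for \<phi> by simp
  show I: "integrable lborel ?f"
    by (rule Bochner_Integration.integrable_bound[of _ ?g])
       (use g le f0 in \<open>auto simp: has_bochner_integral_iff intro!: AE_I2 order_trans[OF _ abs_ge_self]\<close>)
  have "(\<integral>\<phi>. ?f \<phi> \<partial>lborel) \<le> (\<integral>\<phi>. ?g \<phi> \<partial>lborel)"
    using g by (intro integral_mono I le) (simp add: has_bochner_integral_iff)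
  also have "\<dots> = ?C * (?I + ?I)"
    by (rule has_bochner_integral_integral_eq[OF g])
  also have "(t / 3) powr (- (a + 1)) = (1/3) powr (- (a + 1)) * t powr (- (a + 1))"
    using t powr_mult[of "1/3" t "- (a + 1)"] by simp
  finally show "(\<integral>\<phi>. ?f \<phi> \<partial>lborel) \<le> 2 * ?C * Gamma (a + 1) * (1/3) powr (- (a + 1)) * t powr (- (a + 1))"
    by (simp add: algebra_simps)
qed

text \<open>The case t = 1 of the decay estimate: exp(-cos \<phi>) is bounded below by exp(-1), so
  removing it costs only a factor exp 1.\<close>

lemma finite_measure_arcm:
  assumes "a > -1"
  shows "finite_measure (arcm a)"
proof -
  have I: "integrable lborel (\<lambda>\<phi>. exp 1 * (indicator rarc \<phi> * (2 * cos \<phi>) powr a * exp (- (1 * cos \<phi>))))"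
    using arc_exp_decay[OF assms] zero_less_one by (intro integrable_mult_right) blast
  have "integrable lborel (\<lambda>\<phi>. indicator rarc \<phi> * (2 * cos \<phi>) powr a)"
  proof (rule Bochner_Integration.integrable_bound[OF I])
    show "AE \<phi> in lborel. norm (indicator rarc \<phi> * (2 * cos \<phi>) powr a)
        \<le> norm (exp 1 * (indicator rarc \<phi> * (2 * cos \<phi>) powr a * exp (- (1 * cos \<phi>))))"
    proof (rule AE_I2)
      fix \<phi> :: real
      let ?x = "indicator rarc \<phi> * (2 * cos \<phi>) powr a :: real"
      have "?x * 1 \<le> ?x * (exp 1 * exp (- cos \<phi>))"
        by (intro mult_left_mono) (auto simp flip: exp_add)
      also have "\<dots> = exp 1 * (?x * exp (- (1 * cos \<phi>)))" by simp
      finally show "norm ?x \<le> norm (exp 1 * (?x * exp (- (1 * cos \<phi>))))" by simp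
    qed
  qed measurable
  then show ?thesis
    by (intro finite_measureI) (auto simp: arcm_def emeasure_density integrable_iff_bounded abs_mult)
qed

lemma arcm_exp_decay:
  assumes "a > -1"
  shows "\<exists>K\<ge>0. \<forall>t>0. (\<integral>\<phi>. exp (- (t * cos \<phi>)) \<partial>arcm a) \<le> K * t powr (- (a + 1))"
proof -
  have "(\<integral>\<phi>. exp (- (t * cos \<phi>)) \<partial>arcm a) = (\<integral>\<phi>. indicator rarc \<phi> * (2 * cos \<phi>) powr a * exp (- (t * cos \<phi>)) \<partial>lborel)" for t
    unfolding arcm_def by (subst integral_density) auto
  then show ?thesis using arc_exp_decay[OF assms] by simp blast
qed

lemma integrable_arcm:
  fixes f :: "real \<Rightarrow> 'a::{banach,second_countable_topology}"
  assumes "a > -1" "f \<in> borel_measurable borel" "\<And>\<phi>. \<phi> \<in> rarc \<Longrightarrow> norm (f \<phi>) \<le> C"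
  shows "integrable (arcm a) f"
proof -
  interpret finite_measure "arcm a" by (rule finite_measure_arcm) fact
  show ?thesis
    using AE_arcm[of a] assms(3)
    by (intro integrable_const_bound[where B = C]) (use assms(2) in \<open>auto elim: eventually_mono\<close>)
qed

lemma has_integral_arcm:
  fixes f :: "real \<Rightarrow> 'a::euclidean_space"
  assumes "a > -1" "f \<in> borel_measurable borel" "\<And>\<phi>. \<phi> \<in> rarc \<Longrightarrow> norm (f \<phi>) \<le> C"
  shows "((\<lambda>\<phi>. (2 * cos \<phi>) powr a *\<^sub>R f \<phi>) has_integral (\<integral>\<phi>. f \<phi> \<partial>arcm a)) {-pi/2..pi/2}"
proof -
  have "integrable (arcm a) f" by (rule integrable_arcm) fact+
  then have i: "integrable lborel (\<lambda>\<phi>. (indicator rarc \<phi> * (2 * cos \<phi>) powr a) *\<^sub>R f \<phi>)"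
    unfolding arcm_def by (subst (asm) integrable_density) (use assms(2) in auto)
  have "(\<integral>\<phi>. f \<phi> \<partial>arcm a) = (\<integral>\<phi>. (indicator rarc \<phi> * (2 * cos \<phi>) powr a) *\<^sub>R f \<phi> \<partial>lborel)"
    unfolding arcm_def by (subst integral_density) (use assms(2) in auto)
  then have "((\<lambda>\<phi>. (indicator rarc \<phi> * (2 * cos \<phi>) powr a) *\<^sub>R f \<phi>) has_integral (\<integral>\<phi>. f \<phi> \<partial>arcm a)) UNIV"
    using has_integral_integral_lborel[OF i] by simp
  then have "((\<lambda>\<phi>. if \<phi> \<in> rarc then (2 * cos \<phi>) powr a *\<^sub>R f \<phi> else 0) has_integral (\<integral>\<phi>. f \<phi> \<partial>arcm a)) UNIV"
    by (rule has_integral_eq[rotated]) (auto split: split_indicator)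
  then show ?thesis by (simp only: has_integral_restrict_UNIV has_integral_Icc_iff_Ioo)
qed

text \<open>Closed values are found with the fundamental theorem of calculus and Cauchy's theorem,
  hence as gauge integrals; this rule carries them over to \<open>arcm\<close>.\<close>

lemma integral_arcm_eqI:
  fixes f :: "real \<Rightarrow> 'a::euclidean_space"
  assumes "a > -1" "f \<in> borel_measurable borel" "\<And>\<phi>. \<phi> \<in> rarc \<Longrightarrow> norm (f \<phi>) \<le> C"
    "((\<lambda>\<phi>. (2 * cos \<phi>) powr a *\<^sub>R f \<phi>) has_integral I) {-pi/2..pi/2}"
  shows "(\<integral>\<phi>. f \<phi> \<partial>arcm a) = I"
  using has_integral_arcm[OF assms(1-3)] assms(4) by (rule has_integral_unique)

section \<open>Fourier coefficients of the weight and their recursions\<close>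

lemma measurable_cis [measurable]: "cis \<in> borel_measurable borel"
  by (intro borel_measurable_continuous_onI continuous_intros)

lemma integral_arcm_Suc:
  fixes f :: "real \<Rightarrow> 'a::euclidean_space"
  assumes "f \<in> borel_measurable borel"
  shows "(\<integral>\<phi>. f \<phi> \<partial>arcm (a + 1)) = (\<integral>\<phi>. (2 * cos \<phi>) *\<^sub>R f \<phi> \<partial>arcm a)"
proof -
  have "indicator rarc \<phi> * (2 * cos \<phi>) powr (a + 1) = indicator rarc \<phi> * (2 * cos \<phi>) powr a * (2 * cos \<phi>)" for \<phi>
    using cos_arc_pos[of \<phi>] by (cases "\<phi> \<in> rarc") (auto simp: powr_add)
  then have e: "(\<lambda>\<phi>. (indicator rarc \<phi> * (2 * cos \<phi>) powr (a + 1)) *\<^sub>R f \<phi>)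
      = (\<lambda>\<phi>. (indicator rarc \<phi> * (2 * cos \<phi>) powr a) *\<^sub>R (2 * cos \<phi>) *\<^sub>R f \<phi>)"
    by (simp only: scaleR_scaleR)
  have "(\<integral>\<phi>. f \<phi> \<partial>arcm (a + 1)) = (\<integral>\<phi>. (indicator rarc \<phi> * (2 * cos \<phi>) powr (a + 1)) *\<^sub>R f \<phi> \<partial>lborel)"
    unfolding arcm_def by (rule integral_density) (use assms in auto)
  also have "\<dots> = (\<integral>\<phi>. (2 * cos \<phi>) *\<^sub>R f \<phi> \<partial>arcm a)"
    unfolding e arcm_def by (rule integral_density[symmetric]) (use assms in auto)
  finally show ?thesis .
qed

text \<open>Cauchy's integral, in general equal to \<pi> \<Gamma>(a+1) / (\<Gamma>(1 + (a+m)/2)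
  \<Gamma>(1 + (a-m)/2)). Only indices with m - a an integer are evaluated below.\<close>

definition arc_coeff :: "real \<Rightarrow> real \<Rightarrow> complex" where
  "arc_coeff a m = (\<integral>\<phi>. cis (m * \<phi>) \<partial>arcm a)"

lemma integrable_cis_arcm: "a > -1 \<Longrightarrow> integrable (arcm a) (\<lambda>\<phi>. cis (m * \<phi>))"
  by (rule integrable_arcm[where C = 1]) auto

text \<open>Integrates the exact derivative of \<open>cos_powr_has_integral\<close>. It links
  indices two apart, so the classes of m - a modulo 2 evolve separately.\<close>

lemma arc_coeff_rec:
  assumes "a > -1"
  shows "of_real (a + 1 + m) * arc_coeff a (m + 1) = of_real (a + 1 - m) * arc_coeff a (m - 1)"
proof -
  let ?f = "\<lambda>\<phi>. of_real (a + 1 + m) * cis ((m + 1) * \<phi>) - of_real (a + 1 - m) * cis ((m - 1) * \<phi>)"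
  have "(\<integral>\<phi>. ?f \<phi> \<partial>arcm a) = 0"
  proof (rule integral_arcm_eqI[OF assms])
    show "norm (?f \<phi>) \<le> \<bar>a + 1 + m\<bar> + \<bar>a + 1 - m\<bar>" for \<phi>
      by (rule order_trans[OF norm_triangle_ineq4]) (simp add: norm_mult del: of_real_add of_real_diff)
  qed (use cos_powr_has_integral[OF assms, of m] in auto)
  then show ?thesis
    using integrable_cis_arcm[OF assms] by (simp add: arc_coeff_def del: of_real_add of_real_diff)
qed

text \<open>Raising the exponent multiplies the density by 2 cos \<phi> = cis \<phi> + cis
  (-\<phi>). Read from right to left and combined with \<open>arc_coeff_rec\<close>, it transports
  values known for a > 0 down to a > -1.\<close>

lemma arc_coeff_Suc:
  assumes "a > -1"
  shows "arc_coeff (a + 1) m = arc_coeff a (m + 1) + arc_coeff a (m - 1)"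
proof -
  have "arc_coeff (a + 1) m = (\<integral>\<phi>. (2 * cos \<phi>) *\<^sub>R cis (m * \<phi>) \<partial>arcm a)"
    unfolding arc_coeff_def by (rule integral_arcm_Suc) auto
  also have "(\<lambda>\<phi>. (2 * cos \<phi>) *\<^sub>R cis (m * \<phi>)) = (\<lambda>\<phi>. cis ((m + 1) * \<phi>) + cis ((m - 1) * \<phi>))"
  proof
    fix \<phi>
    have "(2 * cos \<phi>) *\<^sub>R cis (m * \<phi>) = (cis \<phi> + cis (-\<phi>)) * cis (m * \<phi>)"
      by (simp add: complex_eq_iff algebra_simps)
    then show "(2 * cos \<phi>) *\<^sub>R cis (m * \<phi>) = cis ((m + 1) * \<phi>) + cis ((m - 1) * \<phi>)"
      by (simp add: algebra_simps cis_mult)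
  qed
  finally show ?thesis
    using integrable_cis_arcm[OF assms] by (simp add: arc_coeff_def)
qed

section \<open>Two Fourier coefficients in closed form\<close>

text \<open>Cauchy's theorem for the half disc; continuity on the boundary suffices.\<close>

lemma arc_segment_integral:
  fixes f :: "complex \<Rightarrow> complex"
  assumes "continuous_on (cball 0 1) f" "finite K"
    and "\<And>q. q \<in> ball 0 1 - K \<Longrightarrow> f field_differentiable at q"
  obtains I where "((\<lambda>\<phi>. cis \<phi> * f (cis \<phi>)) has_integral I) {-pi/2..pi/2}"
    "((\<lambda>u. f (\<i> * of_real u)) has_integral I) {-1..1}"
proof -
  obtain g where g: "\<And>q. q \<in> cball 0 1 \<Longrightarrow> (g has_field_derivative f q) (at q within cball 0 1)"
    using holomorphic_convex_primitive[of "cball (0::complex) 1" K f] assms by auto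
  have 1: "((\<lambda>\<phi>. (\<i> * cis \<phi>) * f (cis \<phi>)) has_integral ((g \<circ> cis) (pi/2) - (g \<circ> cis) (-pi/2))) {-pi/2..pi/2}"
  proof (rule fundamental_theorem_of_calculus)
    fix \<phi> :: real
    have "(cis has_vector_derivative \<i> * cis \<phi>) (at \<phi> within {-pi/2..pi/2})"
      by (auto intro!: derivative_eq_intros simp: has_vector_derivative_def scaleR_conv_of_real)
    moreover have "(g has_field_derivative f (cis \<phi>)) (at (cis \<phi>) within cis ` {-pi/2..pi/2})"
      by (rule DERIV_subset[OF g]) auto
    ultimately show "((g \<circ> cis) has_vector_derivative \<i> * cis \<phi> * f (cis \<phi>)) (at \<phi> within {-pi/2..pi/2})"
      by (rule field_vector_diff_chain_within)
  qed simp
  let ?h = "\<lambda>u. \<i> * complex_of_real u"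
  have 2: "((\<lambda>u. \<i> * f (?h u)) has_integral ((g \<circ> ?h) 1 - (g \<circ> ?h) (-1))) {-1..1}"
  proof (rule fundamental_theorem_of_calculus)
    fix u :: real assume u: "u \<in> {-1..1}"
    have "(?h has_vector_derivative \<i>) (at u within {-1..1})"
      by (auto intro!: derivative_eq_intros simp: has_vector_derivative_def scaleR_conv_of_real)
    moreover have "(g has_field_derivative f (?h u)) (at (?h u) within ?h ` {-1..1})"
      by (rule DERIV_subset[OF g]) (use u in \<open>auto simp: norm_mult\<close>)
    ultimately show "((g \<circ> ?h) has_vector_derivative \<i> * f (?h u)) (at u within {-1..1})"
      by (rule field_vector_diff_chain_within)
  qed simp
  have "cis (- pi / 2) = - \<i>" by (simp add: complex_eq_iff)
  then have D: "(g \<circ> cis) (pi/2) - (g \<circ> cis) (-pi/2) = g \<i> - g (-\<i>)"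
    by (simp add: cis_pi_half)
  show ?thesis
  proof
    \<comment> \<open>Both paths run from -i to i, with dq = i q d\<phi> on the arc and dq = i du on
      the segment; the common factor i is divided out.\<close>
    show "((\<lambda>\<phi>. cis \<phi> * f (cis \<phi>)) has_integral - \<i> * (g \<i> - g (-\<i>))) {-pi/2..pi/2}"
      using has_integral_mult_right[OF 1, of "-\<i>"] unfolding D by (simp add: mult.assoc[symmetric])
    show "((\<lambda>u. f (?h u)) has_integral - \<i> * (g \<i> - g (-\<i>))) {-1..1}"
      using has_integral_mult_right[OF 2, of "-\<i>"] by (simp add: mult.assoc[symmetric])
  qed
qed

text \<open>Since 1 + q^2 = 2 cos \<phi> * q on the circle and |\<phi>| < \<pi>/2, the principal
  logarithm is ln(2 cos \<phi>) + i \<phi>. The weight thus becomes a boundary value of a function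
  holomorphic in the disc.\<close>

lemma one_plus_cis_square_powr:
  assumes "\<phi> \<in> rarc"
  shows "(1 + (cis \<phi>)\<^sup>2) powr (of_real a) = (2 * cos \<phi>) powr a *\<^sub>R cis (a * \<phi>)"
proof -
  have c: "cos \<phi> > 0" by (rule cos_arc_pos) fact
  have "1 + (cis \<phi>)\<^sup>2 = cis \<phi> * (cis \<phi> + cis (-\<phi>))"
    by (simp add: power2_eq_square distrib_left cis_mult)
  also have "cis \<phi> + cis (-\<phi>) = of_real (2 * cos \<phi>)" by (simp add: complex_eq_iff)
  also have "cis \<phi> * of_real (2 * cos \<phi>) = exp (of_real (ln (2 * cos \<phi>)) + \<i> * of_real \<phi>)"
    using c by (simp add: exp_add cis_conv_exp exp_of_real[symmetric] exp_Ln ln_mult mult_ac flip: of_real_mult)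
       (simp add: exp_of_real exp_add)
  finally have e: "1 + (cis \<phi>)\<^sup>2 = exp (of_real (ln (2 * cos \<phi>)) + \<i> * of_real \<phi>)" .
  have "\<bar>\<phi>\<bar> < pi" using assms by auto
  then have l: "Ln (1 + (cis \<phi>)\<^sup>2) = of_real (ln (2 * cos \<phi>)) + \<i> * of_real \<phi>"
    unfolding e by (intro Ln_exp) auto
  have "(1 + (cis \<phi>)\<^sup>2) powr (of_real a) = exp (of_real a * (of_real (ln (2 * cos \<phi>)) + \<i> * of_real \<phi>))"
    unfolding powr_def l by (auto simp: e)
  also have "\<dots> = exp (of_real (a * ln (2 * cos \<phi>))) * cis (a * \<phi>)"
    by (simp add: exp_add distrib_left cis_conv_exp mult_ac)
  also have "exp (of_real (a * ln (2 * cos \<phi>))) = (of_real ((2 * cos \<phi>) powr a) :: complex)"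
    using c by (simp add: powr_def exp_of_real flip: of_real_mult)
  finally show ?thesis by (simp add: scaleR_conv_of_real)
qed

lemma Re_one_plus_square:
  assumes "norm (q::complex) \<le> 1"
  shows "Re (1 + q\<^sup>2) \<ge> 0" "norm q < 1 \<Longrightarrow> Re (1 + q\<^sup>2) > 0"
proof -
  have "- Re (q\<^sup>2) \<le> norm q ^ 2"
    using abs_Re_le_cmod[of "q^2"] by (simp add: norm_power)
  moreover have "norm q ^ 2 \<le> 1" "norm q < 1 \<Longrightarrow> norm q ^ 2 < 1"
    using assms by (auto simp: power_le_one power_less_one_iff abs_square_less_1)
  ultimately show "Re (1 + q\<^sup>2) \<ge> 0" "norm q < 1 \<Longrightarrow> Re (1 + q\<^sup>2) > 0" by auto
qed

text \<open>On the closed disc 1 + q^2 stays in the closed right half plane. Its zeros i and -i lie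
  on the boundary, and a > 0 makes the power continuous there.\<close>

lemma one_plus_square_powr:
  assumes "a > 0"
  shows "continuous_on (cball 0 1) (\<lambda>q::complex. (1 + q\<^sup>2) powr of_real a)"
    and "q \<in> ball 0 1 \<Longrightarrow> ((\<lambda>q::complex. (1 + q\<^sup>2) powr of_real a) has_field_derivative
           of_real a * (1 + q\<^sup>2) powr (of_real a - 1) * (2 * q)) (at q)"
proof -
  show "continuous_on (cball 0 1) (\<lambda>q::complex. (1 + q\<^sup>2) powr of_real a)"
    using Re_one_plus_square assms by (intro continuous_intros) auto
  assume "q \<in> ball 0 1"
  then have "Re (1 + q\<^sup>2) > 0" using Re_one_plus_square[of q] by auto
  then have n: "1 + q\<^sup>2 \<notin> \<real>\<^sub>\<le>\<^sub>0" by (auto simp: complex_nonpos_Reals_iff)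
  show "((\<lambda>q::complex. (1 + q\<^sup>2) powr of_real a) has_field_derivative
           of_real a * (1 + q\<^sup>2) powr (of_real a - 1) * (2 * q)) (at q)"
    by (rule DERIV_chain2[where f = "\<lambda>z. z powr of_real a" and g = "\<lambda>q. 1 + q\<^sup>2", OF has_field_derivative_powr[OF n]]) (auto intro!: derivative_eq_intros)
qed

text \<open>On the arc the integrand is (1 + q^2)^a = 1 + q k(q). The constant 1 contributes \<pi>,
  and q k(q) contributes the integral of the odd function k along the segment, which is 0.\<close>

lemma arc_coeff_diag_pos:
  assumes "a > 0"
  shows "arc_coeff a a = of_real pi"
proof -
  let ?h = "\<lambda>q::complex. (1 + q\<^sup>2) powr of_real a"
  \<comment> \<open>The value 0 at the origin is the limit of the quotient, because
    \<open>?h\<close> is even in q and has derivative 0 there.\<close>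
  define k where "k q = (if q = 0 then 0 else (?h q - 1) / q)" for q
  have h0: "(?h has_field_derivative 0) (at 0)"
    using one_plus_square_powr(2)[OF assms, of 0] by simp
  have diff: "k field_differentiable (at q)" if "q \<in> ball 0 1 - {0}" for q
  proof -
    have "((\<lambda>q. (?h q - 1) / q) has_field_derivative
        ((of_real a * (1 + q\<^sup>2) powr (of_real a - 1) * (2 * q)) * q - (?h q - 1) * 1) / (q * q)) (at q)"
      using that by (intro DERIV_divide DERIV_cong[OF DERIV_diff[OF one_plus_square_powr(2)[OF assms]]] DERIV_ident DERIV_const) auto
    then have "(k has_field_derivative
        ((of_real a * (1 + q\<^sup>2) powr (of_real a - 1) * (2 * q)) * q - (?h q - 1) * 1) / (q * q)) (at q)"
      by (rule has_field_derivative_transform_within_open[where S = "ball 0 1 - {0}"])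
         (use that in \<open>auto simp: k_def open_delete\<close>)
    then show ?thesis by (auto simp: field_differentiable_def)
  qed
  have cont: "continuous_on (cball 0 1) k"
    unfolding continuous_on_eq_continuous_within
  proof
    fix q :: complex assume q: "q \<in> cball 0 1"
    show "continuous (at q within cball 0 1) k"
    proof (cases "q = 0")
      case True
      have "((\<lambda>q. (?h q - ?h 0) / (q - 0)) \<longlongrightarrow> 0) (at 0)"
        using h0 by (simp only: has_field_derivative_iff)
      then have "(k \<longlongrightarrow> 0) (at 0)"
        by (rule Lim_transform_eventually) (auto simp: k_def eventually_at intro!: exI[of _ 1])
      then have "(k \<longlongrightarrow> k 0) (at 0)" by (simp add: k_def)
      then show ?thesis
        unfolding True continuous_within by (rule tendsto_within_subset) auto
    next
      case False
      have "continuous_on (cball 0 1 - {0}) (\<lambda>q. (?h q - 1) / q)"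
        by (intro continuous_on_divide continuous_on_diff continuous_on_subset[OF one_plus_square_powr(1)[OF assms]] continuous_intros) auto
      then have "continuous_on (cball 0 1 - {0}) k"
        by (rule continuous_on_eq) (auto simp: k_def)
      then have "continuous (at q within (cball 0 1 - {0})) k"
        using q False by (simp add: continuous_on_eq_continuous_within)
      moreover have "at q within (cball 0 1 - {0}) = at q within (cball 0 1)"
        using False by (intro at_within_nhd[of q "-{0}"]) auto
      ultimately show ?thesis by (simp add: continuous_within)
    qed
  qed
  obtain I where I: "((\<lambda>\<phi>. cis \<phi> * k (cis \<phi>)) has_integral I) {-pi/2..pi/2}"
    "((\<lambda>u. k (\<i> * of_real u)) has_integral I) {-1..1}"
    using arc_segment_integral[OF cont, of "{0}"] diff by auto
  \<comment> \<open>Reflecting the segment at 0 therefore changes the sign of its integral, which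
    forces I = -I.\<close>
  have "k (-q) = - k q" for q by (simp add: k_def)
  then have "((\<lambda>u. k (\<i> * of_real u)) has_integral - I) {-1..1}"
    using has_integral_reflect_real[THEN iffD2, OF I(2)]
    by (simp add: has_integral_neg_iff)
  then have "I = - I" by (rule has_integral_unique[OF I(2)])
  then have "I = 0" by (simp add: complex_eq_iff)
  have "((\<lambda>\<phi>. cis \<phi> * k (cis \<phi>) + 1) has_integral (I + of_real pi)) {-pi/2..pi/2}"
    using has_integral_const_real[of "1::complex" "-pi/2" "pi/2"]
    by (intro has_integral_add I) (simp add: scaleR_conv_of_real)
  then have *: "((\<lambda>\<phi>. ?h (cis \<phi>)) has_integral (of_real pi)) {-pi/2..pi/2}"
    using \<open>I = 0\<close> by (simp add: k_def)
  have "((\<lambda>\<phi>. (2 * cos \<phi>) powr a *\<^sub>R cis (a * \<phi>)) has_integral (of_real pi)) {-pi/2..pi/2}"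
    unfolding has_integral_Icc_iff_Ioo
    by (rule has_integral_eq[OF one_plus_cis_square_powr *[unfolded has_integral_Icc_iff_Ioo]])
  then show ?thesis
    unfolding arc_coeff_def using assms by (intro integral_arcm_eqI[where C = 1]) auto
qed

text \<open>Lowering \<open>a\<close> by one keeps the diagonal coefficient because \<open>arc_coeff a (a + 2) = 0\<close>.\<close>

lemma arc_coeff_diag:
  assumes "a > -1"
  shows "arc_coeff a a = of_real pi"
proof -
  have "arc_coeff a (a + 2) = 0"
    using arc_coeff_rec[OF assms, of "a + 1"] assms by (simp add: add_ac complex_eq_iff)
  then have "arc_coeff a a = arc_coeff (a + 1) (a + 1)"
    using arc_coeff_Suc[OF assms, of "a + 1"] by (simp add: add_ac)
  then show ?thesis using arc_coeff_diag_pos[of "a + 1"] assms by simp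
qed

lemma Gamma_plus1_real: "x > 0 \<Longrightarrow> Gamma (x + 1) = x * Gamma (x::real)"
  using Gamma_plus1[of x] nonpos_Ints_nonpos[of x] by linarith

lemma Gamma_legendre_duplication_real:
  fixes x :: real
  assumes "x > 0"
  shows "Gamma x * Gamma (x + 1/2) = 2 powr (1 - 2 * x) * sqrt pi * Gamma (2 * x)"
proof -
  have "complex_of_real (Gamma x * Gamma (x + 1/2)) = of_real (2 powr (1 - 2 * x) * sqrt pi * Gamma (2 * x))"
  proof -
    have n: "complex_of_real y \<notin> \<int>\<^sub>\<le>\<^sub>0" if "y > 0" for y
      using that nonpos_Ints_nonpos[of y] of_real_in_nonpos_Ints_iff[of y, where 'a = complex] by auto
    have "Gamma (complex_of_real x) * Gamma (of_real (x + 1/2)) =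
        exp (of_real ((1 - 2 * x) * ln 2)) * of_real (sqrt pi) * Gamma (of_real (2 * x))"
      using Gamma_legendre_duplication[of "of_real x"] n[of x] n[of "x + 1/2"] assms by simp
    moreover have "exp (complex_of_real ((1 - 2 * x) * ln 2)) = of_real (2 powr (1 - 2 * x))"
      unfolding exp_of_real by (simp add: powr_def)
    ultimately show ?thesis
      by (simp only: Gamma_complex_of_real[symmetric] of_real_mult)
  qed
  then show ?thesis by (simp only: of_real_eq_iff)
qed

text \<open>The substitution t = (u+1)/2 gives 1 - u^2 = 4 t (1 - t), hence 4^a times twice a Beta
  value with equal arguments; the duplication formula simplifies it.\<close>

lemma has_integral_one_minus_square_powr:
  assumes "a > -1"
  shows "((\<lambda>u::real. (1 - u\<^sup>2) powr a) has_integral (sqrt pi * Gamma (a + 1) / Gamma (a + 3/2))) {-1..1}"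
proof -
  have "((\<lambda>t. t powr a * (1 - t) powr a) has_integral Beta (a + 1) (a + 1)) (cbox 0 1)"
    using has_integral_Beta_real[of "a + 1" "a + 1"] assms by simp
  from has_integral_affinity'[OF this, of "1/2" "1/2"]
  have "((\<lambda>u. ((u + 1) / 2) powr a * (1 - (u + 1) / 2) powr a) has_integral 2 * Beta (a + 1) (a + 1)) {-1..1}"
    by (simp add: add_divide_distrib)
  from has_integral_mult_right[OF this, of "4 powr a"]
  have "((\<lambda>u. (1 - u\<^sup>2) powr a) has_integral 4 powr a * (2 * Beta (a + 1) (a + 1))) {-1..1}"
  proof (rule has_integral_eq[rotated])
    fix u :: real assume "u \<in> {-1..1}"
    then have "4 powr a * (((u + 1) / 2) powr a * (1 - (u + 1) / 2) powr a) = (4 * ((u + 1) / 2 * (1 - (u + 1) / 2))) powr a"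
      using powr_mult[of "(u + 1) / 2" "1 - (u + 1) / 2" a]
        powr_mult[of 4 "(u + 1) / 2 * (1 - (u + 1) / 2)" a] by simp
    also have "4 * ((u + 1) / 2 * (1 - (u + 1) / 2)) = 1 - u\<^sup>2"
      by (simp add: field_simps power2_eq_square)
    finally show "4 powr a * (((u + 1) / 2) powr a * (1 - (u + 1) / 2) powr a) = (1 - u\<^sup>2) powr a" .
  qed
  moreover have "4 powr a * (2 * Beta (a + 1) (a + 1)) = sqrt pi * Gamma (a + 1) / Gamma (a + 3/2)"
  proof -
    have G: "Gamma (a + 1) * Gamma (a + 1 + 1/2) = 2 powr (1 - 2 * (a + 1)) * sqrt pi * Gamma (2 * (a + 1))"
      by (rule Gamma_legendre_duplication_real) (use assms in simp)
    have pos: "Gamma (a + 1) > 0" "Gamma (a + 3/2) > 0" "Gamma (2 * a + 2) > 0"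
      using assms by (auto intro!: Gamma_real_pos)
    have e: "4 powr a * 2 * 2 powr (1 - 2 * (a + 1)) = (1::real)"
    proof -
      have "(4::real) powr a = 2 powr (2 * a)" using powr_powr[of 2 2 a] by simp
      then show ?thesis by (simp add: powr_diff powr_add algebra_simps)
    qed
    have "4 powr a * (2 * Beta (a + 1) (a + 1)) * Gamma (a + 3/2)
        = 4 powr a * 2 * Gamma (a + 1) / Gamma (2 * a + 2) * (Gamma (a + 1) * Gamma (a + 1 + 1/2))"
      by (simp add: Beta_def add_ac mult_ac)
    also have "\<dots> = (4 powr a * 2 * 2 powr (1 - 2 * (a + 1))) * sqrt pi * Gamma (a + 1)"
      unfolding G using pos by (simp add: algebra_simps)
    finally show ?thesis unfolding e using pos by (simp add: field_simps)
  qed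
  ultimately show ?thesis by simp
qed

text \<open>The extra factor cis \<phi> is exactly the one that \<open>arc_segment_integral\<close>
  supplies. On the segment q = i u, so (1 + q^2)^a = (1 - u^2)^a and the Beta integral
  applies.\<close>

lemma arc_coeff_Suc_diag_pos:
  assumes "a > 0"
  shows "arc_coeff a (a + 1) = of_real (sqrt pi * Gamma (a + 1) / Gamma (a + 3/2))"
proof -
  let ?h = "\<lambda>q::complex. (1 + q\<^sup>2) powr of_real a"
  obtain I where I: "((\<lambda>\<phi>. cis \<phi> * ?h (cis \<phi>)) has_integral I) {-pi/2..pi/2}"
    "((\<lambda>u. ?h (\<i> * of_real u)) has_integral I) {-1..1}"
    using arc_segment_integral[OF one_plus_square_powr(1)[OF assms], of "{}"] one_plus_square_powr(2)[OF assms]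
    by (auto simp: field_differentiable_def)
  have "((\<lambda>u. complex_of_real ((1 - u\<^sup>2) powr a)) has_integral
      of_real (sqrt pi * Gamma (a + 1) / Gamma (a + 3/2))) {-1..1}"
    using has_integral_one_minus_square_powr[of a] assms by (intro has_integral_of_real) auto
  moreover have "?h (\<i> * of_real u) = of_real ((1 - u\<^sup>2) powr a)" if "u \<in> {-1..1}" for u
  proof -
    have "u\<^sup>2 \<le> 1" using that by (auto simp: abs_square_le_1)
    then show ?thesis using powr_of_real[of "1 - u^2" a] by (simp add: power_mult_distrib)
  qed
  ultimately have "((\<lambda>u. ?h (\<i> * of_real u)) has_integral
      of_real (sqrt pi * Gamma (a + 1) / Gamma (a + 3/2))) {-1..1}"
    by (rule has_integral_eq[OF sym, rotated])
  then have eq: "I = of_real (sqrt pi * Gamma (a + 1) / Gamma (a + 3/2))"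
    using I(2) has_integral_unique by blast
  have "((\<lambda>\<phi>. (2 * cos \<phi>) powr a *\<^sub>R cis ((a + 1) * \<phi>)) has_integral I) {-pi/2..pi/2}"
    unfolding has_integral_Icc_iff_Ioo
    by (rule has_integral_eq[OF _ I(1)[unfolded has_integral_Icc_iff_Ioo]])
       (simp only: one_plus_cis_square_powr, simp add: cis_mult algebra_simps)
  then show ?thesis
    unfolding arc_coeff_def eq using assms by (intro integral_arcm_eqI[where C = 1]) auto
qed

text \<open>The coefficient for a + 1 is the sum of those of a at a + 3 and a + 1, and the recursion
  expresses the former by the latter. So the value known at a + 1 > 0 determines the one at
  a.\<close>

lemma arc_coeff_Suc_diag:
  assumes "a > -1"
  shows "arc_coeff a (a + 1) = of_real (sqrt pi * Gamma (a + 1) / Gamma (a + 3/2))"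
proof -
  let ?q = "sqrt pi * Gamma (a + 1) / Gamma (a + 3/2)"
  let ?r = "sqrt pi * ((a + 1) * Gamma (a + 1)) / ((a + 3/2) * Gamma (a + 3/2))"
  have r: "of_real (2 * a + 3) * arc_coeff a (a + 3) = - arc_coeff a (a + 1)"
    using arc_coeff_rec[OF assms, of "a + 2"] by (simp add: algebra_simps)
  have "of_real (2 * a + 3) * arc_coeff (a + 1) (a + 2) = of_real (2 * a + 3) * arc_coeff a (a + 3) + of_real (2 * a + 3) * arc_coeff a (a + 1)"
    using arc_coeff_Suc[OF assms, of "a + 2"] by (simp add: algebra_simps)
  also have "\<dots> = of_real (2 * a + 2) * arc_coeff a (a + 1)"
    unfolding r by (simp add: algebra_simps)
  finally have "of_real (2 * a + 2) * arc_coeff a (a + 1) = of_real (2 * a + 3) * arc_coeff (a + 1) (a + 2)" by simp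
  also have "arc_coeff (a + 1) (a + 2) = of_real (sqrt pi * Gamma (a + 2) / Gamma (a + 5/2))"
    using arc_coeff_Suc_diag_pos[of "a + 1"] assms by (simp add: add_ac)
  also have "Gamma (a + 2) = (a + 1) * Gamma (a + 1)"
    using Gamma_plus1_real[of "a + 1"] assms by (simp add: add_ac)
  also have "Gamma (a + 5/2) = (a + 3/2) * Gamma (a + 3/2)"
    using Gamma_plus1_real[of "a + 3/2"] assms by (simp add: add_ac)
  finally have "of_real (2 * a + 2) * arc_coeff a (a + 1)
     = complex_of_real ((2 * a + 3) * ?r)"
    by (simp only: of_real_mult)
  also have "(2 * a + 3) * ?r
     = (2 * a + 2) * ?q"
    using assms Gamma_real_pos[of "a + 3/2"] by (simp add: divide_simps) (simp add: algebra_simps)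
  finally have "complex_of_real (2 * a + 2) * arc_coeff a (a + 1)
      = of_real (2 * a + 2) * of_real ?q"
    by (simp only: of_real_mult)
  moreover have "complex_of_real (2 * a + 2) \<noteq> 0" using assms by (simp only: of_real_eq_0_iff)
  ultimately show ?thesis by (metis mult_left_cancel)
qed

section \<open>The power series and its integral representation\<close>

definition bcoeff :: "real \<Rightarrow> nat \<Rightarrow> real" where
  "bcoeff \<beta> k = (-1) ^ k / fact k * rGamma (\<beta> + real k + 1)"

text \<open>In this notation \<open>J\<^sub>\<nu> x = (x/2)\<^sup>\<nu> * bser \<nu> ((x/2)\<^sup>2)\<close>.\<close>

definition bser :: "real \<Rightarrow> 'a::{real_normed_field,banach} \<Rightarrow> 'a" where
  "bser \<beta> y = (\<Sum>k. of_real (bcoeff \<beta> k) * y ^ k)"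

text \<open>From \<open>rGamma x = x * rGamma (x + 1)\<close> the absolute value does not increase
  once x \<ge> 1; the finitely many earlier terms are bounded by their sum.\<close>

lemma rGamma_shift_bounded: "\<exists>K\<ge>0. \<forall>k::nat. \<bar>rGamma (\<beta> + real k + 1 :: real)\<bar> \<le> K"
proof -
  obtain N :: nat where "- \<beta> \<le> real N" using real_arch_simple by blast
  then have N: "\<beta> + real N \<ge> 0" by simp
  define K where "K = (\<Sum>k\<le>N. \<bar>rGamma (\<beta> + real k + 1)\<bar>)"
  have small: "\<bar>rGamma (\<beta> + real k + 1)\<bar> \<le> K" if "k \<le> N" for k
    unfolding K_def using that by (intro member_le_sum) auto
  have "\<bar>rGamma (\<beta> + real (N + j) + 1)\<bar> \<le> K" for j
  proof (induction j)
    case 0 show ?case using small[of N] by simp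
  next
    case (Suc j)
    let ?x = "\<beta> + real (N + j) + 1"
    have "?x \<ge> 1" using N by simp
    have "\<bar>rGamma (?x + 1)\<bar> \<le> ?x * \<bar>rGamma (?x + 1)\<bar>"
      using \<open>?x \<ge> 1\<close> mult_right_mono[of 1 ?x "\<bar>rGamma (?x + 1)\<bar>"] by simp
    also have "\<dots> = \<bar>rGamma ?x\<bar>" using \<open>?x \<ge> 1\<close> rGamma_plus1[of ?x] by (metis abs_mult abs_of_nonneg order_trans zero_le_one)
    also note Suc.IH
    finally show ?case by (simp add: add_ac)
  qed
  then have "\<bar>rGamma (\<beta> + real k + 1)\<bar> \<le> K" for k
    by (metis le_Suc_ex nat_le_linear small)
  moreover have "K \<ge> 0" by (simp add: K_def sum_nonneg)
  ultimately show ?thesis by blast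
qed

lemma bcoeff_bounded: "\<exists>K\<ge>0. \<forall>k. \<bar>bcoeff \<beta> k\<bar> \<le> K / fact k"
  using rGamma_shift_bounded[of \<beta>] by (auto simp: bcoeff_def abs_mult divide_right_mono)

lemma summable_norm_bser:
  "summable (\<lambda>k. norm (of_real (bcoeff \<beta> k) * y ^ k :: 'a::{real_normed_field,banach}))"
proof -
  obtain K where K: "\<And>k. \<bar>bcoeff \<beta> k\<bar> \<le> K / fact k" using bcoeff_bounded by blast
  have "summable (\<lambda>k. K * (norm y ^ k /\<^sub>R fact k))"
    by (intro summable_mult summable_exp_generic)
  then show ?thesis
  proof (rule summable_comparison_test'[where N = 0])
    fix k
    have "norm (of_real (bcoeff \<beta> k) * y ^ k :: 'a) = \<bar>bcoeff \<beta> k\<bar> * norm y ^ k"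
      by (simp add: norm_mult norm_power)
    also have "\<dots> \<le> K / fact k * norm y ^ k" by (intro mult_right_mono K) auto
    finally show "norm (norm (of_real (bcoeff \<beta> k) * y ^ k :: 'a)) \<le> K * (norm y ^ k /\<^sub>R fact k)"
      by (simp add: field_simps)
  qed
qed

lemma summable_bser: "summable (\<lambda>k. of_real (bcoeff \<beta> k) * (y::'a::{real_normed_field,banach}) ^ k)"
  using summable_norm_bser by (rule summable_norm_cancel)

lemma sums_bser: "(\<lambda>k. of_real (bcoeff \<beta> k) * y ^ k) sums bser \<beta> (y::'a::{real_normed_field,banach})"
  unfolding bser_def using summable_bser by (rule summable_sums)

lemma bser_of_real: "bser \<beta> (of_real y :: 'a::{real_normed_field,banach}) = of_real (bser \<beta> y)"
  using sums_of_real[OF sums_bser[of \<beta> y], where 'a = 'a] by (simp add: bser_def sums_iff)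

lemma bser_0: "bser \<beta> 0 = of_real (rGamma (\<beta> + 1))"
  unfolding bser_def by (subst powser_zero) (simp add: bcoeff_def)

lemma diffs_bcoeff: "diffs (bcoeff \<beta>) k = - bcoeff (\<beta> + 1) k"
  by (simp add: diffs_def bcoeff_def divide_simps add_ac)

text \<open>The rule that x^(-\<nu>) J_\<nu> has derivative -x^(-\<nu>) J_(\<nu>+1), in the variable
  y = (x/2)^2.\<close>

lemma has_field_derivative_bser:
  "(bser \<beta> has_field_derivative - bser (\<beta> + 1) y) (at (y::'a::{real_normed_field,banach}))"
proof -
  have "((\<lambda>y. \<Sum>k. of_real (bcoeff \<beta> k) * y ^ k) has_field_derivative
      (\<Sum>k. diffs (\<lambda>k. of_real (bcoeff \<beta> k)) k * y ^ k)) (at y)"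
    by (rule termdiffs_strong_converges_everywhere) (rule summable_bser)
  also have "(\<lambda>k. diffs (\<lambda>k. of_real (bcoeff \<beta> k) :: 'a) k) = (\<lambda>k. - of_real (bcoeff (\<beta> + 1) k))"
    using diffs_bcoeff[of \<beta>] by (metis diffs_of_real of_real_minus)
  also have "(\<Sum>k. - of_real (bcoeff (\<beta> + 1) k) * y ^ k) = - bser (\<beta> + 1) y"
    unfolding bser_def using suminf_minus[OF summable_bser[of "\<beta> + 1" y]] by simp
  finally show ?thesis by (simp add: bser_def[abs_def])
qed

text \<open>The three-term recurrence J_(\<beta>-1) + J_(\<beta>+1) = (2 \<beta>/x) J_\<beta>,
  divided by (x/2)^(\<beta>-1). Coefficientwise it is the functional equation of 1/\<Gamma>.\<close>

lemma bser_rec: "bser (\<beta> - 1) y = of_real \<beta> * bser \<beta> y - y * bser (\<beta> + 1) (y::'a::{real_normed_field,banach})"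
proof -
  have c: "bcoeff (\<beta> - 1) (Suc k) = \<beta> * bcoeff \<beta> (Suc k) - bcoeff (\<beta> + 1) k" for k
  proof -
    have "rGamma (\<beta> + real k + 1) = (\<beta> + real k + 1) * rGamma (\<beta> + real k + 1 + 1)"
      by (rule rGamma_plus1[symmetric])
    then show ?thesis
      by (simp add: bcoeff_def divide_simps add_ac) (simp add: algebra_simps)
  qed
  have c0: "bcoeff (\<beta> - 1) 0 = \<beta> * bcoeff \<beta> 0"
    using rGamma_plus1[of \<beta>] by (simp add: bcoeff_def)
  have "(\<lambda>k. of_real \<beta> * (of_real (bcoeff \<beta> (Suc k)) * y ^ Suc k)) sums
      (of_real \<beta> * (bser \<beta> y - of_real (bcoeff \<beta> 0)))"
    using sums_bser[of \<beta> y] by (intro sums_mult) (subst sums_Suc_iff, simp)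
  moreover have "(\<lambda>k. y * (of_real (bcoeff (\<beta> + 1) k) * y ^ k)) sums (y * bser (\<beta> + 1) y)"
    by (intro sums_mult sums_bser)
  ultimately have "(\<lambda>k. of_real \<beta> * (of_real (bcoeff \<beta> (Suc k)) * y ^ Suc k)
      - y * (of_real (bcoeff (\<beta> + 1) k) * y ^ k)) sums
      (of_real \<beta> * (bser \<beta> y - of_real (bcoeff \<beta> 0)) - y * bser (\<beta> + 1) y)"
    by (rule sums_diff)
  also have "(\<lambda>k. of_real \<beta> * (of_real (bcoeff \<beta> (Suc k)) * y ^ Suc k)
      - y * (of_real (bcoeff (\<beta> + 1) k) * y ^ k)) = (\<lambda>k. of_real (bcoeff (\<beta> - 1) (Suc k)) * y ^ Suc k)"
    by (simp add: c algebra_simps)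
  finally have "(\<lambda>k. of_real (bcoeff (\<beta> - 1) k) * y ^ k) sums
      (of_real \<beta> * (bser \<beta> y - of_real (bcoeff \<beta> 0)) - y * bser (\<beta> + 1) y + of_real (bcoeff (\<beta> - 1) 0))"
    by (subst (asm) sums_Suc_iff) simp
  then have "bser (\<beta> - 1) y = of_real \<beta> * (bser \<beta> y - of_real (bcoeff \<beta> 0)) - y * bser (\<beta> + 1) y + of_real (bcoeff (\<beta> - 1) 0)"
    using sums_unique2[OF sums_bser] by blast
  then show ?thesis by (simp add: c0 algebra_simps)
qed

text \<open>At m = a + 1 the right factor a + 1 - m of the recursion vanishes, and the zero
  propagates upwards in steps of two.\<close>

lemma arc_coeff_odd:
  assumes "a > -1"
  shows "arc_coeff a (a + 2 + 2 * real k) = 0"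
proof (induction k)
  case 0
  show ?case using arc_coeff_rec[OF assms, of "a + 1"] assms by (simp add: add_ac complex_eq_iff)
next
  case (Suc k)
  have "of_real (2 * a + 4 + 2 * real k) * arc_coeff a (a + 4 + 2 * real k) = 0"
    using arc_coeff_rec[OF assms, of "a + 3 + 2 * real k"] Suc.IH by (simp add: algebra_simps)
  moreover have "complex_of_real (2 * a + 4 + 2 * real k) \<noteq> 0"
    unfolding of_real_eq_0_iff using assms by simp
  ultimately have "arc_coeff a (a + 4 + 2 * real k) = 0" by (metis mult_eq_0_iff)
  then show ?case by (simp add: algebra_simps)
qed

text \<open>Iterates the ratio -(1 + 2k)/(2a + 3 + 2k) from \<open>arc_coeff_Suc_diag\<close>. The
  form (2k)!/(4^k k!) is chosen to cancel against t^(2k)/(2k)! in the exponential series, leaving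
  (t/2)^(2k)/k!.\<close>

lemma arc_coeff_even:
  assumes "a > -1"
  shows "arc_coeff a (a + 1 + 2 * real k) =
    of_real ((-1) ^ k * fact (2 * k) / (4 ^ k * fact k) * rGamma (a + 3/2 + real k) * (sqrt pi * Gamma (a + 1)))"
proof (induction k)
  case 0
  show ?case using arc_coeff_Suc_diag[OF assms] by (simp add: rGamma_inverse_Gamma field_simps)
next
  case (Suc k)
  have nz: "complex_of_real (2 * a + 3 + 2 * real k) \<noteq> 0"
    unfolding of_real_eq_0_iff using assms by simp
  have "of_real (2 * a + 3 + 2 * real k) * arc_coeff a (a + 3 + 2 * real k) = of_real (- 1 - 2 * real k) * arc_coeff a (a + 1 + 2 * real k)"
    using arc_coeff_rec[OF assms, of "a + 2 + 2 * real k"] by (simp add: algebra_simps)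
  also have "\<dots> = of_real ((2 * a + 3 + 2 * real k) * ((-1) ^ Suc k * fact (2 * Suc k) / (4 ^ Suc k * fact (Suc k)) * rGamma (a + 3/2 + real (Suc k)) * (sqrt pi * Gamma (a + 1))))"
  proof -
    have "rGamma (a + 3/2 + real k) = (a + 3/2 + real k) * rGamma (a + 3/2 + real k + 1)"
      by (rule rGamma_plus1[symmetric])
    moreover have "a + 3/2 + real (Suc k) = a + 3/2 + real k + 1" by simp
    moreover have "(- 1 - 2 * real k) * ((-1) ^ k * fact (2 * k) / (4 ^ k * fact k) * ((a + 3/2 + real k) * R) * G)
      = (2 * a + 3 + 2 * real k) * ((-1) ^ Suc k * fact (2 * Suc k) / (4 ^ Suc k * fact (Suc k)) * R * G)" for R G :: real
      by (simp add: divide_simps) (simp add: algebra_simps)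
    ultimately show ?thesis unfolding Suc.IH of_real_mult[symmetric] of_real_eq_iff by (simp only:)
  qed
  finally have "arc_coeff a (a + 3 + 2 * real k) = of_real ((-1) ^ Suc k * fact (2 * Suc k) / (4 ^ Suc k * fact (Suc k)) * rGamma (a + 3/2 + real (Suc k)) * (sqrt pi * Gamma (a + 1)))"
    unfolding of_real_mult[of "2 * a + 3 + 2 * real k"] using nz by (metis mult_left_cancel)
  then show ?case by (simp only: of_nat_Suc) (simp add: algebra_simps)
qed

text \<open>The normalisation of Poisson's integral: the inverse of the factor common to all values
  in \<open>arc_coeff_even\<close> at a = \<nu> - 1/2.\<close>

definition pc :: "real \<Rightarrow> real" where "pc \<nu> = inverse (sqrt pi * Gamma (\<nu> + 1/2))"

text \<open>The odd coefficients vanish (\<open>arc_coeff_odd\<close>), so that the exponential series reduces to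
  the even Bessel series.\<close>

lemma bser_angular:
  assumes "\<nu> > - 1/2"
  shows "complex_of_real (bser \<nu> ((t / 2)\<^sup>2)) =
    of_real (pc \<nu>) * (\<integral>\<phi>. cis ((\<nu> + 1/2) * \<phi>) * exp (- (of_real t * cis \<phi>)) \<partial>arcm (\<nu> - 1/2))"
proof -
  let ?w = "\<lambda>\<phi>. cis ((\<nu> + 1/2) * \<phi>) * exp (- (of_real t * cis \<phi>))"
  let ?Z = "sqrt pi * Gamma (\<nu> + 1/2)"
  let ?b = "\<lambda>k. of_real (bcoeff \<nu> k * ((t/2)\<^sup>2) ^ k)"
  have a: "\<nu> - 1/2 > -1" using assms by simp
  let ?M = "arcm (\<nu> - 1/2)"
  let ?f = "\<lambda>k \<phi>. of_real ((-t) ^ k / fact k) * cis ((\<nu> + 1/2 + real k) * \<phi>)"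
  have exps: "(\<lambda>k. ?f k \<phi>) sums ?w \<phi>" for \<phi>
  proof -
    have "(\<lambda>k. cis ((\<nu> + 1/2) * \<phi>) * ((- (of_real t * cis \<phi>)) ^ k /\<^sub>R fact k)) sums ?w \<phi>"
      by (intro sums_mult exp_converges)
    also have "(\<lambda>k. cis ((\<nu> + 1/2) * \<phi>) * ((- (of_real t * cis \<phi>)) ^ k /\<^sub>R fact k)) = (\<lambda>k. ?f k \<phi>)"
    proof
      fix k
      have "(- (of_real t * cis \<phi>)) ^ k = of_real ((-t) ^ k) * cis (real k * \<phi>)"
        unfolding mult_minus_left[symmetric] power_mult_distrib using Complex.DeMoivre[of \<phi> k] by simp
      moreover have "cis ((\<nu> + 1/2 + real k) * \<phi>) = cis ((\<nu> + 1/2) * \<phi>) * cis (real k * \<phi>)"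
        by (simp only: distrib_right cis_mult)
      ultimately show "cis ((\<nu> + 1/2) * \<phi>) * ((- (of_real t * cis \<phi>)) ^ k /\<^sub>R fact k) = ?f k \<phi>"
        by (simp only: scaleR_conv_of_real divide_inverse of_real_mult mult_ac)
    qed
    finally show ?thesis .
  qed
  have nrm: "norm (?f k \<phi>) = \<bar>t\<bar> ^ k / fact k" for k \<phi>
    by (simp add: norm_mult norm_divide norm_power)
  have se: "summable (\<lambda>k. \<bar>t\<bar> ^ k / fact k)"
    using summable_exp_generic[of "\<bar>t\<bar>"] by (simp add: field_simps)
  interpret finite_measure ?M by (rule finite_measure_arcm[OF a])
  have "(\<lambda>k. \<integral>\<phi>. ?f k \<phi> \<partial>?M) sums (\<integral>\<phi>. (\<Sum>k. ?f k \<phi>) \<partial>?M)"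
  proof (rule sums_integral)
    show "integrable ?M (?f k)" for k
      by (intro integrable_mult_right integrable_cis_arcm[OF a])
    show "AE \<phi> in ?M. summable (\<lambda>k. norm (?f k \<phi>))" unfolding nrm using se by simp
    show "summable (\<lambda>k. \<integral>\<phi>. norm (?f k \<phi>) \<partial>?M)" unfolding nrm using summable_mult[OF se] by simp
  qed
  also have "(\<lambda>k. \<integral>\<phi>. ?f k \<phi> \<partial>?M) = (\<lambda>k. of_real ((-t) ^ k / fact k) * arc_coeff (\<nu> - 1/2) (\<nu> + 1/2 + real k))"
    by (simp add: arc_coeff_def)
  also have "(\<integral>\<phi>. (\<Sum>k. ?f k \<phi>) \<partial>?M) = (\<integral>\<phi>. ?w \<phi> \<partial>?M)" (is "_ = ?I")
    using exps by (simp add: sums_iff)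
  finally have s: "(\<lambda>k. of_real ((-t) ^ k / fact k) * arc_coeff (\<nu> - 1/2) (\<nu> + 1/2 + real k)) sums ?I" .
  have "(\<lambda>k. of_real ((-t) ^ (2 * k) / fact (2 * k)) * arc_coeff (\<nu> - 1/2) (\<nu> + 1/2 + real (2 * k))) sums ?I"
  proof (subst sums_mono_reindex[where g = "\<lambda>k. 2 * k"])
    show "strict_mono (\<lambda>k::nat. 2 * k)" by (simp add: strict_mono_def)
    fix n :: nat assume "n \<notin> range (\<lambda>k. 2 * k)"
    then have "odd n" by (auto elim!: evenE)
    then obtain k where n: "n = 2 * k + 1" by (elim oddE)
    have "arc_coeff (\<nu> - 1/2) (\<nu> + 1/2 + real n) = 0"
      using arc_coeff_odd[OF a, of k] unfolding n by (simp add: algebra_simps)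
    then show "of_real ((-t) ^ n / fact n) * arc_coeff (\<nu> - 1/2) (\<nu> + 1/2 + real n) = 0" by simp
  qed (rule s)
  also have "(\<lambda>k. of_real ((-t) ^ (2 * k) / fact (2 * k)) * arc_coeff (\<nu> - 1/2) (\<nu> + 1/2 + real (2 * k)))
     = (\<lambda>k. of_real ?Z * ?b k)"
  proof
    fix k
    have "arc_coeff (\<nu> - 1/2) (\<nu> + 1/2 + real (2 * k)) = of_real ((-1) ^ k * fact (2 * k) / (4 ^ k * fact k) * rGamma (\<nu> + 1 + real k) * ?Z)"
      using arc_coeff_even[OF a, of k] by (simp add: algebra_simps)
    moreover have "(-t) ^ (2 * k) / fact (2 * k) * ((-1) ^ k * fact (2 * k) / (4 ^ k * fact k) * rGamma (\<nu> + 1 + real k) * ?Z)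
       = ?Z * (bcoeff \<nu> k * ((t/2)\<^sup>2) ^ k)"
      unfolding power_mult power_divide power2_minus by (simp add: bcoeff_def add_ac mult_ac power_divide)
    ultimately show "of_real ((-t) ^ (2 * k) / fact (2 * k)) * arc_coeff (\<nu> - 1/2) (\<nu> + 1/2 + real (2 * k))
     = complex_of_real ?Z * ?b k"
      by (simp only: of_real_mult[symmetric])
  qed
  finally have "(\<lambda>k. complex_of_real ?Z * ?b k) sums ?I" .
  moreover have "(\<lambda>k. complex_of_real ?Z * ?b k) sums
      (of_real ?Z * of_real (bser \<nu> ((t/2)\<^sup>2)))"
    using sums_bser[of \<nu> "(t/2)\<^sup>2"] by (intro sums_mult sums_of_real) simp
  ultimately have I: "?I = of_real ?Z * of_real (bser \<nu> ((t/2)\<^sup>2))"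
    by (rule sums_unique2)
  have "Gamma (\<nu> + 1/2) > 0" using assms by (intro Gamma_real_pos) simp
  then have nz: "?Z \<noteq> 0" by simp
  have "of_real (inverse Z) * (of_real Z * w) = w" if "Z \<noteq> 0" for Z :: real and w :: complex
    using that by simp
  from this[OF nz] show ?thesis unfolding I pc_def by (simp only:)
qed

section \<open>Laplace transforms\<close>

text \<open>Expanding around a large real \<open>r\<close> with \<open>\<bar>p - r\<bar> < r\<close> reduces the complex rate to the binomial series.\<close>

lemma has_bochner_integral_Gamma_complex:
  fixes p :: complex
  assumes a: "a > -1" and p: "Re p > 0"
  shows "has_bochner_integral lborel (\<lambda>t. indicator {0<..} t *\<^sub>R (of_real (t powr a) * exp (- (p * of_real t))))
           (of_real (Gamma (a + 1)) * p powr (of_real (- (a + 1))))"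
proof -
  let ?L = "\<lambda>t. indicator {0<..} t *\<^sub>R (of_real (t powr a) * exp (- (p * of_real t)))"
  let ?G = "\<lambda>r n. Gamma (a + real n + 1) * r powr (- (a + real n + 1))"
  let ?g = "\<lambda>r n t. indicator {0<..} t * (t powr (a + real n) * exp (- (r * t)))"
  let ?c = "\<lambda>r. Gamma (a + 1) * r powr (- (a + 1))"
  \<comment> \<open>|p - r| < r amounts to |p|^2 < 2 r Re p; the added 1 makes this strict and keeps
    r positive.\<close>
  define r where "r = (norm p ^ 2) / (2 * Re p) + 1"
  have r: "r > 0" unfolding r_def using p by (intro add_nonneg_pos) auto
  define w where "w = p - of_real r"
  have "norm w ^ 2 = norm p ^ 2 - 2 * r * Re p + r ^ 2"
    unfolding w_def cmod_power2 by (simp add: power2_eq_square algebra_simps)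
  also have "2 * r * Re p = norm p ^ 2 + 2 * Re p" unfolding r_def using p by (simp add: field_simps)
  finally have "norm w ^ 2 < r ^ 2" using p by simp
  then have w: "norm w < r" using r power_less_imp_less_base by (metis less_imp_le)
  let ?f = "\<lambda>n t. ((-w) ^ n / fact n) * of_real (?g r n t)"
  have hb: "has_bochner_integral lborel (?f n) ((-w) ^ n / fact n * of_real (?G r n))" for n
    using a r by (intro has_bochner_integral_mult_right has_bochner_integral_of_real has_bochner_integral_Gamma) auto
  have G: "Gamma (a + real n + 1) = Gamma (a + 1) * pochhammer (a + 1) n" for n
  proof -
    have n: "a + 1 \<notin> \<int>\<^sub>\<le>\<^sub>0" using a nonpos_Ints_nonpos[of "a + 1"] by auto
    have "Gamma (a + 1) > 0" using a by (intro Gamma_real_pos) simp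
    then have nz: "Gamma (a + 1) \<noteq> 0" by simp
    have e: "a + real n + 1 = a + 1 + real n" by simp
    show ?thesis unfolding e pochhammer_Gamma[OF n]
      by (simp only: times_divide_eq_right nonzero_mult_div_cancel_left[OF nz])
  qed
  have gb: "pochhammer (a + 1) n / fact n = (-1) ^ n * ((- (a + 1)) gchoose n)" for n
    by (simp add: gbinomial_pochhammer add.commute)
  have rp: "r powr (- (a + real n + 1)) = r powr (- (a + 1)) / r ^ n" for n
  proof -
    have "- (a + real n + 1) = - (a + 1) - real n" by simp
    then show ?thesis using r by (simp only: powr_diff powr_realpow)
  qed
  have val: "?G r n / fact n = ?c r * ((-1) ^ n * ((- (a + 1)) gchoose n)) / r ^ n" for n
    unfolding G rp gb[symmetric] by (simp add: mult_ac)
  have sumf: "?f n t = indicator {0<..} t *\<^sub>R (of_real (t powr a * exp (- (r * t))) * ((- (w * of_real t)) ^ n /\<^sub>R fact n))" for n t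
  proof (cases "t > 0")
    case True
    then have "t powr (a + real n) = t powr a * t ^ n" by (simp add: powr_add powr_realpow)
    then show ?thesis using True by (simp add: power_mult_distrib scaleR_conv_of_real divide_inverse power_minus[of "w * _"] power_minus[of w] mult_ac)
  qed auto
  have fsums: "(\<lambda>n. ?f n t) sums ?L t" for t
  proof -
    have "exp (- (p * of_real t)) = of_real (exp (- (r * t))) * exp (- (w * of_real t))"
      unfolding w_def by (simp add: algebra_simps exp_diff exp_minus exp_of_real[symmetric] field_simps flip: exp_add)
    then have "of_real (t powr a) * exp (- (p * of_real t)) = of_real (t powr a * exp (- (r * t))) * exp (- (w * of_real t))"
      by simp
    then show ?thesis unfolding sumf
      by (simp only:) (intro sums_scaleR_right sums_mult exp_converges)
  qed
  \<comment> \<open>The L1 norms are the terms of the real binomial series at -|w|/r, which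
    converges as |w| < r. This justifies integrating termwise.\<close>
  have nint: "(\<integral>t. norm (?f n t) \<partial>lborel) = ?c r * (((- (a + 1)) gchoose n) * (- (norm w / r)) ^ n)" for n
  proof -
    have "(\<lambda>t. norm (?f n t)) = (\<lambda>t. norm w ^ n / fact n * (?g r n t))"
      by (auto simp: norm_mult norm_divide norm_power abs_mult split: split_indicator)
    moreover have "(\<integral>t. norm w ^ n / fact n * (?g r n t) \<partial>lborel)
        = norm w ^ n / fact n * (?G r n)"
      using a r by (intro has_bochner_integral_integral_eq has_bochner_integral_mult_right has_bochner_integral_Gamma) auto
    moreover have "norm w ^ n / fact n * (?G r n) = norm w ^ n * (?G r n / fact n)"
      by simp
    ultimately have "(\<integral>t. norm (?f n t) \<partial>lborel) = norm w ^ n * (?G r n / fact n)"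
      by (simp only:)
    then show ?thesis unfolding val
      by (simp add: power_minus[of "norm w / r"] power_divide mult_ac)
  qed
  have nsum: "summable (\<lambda>n. \<integral>t. norm (?f n t) \<partial>lborel)"
    unfolding nint
    using gen_binomial_real[of "- (norm w / r)" "- (a + 1)"] w r
    by (intro summable_mult) (auto simp: sums_iff)
  have ns: "summable (\<lambda>n. norm (?f n t))" for t
    unfolding sumf norm_scaleR[of "indicator _ _"] norm_mult[of "complex_of_real (t powr a * exp (- (r * t)))"]
    by (intro summable_mult summable_norm_exp)
  have I: "integrable lborel (?f n)" for n using hb[of n] by (simp only: has_bochner_integral_iff)
  have "integrable lborel (\<lambda>t. \<Sum>n. ?f n t)"
    by (rule integrable_suminf[OF I _ nsum]) (use ns in auto)
  then have int: "integrable lborel ?L"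
    using fsums by (simp add: sums_iff)
  have "(\<lambda>n. \<integral>t. ?f n t \<partial>lborel) sums (\<integral>t. (\<Sum>n. ?f n t) \<partial>lborel)"
    by (rule sums_integral[OF I _ nsum]) (use ns in auto)
  then have s1: "(\<lambda>n. (-w) ^ n / fact n * of_real (?G r n)) sums
      (\<integral>t. ?L t \<partial>lborel)"
    using fsums by (simp only: has_bochner_integral_integral_eq[OF hb] sums_iff)
  have e: "(-w) ^ n / fact n * of_real (?G r n)
      = of_real (?c r) * ((of_real (- (a + 1)) gchoose n) * (w / of_real r) ^ n)" for n
  proof -
    have "(-w) ^ n / fact n * of_real (?G r n)
       = (-w) ^ n * of_real (?G r n / fact n)"
      by simp
    also have "\<dots> = (-w) ^ n * of_real (?c r * ((-1) ^ n * ((- (a + 1)) gchoose n)) / r ^ n)"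
      unfolding val ..
    also have "\<dots> = of_real (?c r) * (of_real ((- (a + 1)) gchoose n) * (w / of_real r) ^ n)"
    proof -
      have "(-w) ^ n * (-1) ^ n = w ^ n" unfolding power_mult_distrib[symmetric] by simp
      then show ?thesis by (simp add: power_divide mult_ac)
    qed
    also have "of_real ((- (a + 1)) gchoose n) = ((of_real (- (a + 1)) :: complex) gchoose n)"
      unfolding gbinomial_pochhammer of_real_minus[symmetric] pochhammer_of_real by simp
    finally show ?thesis .
  qed
  have "norm (w / of_real r) < 1" using w r by (simp add: norm_divide)
  then have s2: "(\<lambda>n. of_real (?c r) * ((of_real (- (a + 1)) gchoose n) * (w / of_real r) ^ n)) sums
     (of_real (?c r) * (1 + w / of_real r) powr (of_real (- (a + 1))))"
    by (intro sums_mult gen_binomial_complex)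
  \<comment> \<open>As r is a positive real, the power of the product splits without any jump of the
    branch.\<close>
  have "p = of_real r * (1 + w / of_real r)" using r by (simp add: w_def field_simps)
  then have "p powr (of_real (- (a + 1))) = of_real r powr (of_real (- (a + 1))) * (1 + w / of_real r) powr (of_real (- (a + 1)))"
    using r powr_times_real_left[of "of_real r" "1 + w / of_real r" "of_real (- (a + 1))"] by simp
  also have "of_real r powr (of_real (- (a + 1))) = complex_of_real (r powr (- (a + 1)))"
    using r by (intro powr_of_real) simp
  finally have "(\<integral>t. ?L t \<partial>lborel)
     = of_real (Gamma (a + 1)) * p powr (of_real (- (a + 1)))"
    using sums_unique2[OF s1 s2[folded e]] by (simp only: of_real_mult mult.assoc)
  with int show ?thesis by (simp add: has_bochner_integral_iff)
qed

text \<open>Termwise integration: the Gamma factor from t^(\<beta>+k) cancels the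
  \<open>rGamma\<close> in the coefficient and leaves the exponential series at -X/p. The L1 norms
  add up to the same expression with Re p in place of p and the opposite sign in the
  exponent.\<close>

lemma has_bochner_integral_bser_Laplace:
  fixes p :: complex
  assumes b: "\<beta> > -1" and p: "Re p > 0" and X: "X \<ge> 0"
  shows "has_bochner_integral lborel
     (\<lambda>t. indicator {0<..} t *\<^sub>R (of_real (t powr \<beta> * bser \<beta> (X * t)) * exp (- (p * of_real t))))
     (p powr (of_real (- (\<beta> + 1))) * exp (- (of_real X / p)))"
proof -
  let ?L = "\<lambda>t. indicator {0<..} t *\<^sub>R (of_real (t powr \<beta> * bser \<beta> (X * t)) * exp (- (p * of_real t)))"
  let ?E = "\<lambda>t. indicator {0<..} t *\<^sub>R (of_real (t powr \<beta>) * exp (- (p * of_real t)))"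
  let ?g = "\<lambda>k t. indicator {0<..} t * (t powr (\<beta> + real k) * exp (- (Re p * t)))"
  have p0: "p \<noteq> 0" using p by auto
  let ?f = "\<lambda>k t. of_real (bcoeff \<beta> k * X ^ k) * (indicator {0<..} t *\<^sub>R (of_real (t powr (\<beta> + real k)) * exp (- (p * of_real t))))"
  have hb: "has_bochner_integral lborel (?f k) (of_real (bcoeff \<beta> k * X ^ k) *
      (of_real (Gamma (\<beta> + real k + 1)) * p powr (of_real (- (\<beta> + real k + 1)))))" for k
    using b p by (intro has_bochner_integral_mult_right has_bochner_integral_Gamma_complex) auto
  have cG: "bcoeff \<beta> k * Gamma (\<beta> + real k + 1) = (-1) ^ k / fact k" for k
  proof -
    have "Gamma (\<beta> + real k + 1) > 0" using b by (intro Gamma_real_pos) simp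
    then show ?thesis by (simp add: bcoeff_def rGamma_inverse_Gamma)
  qed
  have tk: "t powr (\<beta> + real k) = t powr \<beta> * t ^ k" if "t > 0" for t k
    using that by (simp add: powr_add powr_realpow)
  have fe: "?f k t = ?E t * of_real (bcoeff \<beta> k * (X * t) ^ k)" for k t
    using tk[of t k] by (cases "t > 0") (simp_all add: power_mult_distrib scaleR_conv_of_real mult_ac)
  have fsums: "(\<lambda>k. ?f k t) sums ?L t" for t
  proof -
    have "(\<lambda>k. ?E t * of_real (bcoeff \<beta> k * (X * t) ^ k))
      sums (?E t * of_real (bser \<beta> (X * t)))"
      using sums_bser[of \<beta> "X * t"] by (intro sums_mult sums_of_real) simp
    then show ?thesis unfolding fe by (simp add: scaleR_conv_of_real mult_ac)
  qed
  have nint: "(\<integral>t. norm (?f k t) \<partial>lborel) = Re p powr (- (\<beta> + 1)) * ((X / Re p) ^ k /\<^sub>R fact k)" for k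
  proof -
    have "(\<lambda>t. norm (?f k t)) = (\<lambda>t. (\<bar>bcoeff \<beta> k\<bar> * X ^ k) * ?g k t)"
      using X by (auto simp: norm_mult abs_mult norm_power split: split_indicator)
    moreover have "(\<integral>t. (\<bar>bcoeff \<beta> k\<bar> * X ^ k) * ?g k t \<partial>lborel)
       = (\<bar>bcoeff \<beta> k\<bar> * X ^ k) * (Gamma (\<beta> + real k + 1) * Re p powr (- (\<beta> + real k + 1)))"
      using b p by (intro has_bochner_integral_integral_eq has_bochner_integral_mult_right has_bochner_integral_Gamma) auto
    ultimately have A: "(\<integral>t. norm (?f k t) \<partial>lborel) = (\<bar>bcoeff \<beta> k\<bar> * X ^ k) * (Gamma (\<beta> + real k + 1) * Re p powr (- (\<beta> + real k + 1)))"
      by (simp only:)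
    have "\<bar>bcoeff \<beta> k\<bar> * Gamma (\<beta> + real k + 1) = 1 / fact k"
      using arg_cong[OF cG[of k], of abs] b Gamma_real_pos[of "\<beta> + real k + 1"] by (simp add: abs_mult)
    have P: "Re p powr (- (\<beta> + real k + 1)) = Re p powr (- (\<beta> + 1)) / Re p ^ k"
    proof -
      have "- (\<beta> + real k + 1) = - (\<beta> + 1) - real k" by simp
      then show ?thesis using p by (simp only: powr_diff powr_realpow)
    qed
    have "(\<integral>t. norm (?f k t) \<partial>lborel) = (\<bar>bcoeff \<beta> k\<bar> * Gamma (\<beta> + real k + 1)) * X ^ k * Re p powr (- (\<beta> + 1)) / Re p ^ k"
      unfolding A P by (simp only: mult_ac times_divide_eq_right)
    then show ?thesis unfolding \<open>\<bar>bcoeff \<beta> k\<bar> * Gamma (\<beta> + real k + 1) = 1 / fact k\<close>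
      by (simp add: power_divide field_simps)
  qed
  have nsum: "summable (\<lambda>k. \<integral>t. norm (?f k t) \<partial>lborel)"
    unfolding nint by (intro summable_mult summable_exp_generic)
  have ns: "summable (\<lambda>k. norm (?f k t))" for t
    unfolding fe norm_mult[of "_ *\<^sub>R _"] using summable_norm_bser[of \<beta> "X * t"]
    by (intro summable_mult) (simp del: of_real_mult)
  have I: "integrable lborel (?f n)" for n using hb[of n] by (simp only: has_bochner_integral_iff)
  have "integrable lborel (\<lambda>t. \<Sum>n. ?f n t)"
    by (rule integrable_suminf[OF I _ nsum]) (use ns in auto)
  then have int: "integrable lborel ?L"
    using fsums by (simp only: sums_iff)
  have "(\<lambda>n. \<integral>t. ?f n t \<partial>lborel) sums (\<integral>t. (\<Sum>n. ?f n t) \<partial>lborel)"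
    by (rule sums_integral[OF I _ nsum]) (use ns in auto)
  then have s1: "(\<lambda>k. of_real (bcoeff \<beta> k * X ^ k) *
      (of_real (Gamma (\<beta> + real k + 1)) * p powr (of_real (- (\<beta> + real k + 1))))) sums
      (\<integral>t. ?L t \<partial>lborel)"
    using fsums by (simp only: has_bochner_integral_integral_eq[OF hb] sums_iff)
  have e: "of_real (bcoeff \<beta> k * X ^ k) * (of_real (Gamma (\<beta> + real k + 1)) * p powr (of_real (- (\<beta> + real k + 1))))
     = p powr (of_real (- (\<beta> + 1))) * ((- (of_real X / p)) ^ k /\<^sub>R fact k)" for k
  proof -
    have "p powr (of_real (- (\<beta> + real k + 1))) = p powr (of_real (- (\<beta> + 1)) - of_nat k)" by (simp add: algebra_simps)
    also have "\<dots> = p powr (of_real (- (\<beta> + 1))) / p ^ k" by (simp only: powr_diff powr_nat' p0 powr_nat)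
       (simp add: p0 powr_nat)
    finally have "of_real (bcoeff \<beta> k * X ^ k) * (of_real (Gamma (\<beta> + real k + 1)) * p powr (of_real (- (\<beta> + real k + 1))))
       = of_real (bcoeff \<beta> k * Gamma (\<beta> + real k + 1)) * (of_real X ^ k * (p powr (of_real (- (\<beta> + 1))) / p ^ k))"
      by (simp add: mult_ac)
    then show ?thesis unfolding cG
      by (simp add: power_minus[of "of_real X / p"] power_divide scaleR_conv_of_real field_simps)
  qed
  have s2: "(\<lambda>k. p powr (of_real (- (\<beta> + 1))) * ((- (of_real X / p)) ^ k /\<^sub>R fact k)) sums
     (p powr (of_real (- (\<beta> + 1))) * exp (- (of_real X / p)))"
    by (intro sums_mult exp_converges)
  show ?thesis using int sums_unique2[OF s1 s2[folded e]] by (simp only: has_bochner_integral_iff)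
qed

section \<open>Decay on the positive axis\<close>

lemma exp_cis_le_1: "\<phi> \<in> rarc \<Longrightarrow> t \<ge> 0 \<Longrightarrow> exp (- (t * cos \<phi>)) \<le> 1"
  using cos_arc_pos[of \<phi>] by simp

lemma pc_pos: "\<nu> > -1/2 \<Longrightarrow> pc \<nu> > 0"
  unfolding pc_def using Gamma_real_pos[of "\<nu> + 1/2"] by simp

text \<open>The phase has modulus 1, so only the damping exp(-t cos \<phi>) survives. Both the decay
  and the global bound rest on this.\<close>

lemma abs_bser_le_arcm:
  assumes "\<nu> > -1/2" "t \<ge> 0"
  shows "\<bar>bser \<nu> ((t/2)\<^sup>2)\<bar> \<le> pc \<nu> * (\<integral>\<phi>. exp (- (t * cos \<phi>)) \<partial>arcm (\<nu> - 1/2))"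
proof -
  have "\<bar>bser \<nu> ((t/2)\<^sup>2)\<bar> = norm (complex_of_real (bser \<nu> ((t/2)\<^sup>2)))" by simp
  also have "\<dots> = pc \<nu> * norm (\<integral>\<phi>. cis ((\<nu> + 1/2) * \<phi>) * exp (- (of_real t * cis \<phi>)) \<partial>arcm (\<nu> - 1/2))"
    using assms pc_pos[of \<nu>] by (subst bser_angular) (auto simp: norm_mult)
  also have "\<dots> \<le> pc \<nu> * (\<integral>\<phi>. norm (cis ((\<nu> + 1/2) * \<phi>) * exp (- (of_real t * cis \<phi>))) \<partial>arcm (\<nu> - 1/2))"
    using assms pc_pos[of \<nu>] by (intro mult_left_mono integral_norm_bound) auto
  also have "(\<lambda>\<phi>. norm (cis ((\<nu> + 1/2) * \<phi>) * exp (- (of_real t * cis \<phi>)))) = (\<lambda>\<phi>. exp (- (t * cos \<phi>)))"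
    by (simp add: norm_mult)
  finally show ?thesis .
qed

lemma integrable_arcm_exp: "a > -1 \<Longrightarrow> t \<ge> 0 \<Longrightarrow> integrable (arcm a) (\<lambda>\<phi>. exp (- (t * cos \<phi>)))"
  by (rule integrable_arcm[where C = 1]) (use exp_cis_le_1 in auto)

lemma abs_bser_le_mass:
  assumes "\<nu> > -1/2" "t \<ge> 0"
  shows "\<bar>bser \<nu> ((t/2)\<^sup>2)\<bar> \<le> pc \<nu> * measure (arcm (\<nu> - 1/2)) UNIV"
proof -
  have a: "\<nu> - 1/2 > -1" using assms by simp
  interpret finite_measure "arcm (\<nu> - 1/2)" by (rule finite_measure_arcm[OF a])
  have "(\<integral>\<phi>. exp (- (t * cos \<phi>)) \<partial>arcm (\<nu> - 1/2)) \<le> (\<integral>\<phi>. 1 \<partial>arcm (\<nu> - 1/2))"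
    using AE_arcm[of "\<nu> - 1/2"] integrable_arcm_exp[OF a assms(2)] exp_cis_le_1[OF _ assms(2)]
    by (intro integral_mono_AE) (auto elim: eventually_mono)
  then have "pc \<nu> * (\<integral>\<phi>. exp (- (t * cos \<phi>)) \<partial>arcm (\<nu> - 1/2)) \<le> pc \<nu> * measure (arcm (\<nu> - 1/2)) UNIV"
    using pc_pos[OF assms(1)] by (intro mult_left_mono) auto
  then show ?thesis using abs_bser_le_arcm[OF assms] by linarith
qed

text \<open>The integral representation gives the decay for \<open>\<beta> > -1/2\<close>; the recurrence extends it downwards.\<close>

lemma bser_decay_aux:
  "\<beta> > -1/2 - real n \<Longrightarrow> \<exists>K\<ge>0. \<forall>s\<ge>1. \<bar>bser \<beta> ((s/2)\<^sup>2)\<bar> \<le> K * s powr (- \<beta> - 1/2)"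
proof (induction n arbitrary: \<beta>)
  case 0
  then have a: "\<beta> - 1/2 > -1" "\<beta> > -1/2" by auto
  obtain K where K: "K \<ge> 0" "\<And>t. t > 0 \<Longrightarrow> (\<integral>\<phi>. exp (- (t * cos \<phi>)) \<partial>arcm (\<beta> - 1/2)) \<le> K * t powr (- (\<beta> - 1/2 + 1))"
    using arcm_exp_decay[OF a(1)] by blast
  have "\<bar>bser \<beta> ((s/2)\<^sup>2)\<bar> \<le> pc \<beta> * K * s powr (- \<beta> - 1/2)" if "s \<ge> 1" for s
  proof -
    have "- (\<beta> - 1/2 + 1) = - \<beta> - 1/2" by simp
    then show ?thesis
      using abs_bser_le_arcm[OF a(2), of s] mult_left_mono[OF K(2)[of s], of "pc \<beta>"] pc_pos[OF a(2)] that
      by (simp only: mult.assoc) linarith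
  qed
  then show ?case using K(1) pc_pos[OF a(2)] by (intro exI[of _ "pc \<beta> * K"]) auto
next
  case (Suc n)
  obtain K1 where K1: "K1 \<ge> 0" "\<And>s. s \<ge> 1 \<Longrightarrow> \<bar>bser (\<beta> + 1) ((s/2)\<^sup>2)\<bar> \<le> K1 * s powr (- (\<beta> + 1) - 1/2)"
    using Suc.IH[of "\<beta> + 1"] Suc.prems by auto
  obtain K2 where K2: "K2 \<ge> 0" "\<And>s. s \<ge> 1 \<Longrightarrow> \<bar>bser (\<beta> + 2) ((s/2)\<^sup>2)\<bar> \<le> K2 * s powr (- (\<beta> + 2) - 1/2)"
    using Suc.IH[of "\<beta> + 2"] Suc.prems by auto
  have "\<bar>bser \<beta> ((s/2)\<^sup>2)\<bar> \<le> (\<bar>\<beta> + 1\<bar> * K1 + K2) * s powr (- \<beta> - 1/2)" if s: "s \<ge> 1" for s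
  proof -
    \<comment> \<open>The recurrence solved for the lowest of three orders. The factor s^2/4 undoes
      the additional decay s^(-2) of order \<beta> + 2, and the order \<beta> + 1 term decays faster
      than required.\<close>
    have "bser \<beta> ((s/2)\<^sup>2) = (\<beta> + 1) * bser (\<beta> + 1) ((s/2)\<^sup>2) - (s/2)\<^sup>2 * bser (\<beta> + 2) ((s/2)\<^sup>2)"
      using bser_rec[of "\<beta> + 1" "(s/2)\<^sup>2"] by (simp add: add.assoc)
    then have "\<bar>bser \<beta> ((s/2)\<^sup>2)\<bar> \<le> \<bar>\<beta> + 1\<bar> * \<bar>bser (\<beta> + 1) ((s/2)\<^sup>2)\<bar> + (s/2)\<^sup>2 * \<bar>bser (\<beta> + 2) ((s/2)\<^sup>2)\<bar>"
      using abs_triangle_ineq4[of "(\<beta> + 1) * bser (\<beta> + 1) ((s/2)\<^sup>2)" "(s/2)\<^sup>2 * bser (\<beta> + 2) ((s/2)\<^sup>2)"] by (simp add: abs_mult)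
    also have "\<dots> \<le> \<bar>\<beta> + 1\<bar> * (K1 * s powr (- (\<beta> + 1) - 1/2)) + s\<^sup>2 * (K2 * s powr (- (\<beta> + 2) - 1/2))"
      using s K1 K2 by (intro add_mono mult_mono) (auto simp: power_divide)
    also have "s\<^sup>2 * (K2 * s powr (- (\<beta> + 2) - 1/2)) = K2 * s powr (- \<beta> - 1/2)"
    proof -
      have "s powr 2 * s powr (- (\<beta> + 2) - 1/2) = s powr (- \<beta> - 1/2)" by (simp flip: powr_add add: add.commute)
      then show ?thesis using s by (simp add: mult_ac)
    qed
    also have "\<bar>\<beta> + 1\<bar> * (K1 * s powr (- (\<beta> + 1) - 1/2)) \<le> \<bar>\<beta> + 1\<bar> * (K1 * s powr (- \<beta> - 1/2))"
      using s K1 by (intro mult_left_mono powr_mono) auto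
    finally show ?thesis by (simp add: algebra_simps)
  qed
  then show ?case using K1(1) K2(1) by (intro exI[of _ "\<bar>\<beta> + 1\<bar> * K1 + K2"]) auto
qed

text \<open>All real orders are covered because the derivative \<open>lfac'\<close> involves order 2
  \<nu> - 1, which may lie below -1/2.\<close>

lemma bser_decay: "\<exists>K\<ge>0. \<forall>s\<ge>1. \<bar>bser \<beta> ((s/2)\<^sup>2)\<bar> \<le> K * s powr (- \<beta> - 1/2)"
proof -
  obtain n :: nat where "- \<beta> < real n" using reals_Archimedean2 by blast
  then show ?thesis by (intro bser_decay_aux[of n]) simp
qed

section \<open>The first integral\<close>

lemma isCont_bser [continuous_intros]: "isCont (bser \<beta>) (y::'a::{real_normed_field,banach})"
  by (rule DERIV_isCont[OF has_field_derivative_bser])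

lemma continuous_on_bser [continuous_intros]:
  "continuous_on A f \<Longrightarrow> continuous_on A (\<lambda>x. bser \<beta> (f x :: 'a::{real_normed_field,banach}))"
  by (rule continuous_on_compose2[of UNIV "bser \<beta>"]) (auto intro: continuous_at_imp_continuous_on isCont_bser)

lemma borel_measurable_bser [measurable]: "bser \<beta> \<in> borel_measurable (borel :: real measure)"
  by (intro borel_measurable_continuous_onI continuous_intros)

text \<open>A bound h(t) that does not depend on \<phi> suffices because \<open>arcm\<close> has
  finite mass; the singular weight does not enter the domination.\<close>

lemma arcm_Fubini:
  fixes F :: "real \<Rightarrow> real \<Rightarrow> complex"
  assumes a: "a > -1" and h: "integrable lborel h"
    and F [measurable]: "case_prod F \<in> borel_measurable (borel \<Otimes>\<^sub>M borel)"
    and le: "\<And>\<phi> t. \<phi> \<in> rarc \<Longrightarrow> norm (F \<phi> t) \<le> h t"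
  shows "(\<integral>t. (\<integral>\<phi>. F \<phi> t \<partial>arcm a) \<partial>lborel) = (\<integral>\<phi>. (\<integral>t. F \<phi> t \<partial>lborel) \<partial>arcm a)"
    and "integrable (arcm a) (\<lambda>\<phi>. \<integral>t. F \<phi> t \<partial>lborel)"
proof -
  interpret finite_measure "arcm a" by (rule finite_measure_arcm[OF a])
  interpret pair_sigma_finite "arcm a" lborel ..
  have Fm: "case_prod F \<in> borel_measurable (arcm a \<Otimes>\<^sub>M lborel)"
    using F by (simp cong: measurable_cong_sets)
  have I: "integrable lborel (\<lambda>t. norm (F \<phi> t))" if "\<phi> \<in> rarc" for \<phi>
    by (rule Bochner_Integration.integrable_bound[OF h])
       (use le[OF that] in \<open>auto intro!: AE_I2 order_trans[OF _ abs_ge_self]\<close>)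
  have "integrable (arcm a \<Otimes>\<^sub>M lborel) (case_prod F)"
  proof (rule Fubini_integrable[OF Fm])
    show "integrable (arcm a) (\<lambda>\<phi>. \<integral>t. norm (case_prod F (\<phi>, t)) \<partial>lborel)"
    proof (rule integrable_arcm[OF a])
      fix \<phi> assume "\<phi> \<in> rarc"
      then show "norm (\<integral>t. norm (case_prod F (\<phi>, t)) \<partial>lborel) \<le> (\<integral>t. h t \<partial>lborel)"
        using le I h by (simp add: integral_nonneg) (intro integral_mono, auto)
    qed simp
    show "AE \<phi> in arcm a. integrable lborel (\<lambda>t. case_prod F (\<phi>, t))"
      using AE_arcm
    proof eventually_elim
      case (elim \<phi>)
      then show ?case using I[OF elim] by (subst (asm) integrable_norm_iff) auto
    qed
  qed
  then show "(\<integral>t. (\<integral>\<phi>. F \<phi> t \<partial>arcm a) \<partial>lborel) = (\<integral>\<phi>. (\<integral>t. F \<phi> t \<partial>lborel) \<partial>arcm a)"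
    "integrable (arcm a) (\<lambda>\<phi>. \<integral>t. F \<phi> t \<partial>lborel)"
    using Fubini_integral integrable_fst by auto
qed

lemma borel_measurable_cnj [measurable]: "cnj \<in> borel_measurable borel"
  by (intro borel_measurable_continuous_onI continuous_intros)

lemma powr_exp_tendsto_0:
  fixes a c :: real
  assumes "c > 0"
  shows "((\<lambda>t. t powr a * exp (- (c * t))) \<longlongrightarrow> 0) at_top"
  using assms by real_asymp

lemma cis_powr_real: "\<phi> \<in> rarc \<Longrightarrow> cis \<phi> powr of_real r = cis (r * \<phi>)"
proof -
  assume "\<phi> \<in> rarc"
  then have "Ln (cis \<phi>) = \<i> * of_real \<phi>" unfolding cis_conv_exp by (intro Ln_exp) auto
  then show ?thesis by (simp add: powr_def cis_conv_exp mult_ac)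
qed

text \<open>The exponent is (\<nu> - 3/4) + (-\<nu> - 1/2): the size of \<open>lfac'\<close> times
  the decay of the arc integral.\<close>

lemma nn_integral_powr_tail:
  assumes "R > 0"
  shows "(\<integral>\<^sup>+t. ennreal (indicator {R<..} t * t powr (-5/4)) \<partial>lborel) \<le> ennreal (4 * R powr (-1/4))"
proof -
  have "((\<lambda>t. t powr (-5/4)) has_integral -(R powr (-5/4 + 1)) / (-5/4 + 1)) {R..}"
    by (rule has_integral_powr_to_inf) (use assms in auto)
  then have "((\<lambda>t. t powr (-5/4)) has_integral 4 * R powr (-1/4)) {R..}" by (simp add: mult.commute)
  then have "(\<integral>\<^sup>+t. ennreal (indicator {R..} t * t powr (-5/4)) \<partial>lborel) = ennreal (4 * R powr (-1/4))"
    by (subst nn_integral_has_integral_lebesgue) auto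
  moreover have "(\<integral>\<^sup>+t. ennreal (indicator {R<..} t * t powr (-5/4)) \<partial>lborel) \<le> (\<integral>\<^sup>+t. ennreal (indicator {R..} t * t powr (-5/4)) \<partial>lborel)"
    by (intro nn_integral_mono ennreal_leI) (auto split: split_indicator)
  ultimately show ?thesis by simp
qed

section \<open>The first integral in the variable t = c^2/4, truncated at R\<close>

context
  fixes \<nu> X :: real
  assumes nu: "\<nu> > -1/2" and X: "X > 0"
begin

text \<open>Up to constants, \<open>lfac t\<close> is \<open>t\<^sup>\<nu> J\<^sub>2\<^sub>\<nu> (2 sqrt (X t))\<close>, and \<open>lfac'\<close> is its derivative.\<close>

definition lfac :: "real \<Rightarrow> real" where "lfac t = t powr (2 * \<nu>) * bser (2 * \<nu>) (X * t)"
definition lfac' :: "real \<Rightarrow> real" where "lfac' t = t powr (2 * \<nu> - 1) * bser (2 * \<nu> - 1) (X * t)"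

abbreviation "M \<equiv> arcm (\<nu> - 1/2)"
abbreviation "twist \<phi> \<equiv> cis ((\<nu> + 1/2) * \<phi>)"
abbreviation "Lap A \<phi> \<equiv> LINT t:A|lborel. exp (- (cis \<phi> * complex_of_real t)) * of_real (lfac t)"
abbreviation "trunc R \<equiv> LINT t:{0<..R}|lborel. lfac t * bser \<nu> ((t/2)\<^sup>2)"

lemma lfac_measurable [measurable]: "lfac \<in> borel_measurable borel" "lfac' \<in> borel_measurable borel"
  unfolding lfac_def[abs_def] lfac'_def[abs_def] by measurable

text \<open>The product rule followed by \<open>bser_rec\<close>; classically, x^\<nu> J_\<nu> has
  derivative x^\<nu> J_(\<nu>-1).\<close>

lemma DERIV_lfac: "t > 0 \<Longrightarrow> (lfac has_real_derivative lfac' t) (at t)"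
proof -
  assume t: "t > 0"
  have 1: "((\<lambda>t. t powr (2 * \<nu>)) has_real_derivative (2 * \<nu>) * t powr (2 * \<nu> - 1)) (at t)"
    using t by (rule has_real_derivative_powr)
  have 2: "((\<lambda>t. bser (2 * \<nu>) (X * t)) has_real_derivative - bser (2 * \<nu> + 1) (X * t) * X) (at t)"
    by (rule DERIV_chain2[OF has_field_derivative_bser]) (auto intro!: derivative_eq_intros)
  have p: "t powr (2 * \<nu>) = t powr (2 * \<nu> - 1) * t" using t by (simp add: powr_diff)
  have "(lfac has_real_derivative (2 * \<nu>) * t powr (2 * \<nu> - 1) * bser (2 * \<nu>) (X * t)
      + (- bser (2 * \<nu> + 1) (X * t) * X) * t powr (2 * \<nu>)) (at t)"
    unfolding lfac_def[abs_def] by (rule DERIV_mult[OF 1 2])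
  also have "(2 * \<nu>) * t powr (2 * \<nu> - 1) * bser (2 * \<nu>) (X * t) + (- bser (2 * \<nu> + 1) (X * t) * X) * t powr (2 * \<nu>) = lfac' t"
    unfolding lfac'_def bser_rec p by (simp add: algebra_simps)
  finally show ?thesis .
qed

lemma bser_decay_Xt: "\<exists>K\<ge>0. \<exists>R0\<ge>1. \<forall>t\<ge>R0. \<bar>bser \<beta> (X * t)\<bar> \<le> K * t powr (- \<beta> / 2 - 1/4)"
proof -
  obtain K where K: "K \<ge> 0" "\<And>s. s \<ge> 1 \<Longrightarrow> \<bar>bser \<beta> ((s/2)\<^sup>2)\<bar> \<le> K * s powr (- \<beta> - 1/2)"
    using bser_decay by blast
  have "\<bar>bser \<beta> (X * t)\<bar> \<le> (K * (4 * X) powr (- \<beta> / 2 - 1/4)) * t powr (- \<beta> / 2 - 1/4)" if t: "t \<ge> max 1 (1 / X)" for t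
  proof -
    let ?s = "2 * sqrt (X * t)"
    have t': "t > 0" "X * t \<ge> 1" using t X by (auto simp: field_simps)
    have "sqrt (X * t) \<ge> 1" using t' by simp
    then have s: "?s \<ge> 1" by linarith
    have e: "(?s / 2)\<^sup>2 = X * t" using t' X by simp
    have "?s powr (- \<beta> - 1/2) = (4 * (X * t)) powr (- \<beta> / 2 - 1/4)"
    proof -
      have "?s = (4 * (X * t)) powr (1/2)" using t' X by (simp add: powr_half_sqrt real_sqrt_mult)
      then have "?s powr (- \<beta> - 1/2) = (4 * (X * t)) powr (1/2 * (- \<beta> - 1/2))" by (simp only: powr_powr)
      also have "1/2 * (- \<beta> - 1/2) = - \<beta> / 2 - 1/4" by simp
      finally show ?thesis .
    qed
    also have "\<dots> = (4 * X) powr (- \<beta> / 2 - 1/4) * t powr (- \<beta> / 2 - 1/4)"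
      using powr_mult[of "4 * X" t "- \<beta> / 2 - 1/4"] t' X by (simp add: mult.assoc)
    finally show ?thesis using K(2)[OF s] unfolding e by simp
  qed
  then show ?thesis using K(1) by (intro exI[of _ "K * (4 * X) powr (- \<beta> / 2 - 1/4)"] conjI exI[of _ "max 1 (1/X)"]) auto
qed

text \<open>The argument X t corresponds to s = 2 sqrt(X t), which halves the exponents in the decay
  of \<open>bser\<close>. Differentiation gains t^(-1/2), the gain exploited by the integration by
  parts.\<close>

lemma lfac_bounds:
  "\<exists>C\<ge>0. \<exists>R0\<ge>1. \<forall>t\<ge>R0. \<bar>lfac t\<bar> \<le> C * t powr (\<nu> - 1/4) \<and> \<bar>lfac' t\<bar> \<le> C * t powr (\<nu> - 3/4)"
proof -
  obtain K1 R1 where 1: "K1 \<ge> 0" "R1 \<ge> 1" "\<And>t. t \<ge> R1 \<Longrightarrow> \<bar>bser (2 * \<nu>) (X * t)\<bar> \<le> K1 * t powr (- (2 * \<nu>) / 2 - 1/4)"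
    using bser_decay_Xt by blast
  obtain K2 R2 where 2: "K2 \<ge> 0" "R2 \<ge> 1" "\<And>t. t \<ge> R2 \<Longrightarrow> \<bar>bser (2 * \<nu> - 1) (X * t)\<bar> \<le> K2 * t powr (- (2 * \<nu> - 1) / 2 - 1/4)"
    using bser_decay_Xt by blast
  have "\<bar>lfac t\<bar> \<le> max K1 K2 * t powr (\<nu> - 1/4) \<and> \<bar>lfac' t\<bar> \<le> max K1 K2 * t powr (\<nu> - 3/4)" if t: "t \<ge> max R1 R2" for t
  proof -
    have "2 * \<nu> + (- (2 * \<nu>) / 2 - 1/4) = \<nu> - 1/4" by (simp add: field_simps)
    then have a: "t powr (2 * \<nu>) * t powr (- (2 * \<nu>) / 2 - 1/4) = t powr (\<nu> - 1/4)" by (metis powr_add)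
    have "2 * \<nu> - 1 + (- (2 * \<nu> - 1) / 2 - 1/4) = \<nu> - 3/4" by (simp add: field_simps)
    then have b: "t powr (2 * \<nu> - 1) * t powr (- (2 * \<nu> - 1) / 2 - 1/4) = t powr (\<nu> - 3/4)" by (metis powr_add)
    have "\<bar>lfac t\<bar> \<le> t powr (2 * \<nu>) * (K1 * t powr (- (2 * \<nu>) / 2 - 1/4))"
      unfolding lfac_def abs_mult using 1(3)[of t] t by (intro mult_mono) auto
    also have "\<dots> = K1 * t powr (\<nu> - 1/4)" unfolding a[symmetric] by (simp only: mult_ac)
    also have "\<dots> \<le> max K1 K2 * t powr (\<nu> - 1/4)" by (intro mult_right_mono) auto
    finally have A: "\<bar>lfac t\<bar> \<le> max K1 K2 * t powr (\<nu> - 1/4)" .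
    have "\<bar>lfac' t\<bar> \<le> t powr (2 * \<nu> - 1) * (K2 * t powr (- (2 * \<nu> - 1) / 2 - 1/4))"
      unfolding lfac'_def abs_mult using 2(3)[of t] t by (intro mult_mono) auto
    also have "\<dots> = K2 * t powr (\<nu> - 3/4)" unfolding b[symmetric] by (simp only: mult_ac)
    also have "\<dots> \<le> max K1 K2 * t powr (\<nu> - 3/4)" by (intro mult_right_mono) auto
    finally show ?thesis using A by simp
  qed
  then show ?thesis using 1(1,2) by (intro exI[of _ "max K1 K2"] conjI exI[of _ "max R1 R2"]) auto
qed

lemma lfac_Laplace:
  assumes "Re p > 0"
  shows "set_integrable lborel {0<..} (\<lambda>t. exp (- (p * of_real t)) * of_real (lfac t))"
    and "(LINT t:{0<..}|lborel. exp (- (p * of_real t)) * of_real (lfac t)) = p powr (of_real (- (2 * \<nu> + 1))) * exp (- (of_real X / p))"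
proof -
  have "has_bochner_integral lborel
     (\<lambda>t. indicator {0<..} t *\<^sub>R (of_real (lfac t) * exp (- (p * of_real t))))
     (p powr (of_real (- (2 * \<nu> + 1))) * exp (- (of_real X / p)))"
    unfolding lfac_def using nu X assms by (intro has_bochner_integral_bser_Laplace) auto
  then show "set_integrable lborel {0<..} (\<lambda>t. exp (- (p * of_real t)) * of_real (lfac t))"
    "(LINT t:{0<..}|lborel. exp (- (p * of_real t)) * of_real (lfac t)) = p powr (of_real (- (2 * \<nu> + 1))) * exp (- (of_real X / p))"
    unfolding set_integrable_def set_lebesgue_integral_def has_bochner_integral_iff by (simp_all only: mult.commute)
qed

text \<open>Integration by parts on (R, \<infinity>), with q = cis \<phi>. Dividing by q is harmless
  since |q| = 1, whereas an estimate through 1/cos \<phi> would degenerate at the ends of the arc.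
  The bound is stated in \<open>ennreal\<close> so that it can be integrated over \<phi> by
  Tonelli.\<close>

lemma Laplace_tail:
  assumes \<phi>: "\<phi> \<in> rarc" and C: "C \<ge> 0" "R0 \<ge> 1"
    and b: "\<And>t. t \<ge> R0 \<Longrightarrow> \<bar>lfac t\<bar> \<le> C * t powr (\<nu> - 1/4) \<and> \<bar>lfac' t\<bar> \<le> C * t powr (\<nu> - 3/4)"
    and R: "R \<ge> R0"
  shows "ennreal (norm (Lap {R<..} \<phi>))
    \<le> ennreal (C * R powr (\<nu> - 1/4) * exp (- (R * cos \<phi>))) +
      (\<integral>\<^sup>+t. ennreal (indicator {R<..} t * (C * t powr (\<nu> - 3/4) * exp (- (t * cos \<phi>)))) \<partial>lborel)"
proof -
  let ?T = "LINT t:{R<..}|lborel. exp (- (cis \<phi> * complex_of_real t)) * of_real (lfac t)"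
  let ?S = "LINT t:{R<..}|lborel. exp (- (cis \<phi> * complex_of_real t)) * of_real (lfac' t)"
  let ?k = "\<lambda>t. C * t powr (\<nu> - 3/4) * exp (- (t * cos \<phi>))"
  let ?b = "C * R powr (\<nu> - 1/4) * exp (- (R * cos \<phi>))"
  let ?q = "cis \<phi>"
  have c: "cos \<phi> > 0" by (rule cos_arc_pos) fact
  have R1: "R \<ge> 1" using R C by simp
  let ?e = "\<lambda>t. exp (- (?q * complex_of_real t))"
  have ne: "norm (?e t) = exp (- (t * cos \<phi>))" for t by (simp add: mult.commute)
  have i1: "set_integrable lborel {R<..} (\<lambda>t. ?e t * of_real (lfac t))"
    by (rule set_integrable_subset[OF lfac_Laplace(1)]) (use c R1 in auto)
  have i3: "set_integrable lborel {R<..} (\<lambda>t. ?k t)"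
  proof (rule set_integrable_bound)
    \<comment> \<open>The exponent is raised by 1, which only enlarges the integrand for t \<ge> 1.
      The original \<nu> - 3/4 may be below -1, where the Gamma integral diverges at 0.\<close>
    have "set_integrable lborel {0<..} (\<lambda>t. t powr (\<nu> + 1/4) * exp (- (cos \<phi> * t)))"
      using has_bochner_integral_Gamma[of "\<nu> + 1/4" "cos \<phi>"] nu c
      by (simp add: set_integrable_def has_bochner_integral_iff)
    then have "set_integrable lborel {0<..} (\<lambda>t. C * (t powr (\<nu> + 1/4) * exp (- (cos \<phi> * t))))"
      by (intro set_integrable_mult_right)
    then show "set_integrable lborel {R<..} (\<lambda>t. C * (t powr (\<nu> + 1/4) * exp (- (cos \<phi> * t))))"
      by (rule set_integrable_subset) (use R1 in auto)
    show "AE t in lborel. t \<in> {R<..} \<longrightarrow> norm (?k t) \<le> norm (C * (t powr (\<nu> + 1/4) * exp (- (cos \<phi> * t))))"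
      using C R1 by (auto intro!: AE_I2 mult_left_mono mult_right_mono powr_mono simp: abs_mult mult.assoc mult.commute[of "cos \<phi>"])
  qed (simp add: set_borel_measurable_def)
  have i2: "set_integrable lborel {R<..} (\<lambda>t. ?e t * of_real (lfac' t))"
  proof (rule set_integrable_bound[OF i3])
    show "AE t in lborel. t \<in> {R<..} \<longrightarrow> norm (?e t * of_real (lfac' t)) \<le> norm (?k t)"
      using b R C by (auto intro!: AE_I2 mult_right_mono simp: norm_mult ne abs_mult mult.commute[of "exp _"] mult.commute[of "cos \<phi>"])
  qed (simp add: set_borel_measurable_def)
  let ?F = "\<lambda>t. - (?e t * of_real (lfac t) / ?q)"
  let ?f = "\<lambda>t. ?e t * of_real (lfac t) - ?e t * of_real (lfac' t) / ?q"
  have if_: "set_integrable lborel {R<..} ?f"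
    using i1 i2 by (intro set_integral_diff(1) set_integrable_divide)
  have "(LBINT t=ereal R..\<infinity>. ?f t) = 0 - ?F R"
  proof (rule interval_integral_FTC_integrable)
    fix t assume "ereal R < ereal t"
    then have t: "t > 0" using R1 by simp
    have w: "(lfac has_vector_derivative lfac' t) (at t)"
      using DERIV_lfac[OF t] by (simp add: has_real_derivative_iff_has_vector_derivative)
    have e: "(?e has_vector_derivative (- ?q) * ?e t) (at t)"
    proof -
      have "((\<lambda>z. exp (- (?q * z))) has_field_derivative (- ?q) * ?e t) (at (complex_of_real t))"
        by (auto intro!: derivative_eq_intros)
      from has_vector_derivative_real_field[OF this] show ?thesis .
    qed
    have "((\<lambda>t. ?e t * of_real (lfac t)) has_vector_derivative (?e t * of_real (lfac' t) + (- ?q * ?e t) * of_real (lfac t))) (at t)"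
      by (intro has_vector_derivative_mult e has_vector_derivative_of_real) (rule DERIV_lfac[OF t])
    then have "((\<lambda>t. (- 1 / ?q) * (?e t * of_real (lfac t))) has_vector_derivative (- 1 / ?q) * (?e t * of_real (lfac' t) + (- ?q * ?e t) * of_real (lfac t))) (at t)"
      by (rule has_vector_derivative_mult_right)
    moreover have "(- 1 / ?q) * (?e t * of_real (lfac' t) + (- ?q * ?e t) * of_real (lfac t)) = ?f t"
      by (simp add: field_simps)
    ultimately show "(?F has_vector_derivative ?f t) (at t)" by simp
    show "isCont ?f t"
    proof -
      have "isCont lfac t" using DERIV_lfac[OF t] by (rule DERIV_isCont)
      moreover have "isCont lfac' t" unfolding lfac'_def[abs_def] using t
        by (intro continuous_intros isCont_o2[OF _ isCont_bser]) auto
      ultimately show ?thesis by (intro continuous_intros) auto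
    qed
  next
    show "set_integrable lborel (einterval (ereal R) \<infinity>) ?f" using if_ by (simp add: einterval_eq)
    have "isCont lfac R" using DERIV_lfac[of R] R1 by (intro DERIV_isCont) auto
    then have "isCont ?F R" by (intro continuous_intros) auto
    then have "(?F \<longlongrightarrow> ?F R) (at_right R)" unfolding isCont_def by (rule tendsto_within_subset) simp
    then show "((?F \<circ> real_of_ereal) \<longlongrightarrow> ?F R) (at_right (ereal R))" by (simp add: ereal_tendsto_simps)
    have "(?F \<longlongrightarrow> 0) at_top"
    proof (rule Lim_null_comparison)
      show "((\<lambda>t. C * (t powr (\<nu> - 1/4) * exp (- (cos \<phi> * t)))) \<longlongrightarrow> 0) at_top"
        by (intro tendsto_mult_right_zero powr_exp_tendsto_0 c)
      show "\<forall>\<^sub>F t in at_top. norm (?F t) \<le> C * (t powr (\<nu> - 1/4) * exp (- (cos \<phi> * t)))"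
        using eventually_ge_at_top[of R0]
      proof eventually_elim
        case (elim t)
        have "norm (?F t) = \<bar>lfac t\<bar> * exp (- (t * cos \<phi>))" by (simp add: norm_mult norm_divide mult.commute)
        also have "\<dots> \<le> (C * t powr (\<nu> - 1/4)) * exp (- (t * cos \<phi>))" using b[OF elim] by (intro mult_right_mono) auto
        finally show ?case by (simp add: mult_ac)
      qed
    qed
    then show "((?F \<circ> real_of_ereal) \<longlongrightarrow> 0) (at_left \<infinity>)" by (simp add: ereal_tendsto_simps)
  qed simp
  then have "(LINT t:{R<..}|lborel. ?f t) = ?e R * of_real (lfac R) / ?q"
    by (simp add: interval_integral_to_infinity_eq)
  also have "(LINT t:{R<..}|lborel. ?f t) = ?T - ?S / ?q"
    using i1 i2 by (subst set_integral_diff(2)) (auto simp: set_integral_divide_zero)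
  finally have eq: "?T = ?e R * of_real (lfac R) / ?q + ?S / ?q"
    by (simp add: algebra_simps)
  have "norm ?T \<le> norm (?e R * of_real (lfac R)) + norm ?S"
    unfolding eq by (rule order_trans[OF norm_triangle_ineq]) (simp add: norm_divide)
  also have "norm (?e R * of_real (lfac R)) \<le> ?b"
    using b[of R] R by (auto simp: norm_mult ne mult.commute[of "exp _"] mult.commute[of "cos \<phi>"] intro!: mult_right_mono)
  finally have 1: "norm ?T \<le> ?b + norm ?S"
    by simp
  have "ennreal (norm ?S) \<le> (\<integral>\<^sup>+t. ennreal (norm (indicator {R<..} t *\<^sub>R (?e t * of_real (lfac' t)))) \<partial>lborel)"
    using i2 unfolding set_lebesgue_integral_def set_integrable_def by (rule integral_norm_bound_ennreal)
  also have "\<dots> \<le> (\<integral>\<^sup>+t. ennreal (indicator {R<..} t * (?k t)) \<partial>lborel)"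
    using b R by (intro nn_integral_mono ennreal_leI) (auto simp: norm_mult ne mult.commute[of "exp _"] mult.commute[of "cos \<phi>"] intro!: mult_right_mono split: split_indicator)
  finally have 2: "ennreal (norm ?S) \<le> \<dots>" .
  have "ennreal (norm ?T) \<le>
     ennreal (?b + norm ?S)"
    using 1 by (rule ennreal_leI)
  also have "\<dots> = ennreal (?b) + ennreal (norm ?S)"
    using C by (intro ennreal_plus) auto
  also note add_left_mono[OF 2]
  finally show ?thesis .
qed


text \<open>Read off from the Laplace transform at p = 1: on the range t \<le> R the factor exp(R)
  exp(-t) is at least 1.\<close>

lemma lfac_set_integrable: "set_integrable lborel {0<..R} lfac"
proof -
  have "set_integrable lborel {0<..} (\<lambda>t. exp (- (1 * complex_of_real t)) * of_real (lfac t))"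
    by (rule lfac_Laplace) simp
  then have "set_integrable lborel {0<..R} (\<lambda>t. exp (- (1 * complex_of_real t)) * of_real (lfac t))"
    by (rule set_integrable_subset) auto
  then have "set_integrable lborel {0<..R} (\<lambda>t. exp R *\<^sub>R (exp (- (1 * complex_of_real t)) * of_real (lfac t)))"
    by (rule set_integrable_scaleR_right)
  then show ?thesis
  proof (rule set_integrable_bound)
    show "AE t in lborel. t \<in> {0<..R} \<longrightarrow> norm (lfac t) \<le> norm (exp R *\<^sub>R (exp (- (1 * complex_of_real t)) * of_real (lfac t)))"
    proof (intro AE_I2 impI)
      fix t assume t: "t \<in> {0<..R}"
      have "\<bar>lfac t\<bar> * 1 \<le> \<bar>lfac t\<bar> * (exp R * exp (- t))"
        using t by (intro mult_left_mono) (auto simp flip: exp_add)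
      then show "norm (lfac t) \<le> norm (exp R *\<^sub>R (exp (- (1 * complex_of_real t)) * of_real (lfac t)))"
        by (simp add: norm_mult mult_ac)
    qed
  qed (simp add: set_borel_measurable_def)
qed

text \<open>On a bounded range of t, |\<open>lfac\<close>| alone dominates, so Poisson's integral
  may be inserted and the order of integration exchanged. Integrability over the arc is recorded for
  the later subtraction.\<close>

lemma lfac_bser_angular:
  shows "complex_of_real (trunc R) =
    of_real (pc \<nu>) * (\<integral>\<phi>. twist \<phi> * Lap {0<..R} \<phi> \<partial>M)" (is ?eq)
    and "integrable M (\<lambda>\<phi>. twist \<phi> * Lap {0<..R} \<phi>)" (is ?int)
proof -
  let ?i = "\<lambda>t. indicator {0<..R} t *\<^sub>R complex_of_real (lfac t)"
  let ?F = "\<lambda>\<phi> t. indicator {0<..R} t *\<^sub>R (twist \<phi> * (exp (- (cis \<phi> * complex_of_real t)) * of_real (lfac t)))"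
  have a: "\<nu> - 1/2 > -1" using nu by simp
  have h: "integrable lborel (\<lambda>t. indicator {0<..R} t *\<^sub>R \<bar>lfac t\<bar>)"
    using set_integrable_abs[OF lfac_set_integrable[of R]] by (simp add: set_integrable_def)
  have m: "case_prod ?F \<in> borel_measurable (borel \<Otimes>\<^sub>M borel)" by measurable
  have le: "norm (?F \<phi> t) \<le> indicator {0<..R} t *\<^sub>R \<bar>lfac t\<bar>" if "\<phi> \<in> rarc" for \<phi> t
    using exp_cis_le_1[OF that, of t] mult_right_mono[of "exp (- (t * cos \<phi>))" 1 "\<bar>lfac t\<bar>"]
    by (auto simp: norm_mult mult.commute[of "cos \<phi>"] split: split_indicator)
  have e: "(\<integral>t. ?F \<phi> t \<partial>lborel) = twist \<phi> * Lap {0<..R} \<phi>" for \<phi>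
    unfolding set_lebesgue_integral_def by (subst integral_mult_right_zero[symmetric]) (simp add: scaleR_conv_of_real mult_ac)
  show ?int using arcm_Fubini(2)[OF a h m le] unfolding e .
  have "complex_of_real (trunc R) = (\<integral>t. indicator {0<..R} t *\<^sub>R (of_real (lfac t) * complex_of_real (bser \<nu> ((t/2)\<^sup>2))) \<partial>lborel)"
    unfolding set_lebesgue_integral_def by (subst integral_complex_of_real[symmetric]) (simp add: scaleR_conv_of_real)
  also have "\<dots> = (\<integral>t. of_real (pc \<nu>) * (\<integral>\<phi>. ?F \<phi> t \<partial>M) \<partial>lborel)"
  proof (rule Bochner_Integration.integral_cong[OF refl])
    fix t :: real
    have "(\<integral>\<phi>. ?F \<phi> t \<partial>M) = (\<integral>\<phi>. ?i t * (twist \<phi> * exp (- (of_real t * cis \<phi>))) \<partial>M)"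
      by (simp add: scaleR_conv_of_real mult_ac)
    also have "\<dots> = ?i t * (\<integral>\<phi>. twist \<phi> * exp (- (of_real t * cis \<phi>)) \<partial>M)"
      by (rule integral_mult_right_zero)
    finally show "indicator {0<..R} t *\<^sub>R (of_real (lfac t) * complex_of_real (bser \<nu> ((t/2)\<^sup>2))) = of_real (pc \<nu>) * (\<integral>\<phi>. ?F \<phi> t \<partial>M)"
      using bser_angular[of \<nu> t] nu by (simp add: scaleR_conv_of_real mult_ac)
  qed
  also have "\<dots> = of_real (pc \<nu>) * (\<integral>t. (\<integral>\<phi>. ?F \<phi> t \<partial>M) \<partial>lborel)"
    by (rule integral_mult_right_zero)
  also have "(\<integral>t. (\<integral>\<phi>. ?F \<phi> t \<partial>M) \<partial>lborel) = (\<integral>\<phi>. (\<integral>t. ?F \<phi> t \<partial>lborel) \<partial>M)"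
    by (rule arcm_Fubini(1)[OF a h m le])
  finally show ?eq by (simp only: e)
qed

text \<open>On the unit circle 1/q is the conjugate of q, so no change of variables is made:
  \<open>twist\<close> times q^(-2\<nu>-1) is the conjugate of \<open>twist\<close>, the whole
  integrand is the conjugate of the one in \<open>bser_angular\<close> at X, and \<open>bser\<close>
  is real. No interchange of integrals occurs here.\<close>

lemma lfac_full_angular:
  shows "complex_of_real (bser \<nu> ((X/2)\<^sup>2)) =
    of_real (pc \<nu>) * (\<integral>\<phi>. twist \<phi> * Lap {0<..} \<phi> \<partial>M)" (is ?eq)
    and "integrable M (\<lambda>\<phi>. twist \<phi> * Lap {0<..} \<phi>)" (is ?int)
proof -
  have a: "\<nu> - 1/2 > -1" using nu by simp
  let ?g = "\<lambda>\<phi>. twist \<phi> * exp (- (complex_of_real X * cis \<phi>))"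
  let ?D = "\<lambda>\<phi>. LINT t:{0<..}|lborel. exp (- (cis \<phi> * of_real t)) * complex_of_real (lfac t)"
  have eq: "twist \<phi> * ?D \<phi> = cnj (?g \<phi>)" if "\<phi> \<in> rarc" for \<phi>
  proof -
    have "?D \<phi> = cis (- (2 * \<nu> + 1) * \<phi>) * exp (- (of_real X / cis \<phi>))"
      using cos_arc_pos[OF that] by (subst lfac_Laplace(2)) (simp_all only: cis.simps cis_powr_real[OF that])
    also have "of_real X / cis \<phi> = cnj (of_real X * cis \<phi>)" by (simp add: divide_inverse cis_cnj)
    also have "exp (- cnj (of_real X * cis \<phi>)) = cnj (exp (- (of_real X * cis \<phi>)))" by (simp add: exp_cnj)
    finally have "twist \<phi> * ?D \<phi> = (twist \<phi> * cis (- (2 * \<nu> + 1) * \<phi>)) * cnj (exp (- (of_real X * cis \<phi>)))"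
      by simp
    also have "twist \<phi> * cis (- (2 * \<nu> + 1) * \<phi>) = cnj (twist \<phi>)"
      by (simp add: cis_mult cis_cnj) (simp add: algebra_simps)
    finally show ?thesis by simp
  qed
  have m: "(\<lambda>\<phi>. twist \<phi> * ?D \<phi>) \<in> borel_measurable borel"
    unfolding set_lebesgue_integral_def by measurable
  have AE: "AE \<phi> in M. twist \<phi> * ?D \<phi> = cnj (?g \<phi>)"
    using AE_arcm by eventually_elim (rule eq)
  have g: "integrable M (\<lambda>\<phi>. cnj (?g \<phi>))"
    by (rule integrable_arcm[OF a, where C = 1])
       (use exp_cis_le_1[of _ X] X in \<open>auto simp: norm_mult\<close>)
  show ?int
    by (subst integrable_cong_AE[OF _ _ AE]) (use m g in auto)
  have "(\<integral>\<phi>. twist \<phi> * ?D \<phi> \<partial>M) = (\<integral>\<phi>. cnj (?g \<phi>) \<partial>M)"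
    by (rule integral_cong_AE[OF _ _ AE]) (use m in auto)
  also have "\<dots> = cnj (\<integral>\<phi>. ?g \<phi> \<partial>M)" by (rule Bochner_Integration.integral_cnj)
  finally have "of_real (pc \<nu>) * (\<integral>\<phi>. twist \<phi> * ?D \<phi> \<partial>M) = cnj (of_real (pc \<nu>) * (\<integral>\<phi>. ?g \<phi> \<partial>M))"
    by simp
  also have "\<dots> = cnj (complex_of_real (bser \<nu> ((X/2)\<^sup>2)))"
    using bser_angular[of \<nu> X] nu by simp
  finally show ?eq by simp
qed

text \<open>For each \<phi> the difference of the two arc integrands is the Laplace tail beyond R.
  Its boundary term integrates to R^(\<nu>-1/4) R^(-\<nu>-1/2) = R^(-3/4), the remaining one to the
  tail of t^(-5/4).\<close>

lemma lfac_bser_tail: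
  "\<exists>K\<ge>0. \<exists>R0\<ge>1. \<forall>R\<ge>R0. \<bar>trunc R - bser \<nu> ((X/2)\<^sup>2)\<bar>
     \<le> K * (R powr (-3/4) + 4 * R powr (-1/4))"
proof -
  let ?z = "\<lambda>R. R powr (-3/4) + 4 * R powr (-1/4)"
  let ?l = "bser \<nu> ((X/2)\<^sup>2)"
  let ?m = "M"
  have a: "\<nu> - 1/2 > -1" using nu by simp
  obtain C R0 where C: "C \<ge> 0" "R0 \<ge> 1" and b: "\<And>t. t \<ge> R0 \<Longrightarrow> \<bar>lfac t\<bar> \<le> C * t powr (\<nu> - 1/4) \<and> \<bar>lfac' t\<bar> \<le> C * t powr (\<nu> - 3/4)"
    using lfac_bounds by blast
  obtain K where K: "K \<ge> 0" "\<And>t. t > 0 \<Longrightarrow> (\<integral>\<phi>. exp (- (t * cos \<phi>)) \<partial>?m) \<le> K * t powr (- (\<nu> - 1/2 + 1))"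
    using arcm_exp_decay[OF a] by blast
  have nn: "(\<integral>\<^sup>+\<phi>. ennreal (c * exp (- (t * cos \<phi>))) \<partial>?m) \<le> ennreal (c * (K * t powr (- \<nu> - 1/2)))"
    if "t > 0" "c \<ge> 0" for t c
  proof -
    have "- (\<nu> - 1/2 + 1) = - \<nu> - 1/2" by simp
    then have "(\<integral>\<phi>. exp (- (t * cos \<phi>)) \<partial>?m) \<le> K * t powr (- \<nu> - 1/2)"
      using K(2)[OF that(1)] by (simp only:)
    then have "c * (\<integral>\<phi>. exp (- (t * cos \<phi>)) \<partial>?m) \<le> c * (K * t powr (- \<nu> - 1/2))"
      using that by (intro mult_left_mono)
    from ennreal_leI[OF this] show ?thesis
      using integrable_arcm_exp[OF a, of t] that by (subst nn_integral_eq_integral) auto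
  qed
  interpret finite_measure ?m by (rule finite_measure_arcm[OF a])
  interpret pair_sigma_finite ?m lborel ..
  have "\<bar>trunc R - ?l\<bar> \<le> pc \<nu> * (C * K) * ?z R"
    if R: "R \<ge> R0" for R
  proof -
    have R1: "R \<ge> 1" using R C by simp
    let ?w = "\<lambda>\<phi>. twist \<phi>"
    let ?e = "\<lambda>\<phi> t. exp (- (cis \<phi> * of_real t)) * complex_of_real (lfac t)"
    let ?T = "\<lambda>\<phi>. LINT t:{R<..}|lborel. ?e \<phi> t"
    let ?D = "\<lambda>\<phi>. ?w \<phi> * (LINT t:{0<..R}|lborel. ?e \<phi> t) - ?w \<phi> * (LINT t:{0<..}|lborel. ?e \<phi> t)"
    have D: "norm (?D \<phi>) = norm (?T \<phi>)" if \<phi>: "\<phi> \<in> rarc" for \<phi>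
    proof -
      have i: "set_integrable lborel {0<..} (?e \<phi>)"
        using cos_arc_pos[OF \<phi>] by (intro lfac_Laplace) simp
      have "(LINT t:{0<..R} \<union> {R<..}|lborel. ?e \<phi> t) = (LINT t:{0<..R}|lborel. ?e \<phi> t) + ?T \<phi>"
        using R1 by (intro set_integral_Un set_integrable_subset[OF i]) auto
      moreover have "{0<..R} \<union> {R<..} = {0<..}" using R1 by auto
      ultimately have "?D \<phi> = - (?w \<phi> * ?T \<phi>)" by (simp add: algebra_simps)
      then show ?thesis by (simp add: norm_mult)
    qed
    have Dint: "integrable (?m) ?D"
      by (intro Bochner_Integration.integrable_diff lfac_bser_angular lfac_full_angular)
    have "complex_of_real (trunc R - ?l) = of_real (pc \<nu>) * (\<integral>\<phi>. ?D \<phi> \<partial>?m)"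
      unfolding of_real_diff lfac_bser_angular(1) lfac_full_angular(1)
      by (subst Bochner_Integration.integral_diff[OF lfac_bser_angular(2) lfac_full_angular(2)]) (simp add: algebra_simps)
    from arg_cong[OF this, of norm]
    have "\<bar>trunc R - ?l\<bar> = \<bar>pc \<nu>\<bar> * norm (\<integral>\<phi>. ?D \<phi> \<partial>?m)"
      by (simp only: norm_of_real norm_mult)
    also have "\<bar>pc \<nu>\<bar> = pc \<nu>" using pc_pos[of \<nu>] nu by simp
    finally have eqn: "\<bar>trunc R - ?l\<bar> = pc \<nu> * norm (\<integral>\<phi>. ?D \<phi> \<partial>?m)" .
    have "ennreal (norm (\<integral>\<phi>. ?D \<phi> \<partial>?m)) \<le> ennreal (C * K * ?z R)"
    proof -
      let ?tail = "\<lambda>\<phi> t. ennreal (indicator {R<..} t * (C * t powr (\<nu> - 3/4) * exp (- (t * cos \<phi>))))"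
      have "ennreal (norm (\<integral>\<phi>. ?D \<phi> \<partial>?m)) \<le> (\<integral>\<^sup>+\<phi>. ennreal (norm (?D \<phi>)) \<partial>?m)"
        using Dint by (rule integral_norm_bound_ennreal)
      also have "\<dots> \<le> (\<integral>\<^sup>+\<phi>. ennreal (C * R powr (\<nu> - 1/4) * exp (- (R * cos \<phi>))) + (\<integral>\<^sup>+t. ?tail \<phi> t \<partial>lborel) \<partial>?m)"
      proof (rule nn_integral_mono_AE)
        have "ennreal (norm (?D \<phi>)) \<le> ennreal (C * R powr (\<nu> - 1/4) * exp (- (R * cos \<phi>))) + (\<integral>\<^sup>+t. ?tail \<phi> t \<partial>lborel)"
          if "\<phi> \<in> rarc" for \<phi>
          unfolding D[OF that] by (rule Laplace_tail[OF that C b R])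
        then show "AE \<phi> in ?m. ennreal (norm (?D \<phi>)) \<le> ennreal (C * R powr (\<nu> - 1/4) * exp (- (R * cos \<phi>))) + (\<integral>\<^sup>+t. ?tail \<phi> t \<partial>lborel)"
          using AE_arcm by (rule eventually_mono[rotated])
      qed
      also have "\<dots> = (\<integral>\<^sup>+\<phi>. ennreal (C * R powr (\<nu> - 1/4) * exp (- (R * cos \<phi>))) \<partial>?m) + (\<integral>\<^sup>+\<phi>. (\<integral>\<^sup>+t. ?tail \<phi> t \<partial>lborel) \<partial>?m)"
        by (intro nn_integral_add) auto
      \<comment> \<open>Integrating over \<phi> first supplies the decay t^(-\<nu>-1/2), which makes
        the t-integral converge.\<close>
      also have "(\<integral>\<^sup>+\<phi>. (\<integral>\<^sup>+t. ?tail \<phi> t \<partial>lborel) \<partial>?m) = (\<integral>\<^sup>+t. (\<integral>\<^sup>+\<phi>. ?tail \<phi> t \<partial>?m) \<partial>lborel)"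
        by (rule Fubini'[symmetric]) measurable
      also have "\<dots> \<le> (\<integral>\<^sup>+t. ennreal (C * K) * ennreal (indicator {R<..} t * t powr (-5/4)) \<partial>lborel)"
      proof (rule nn_integral_mono)
        fix t :: real
        show "(\<integral>\<^sup>+\<phi>. ?tail \<phi> t \<partial>?m) \<le> ennreal (C * K) * ennreal (indicator {R<..} t * t powr (-5/4))"
        proof (cases "t > R")
          case True
          have "(\<integral>\<^sup>+\<phi>. ?tail \<phi> t \<partial>?m) \<le> ennreal (C * t powr (\<nu> - 3/4) * (K * t powr (- \<nu> - 1/2)))"
            using True R1 C nn[of t "C * t powr (\<nu> - 3/4)"] by simp
          also have "C * t powr (\<nu> - 3/4) * (K * t powr (- \<nu> - 1/2)) = C * K * (t powr (\<nu> - 3/4) * t powr (- \<nu> - 1/2))"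
            by simp
          also have "t powr (\<nu> - 3/4) * t powr (- \<nu> - 1/2) = t powr (-5/4)"
            by (simp flip: powr_add)
          finally show ?thesis using True C K by (simp add: ennreal_mult')
        qed simp
      qed
      also have "\<dots> = ennreal (C * K) * (\<integral>\<^sup>+t. ennreal (indicator {R<..} t * t powr (-5/4)) \<partial>lborel)"
        by (rule nn_integral_cmult) auto
      also have "\<dots> \<le> ennreal (C * K) * ennreal (4 * R powr (-1/4))"
        using R1 by (intro mult_left_mono nn_integral_powr_tail) auto
      also have "\<dots> = ennreal (C * K * (4 * R powr (-1/4)))"
        using C K by (simp add: ennreal_mult')
      also have "(\<integral>\<^sup>+\<phi>. ennreal (C * R powr (\<nu> - 1/4) * exp (- (R * cos \<phi>))) \<partial>?m) \<le> ennreal (C * K * R powr (-3/4))"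
      proof -
        have "(\<integral>\<^sup>+\<phi>. ennreal (C * R powr (\<nu> - 1/4) * exp (- (R * cos \<phi>))) \<partial>?m) \<le> ennreal (C * R powr (\<nu> - 1/4) * (K * R powr (- \<nu> - 1/2)))"
          using R1 C by (intro nn) auto
        also have "C * R powr (\<nu> - 1/4) * (K * R powr (- \<nu> - 1/2)) = C * K * (R powr (\<nu> - 1/4) * R powr (- \<nu> - 1/2))"
          by simp
        also have "R powr (\<nu> - 1/4) * R powr (- \<nu> - 1/2) = R powr (-3/4)"
          by (simp flip: powr_add)
        finally show ?thesis .
      qed
      also have "ennreal (C * K * R powr (-3/4)) + ennreal (C * K * (4 * R powr (-1/4))) = ennreal (C * K * ?z R)"
        using C K by (subst ennreal_plus[symmetric]) (auto simp: algebra_simps)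
      finally show ?thesis by (simp add: add_mono)
    qed
    then have "norm (\<integral>\<phi>. ?D \<phi> \<partial>?m) \<le> C * K * ?z R"
      using C K by (subst (asm) ennreal_le_iff) auto
    then have "pc \<nu> * norm (\<integral>\<phi>. ?D \<phi> \<partial>?m) \<le> pc \<nu> * (C * K * ?z R)"
      using pc_pos[of \<nu>] nu by (intro mult_left_mono) auto
    then show ?thesis unfolding eqn by (simp only: mult.assoc)
  qed
  then show ?thesis using C K pc_pos[of \<nu>] nu
    by (intro exI[of _ "pc \<nu> * (C * K)"] conjI exI[of _ R0]) auto
qed

lemma lfac_bser_limit:
  "((\<lambda>R. trunc R) \<longlongrightarrow> bser \<nu> ((X/2)\<^sup>2)) at_top"
proof -
  obtain K R0 where K: "\<And>R. R \<ge> R0 \<Longrightarrow> \<bar>trunc R - bser \<nu> ((X/2)\<^sup>2)\<bar>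
     \<le> K * (R powr (-3/4) + 4 * R powr (-1/4))" using lfac_bser_tail by blast
  have "((\<lambda>R::real. K * (R powr (-3/4) + 4 * R powr (-1/4))) \<longlongrightarrow> 0) at_top" by real_asymp
  then have "((\<lambda>R. trunc R - bser \<nu> ((X/2)\<^sup>2)) \<longlongrightarrow> 0) at_top"
  proof (rule Lim_null_comparison[rotated])
    show "\<forall>\<^sub>F R in at_top. norm (trunc R - bser \<nu> ((X/2)\<^sup>2)) \<le> K * (R powr (-3/4) + 4 * R powr (-1/4))"
      using eventually_ge_at_top[of R0] by eventually_elim (use K in simp)
  qed
  then show ?thesis by (simp add: LIM_zero_iff)
qed

end

section \<open>The second integral\<close>

definition rbes :: "real \<Rightarrow> real \<Rightarrow> real" where "rbes \<beta> x = bser \<beta> ((x/2)\<^sup>2)"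

lemma borel_measurable_rbes [measurable]: "rbes \<beta> \<in> borel_measurable borel"
  unfolding rbes_def[abs_def] by measurable

lemma continuous_on_rbes [continuous_intros]: "continuous_on A f \<Longrightarrow> continuous_on A (\<lambda>x. rbes \<beta> (f x))"
  unfolding rbes_def by (intro continuous_on_bser continuous_intros) auto

lemma DERIV_rbes: "(rbes \<beta> has_real_derivative - (x/2 * rbes (\<beta> + 1) x)) (at x)"
proof -
  have "((\<lambda>x. bser \<beta> ((x/2)\<^sup>2)) has_real_derivative - bser (\<beta> + 1) ((x/2)\<^sup>2) * (x/2)) (at x)"
    by (rule DERIV_chain2[OF has_field_derivative_bser]) (auto intro!: derivative_eq_intros simp: power2_eq_square field_simps)
  then show ?thesis by (simp add: rbes_def[abs_def] mult.commute)
qed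

lemma rbes_0: "rbes \<beta> 0 = rGamma (\<beta> + 1)"
  by (simp add: rbes_def bser_0)

text \<open>Poisson's integral with the damping replaced by 1. An explicit bound, so that its
  dependence on the order can be followed in \<open>Hk_bounded\<close>.\<close>

definition rbes_bound :: "real \<Rightarrow> real" where "rbes_bound \<beta> = pc \<beta> * measure (arcm (\<beta> - 1/2)) UNIV"

lemma rbes_bound_nonneg: "\<beta> > -1/2 \<Longrightarrow> rbes_bound \<beta> \<ge> 0"
  unfolding rbes_bound_def using pc_pos[of \<beta>] by simp

lemma abs_rbes_le: "\<beta> > -1/2 \<Longrightarrow> \<bar>rbes \<beta> x\<bar> \<le> rbes_bound \<beta>"
  using abs_bser_le_mass[of \<beta> "\<bar>x\<bar>"] by (simp add: rbes_def rbes_bound_def power_divide)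

section \<open>Absolute integrability of \<open>rbes\<close> for orders above 1/2\<close>

lemma nn_integral_arcm_Suc:
  assumes [measurable]: "f \<in> borel_measurable borel"
  shows "(\<integral>\<^sup>+\<phi>. f \<phi> \<partial>arcm (a + 1)) = (\<integral>\<^sup>+\<phi>. ennreal (2 * cos \<phi>) * f \<phi> \<partial>arcm a)"
proof -
  have "ennreal (indicator rarc \<phi> * (2 * cos \<phi>) powr (a + 1)) * f \<phi>
      = ennreal (indicator rarc \<phi> * (2 * cos \<phi>) powr a) * (ennreal (2 * cos \<phi>) * f \<phi>)" for \<phi>
    using cos_arc_pos[of \<phi>]
    by (cases "\<phi> \<in> rarc") (auto simp: powr_add mult.assoc[symmetric] ennreal_mult[symmetric])
  then show ?thesis unfolding arcm_def by (subst (1 2) nn_integral_density) auto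
qed

text \<open>The density gains a factor 2 cos \<phi> \<le> 2. This is the source of the growth 2^k in
  \<open>Hk_bounded\<close>.\<close>

lemma measure_arcm_Suc_le:
  assumes a: "a > -1"
  shows "measure (arcm (a + 1)) UNIV \<le> 2 * measure (arcm a) UNIV"
proof -
  interpret A: finite_measure "arcm a" by (rule finite_measure_arcm[OF a])
  interpret B: finite_measure "arcm (a + 1)" by (rule finite_measure_arcm) (use a in simp)
  have "emeasure (arcm (a + 1)) UNIV = (\<integral>\<^sup>+\<phi>. 1 \<partial>arcm (a + 1))" by simp
  also have "\<dots> = (\<integral>\<^sup>+\<phi>. ennreal (2 * cos \<phi>) * 1 \<partial>arcm a)" by (rule nn_integral_arcm_Suc) auto
  also have "\<dots> \<le> (\<integral>\<^sup>+\<phi>. ennreal 2 \<partial>arcm a)" unfolding mult_1_right by (intro nn_integral_mono ennreal_leI) simp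
  also have "\<dots> = ennreal (2 * measure (arcm a) UNIV)" by (simp add: A.emeasure_eq_measure ennreal_mult)
  finally show ?thesis by (simp add: B.emeasure_eq_measure)
qed

lemma nn_integral_exp_Ioi:
  assumes "c > 0"
  shows "(\<integral>\<^sup>+t. ennreal (indicator {0<..} t * exp (- (t * c))) \<partial>lborel) = ennreal (1 / c)"
proof -
  have "has_bochner_integral lborel (\<lambda>t. indicator {0<..} t * (t powr 0 * exp (- (c * t)))) (Gamma (0 + 1) * c powr (- (0 + 1)))"
    using assms by (intro has_bochner_integral_Gamma) auto
  also have "(\<lambda>t. indicator {0<..} t * (t powr 0 * exp (- (c * t)))) = (\<lambda>t::real. indicator {0<..} t * exp (- (t * c)))"
    by (auto simp: mult.commute split: split_indicator)
  also have "Gamma (0 + 1) * c powr (- (0 + 1)) = 1 / c" using assms by (simp add: powr_minus divide_inverse)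
  finally have "has_bochner_integral lborel (\<lambda>t::real. indicator {0<..} t * exp (- (t * c))) (1 / c)" .
  then show ?thesis by (subst nn_integral_eq_integral) (auto simp: has_bochner_integral_iff)
qed

text \<open>Integrating exp(-t cos \<phi>) over t gives 1/cos \<phi>, which one power of the weight
  absorbs: the weight exponent drops from \<alpha> - 1/2 to \<alpha> - 3/2, still above -1. The 2 is
  the one in 2 cos \<phi>.\<close>

lemma rbes_integrable:
  assumes al: "\<alpha> > 1/2"
  shows "set_integrable lborel {0<..} (rbes \<alpha>)"
    and "(LINT t:{0<..}|lborel. \<bar>rbes \<alpha> t\<bar>) \<le> 2 * pc \<alpha> * measure (arcm (\<alpha> - 3/2)) UNIV"
proof -
  let ?e = "\<lambda>t \<phi>. ennreal (indicator {0<..} t * exp (- (t * cos \<phi>)))"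
  let ?m = "measure (arcm (\<alpha> - 3/2)) UNIV"
  let ?j = "\<integral>\<^sup>+t. ennreal (indicator {0<..} t * \<bar>rbes \<alpha> t\<bar>) \<partial>lborel"
  let ?a = "\<alpha> - 3/2"
  have a: "?a > -1" "?a + 1 > -1" "\<alpha> > -1/2" using al by auto
  have aa: "\<alpha> - 1/2 = ?a + 1" by simp
  interpret A: finite_measure "arcm ?a" by (rule finite_measure_arcm[OF a(1)])
  interpret B: finite_measure "arcm (?a + 1)" by (rule finite_measure_arcm[OF a(2)])
  interpret pair_sigma_finite "arcm (?a + 1)" lborel ..
  have "?j \<le>
     (\<integral>\<^sup>+t. ennreal (pc \<alpha>) * (\<integral>\<^sup>+\<phi>. ?e t \<phi> \<partial>arcm (?a + 1)) \<partial>lborel)"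
  proof (rule nn_integral_mono)
    fix t :: real
    show "ennreal (indicator {0<..} t * \<bar>rbes \<alpha> t\<bar>) \<le> ennreal (pc \<alpha>) * (\<integral>\<^sup>+\<phi>. ?e t \<phi> \<partial>arcm (?a + 1))"
    proof (cases "t > 0")
      case True
      have "ennreal \<bar>rbes \<alpha> t\<bar> \<le> ennreal (pc \<alpha> * (\<integral>\<phi>. exp (- (t * cos \<phi>)) \<partial>arcm (?a + 1)))"
        using abs_bser_le_arcm[OF a(3), of t] True unfolding rbes_def aa by (intro ennreal_leI) auto
      also have "\<dots> = ennreal (pc \<alpha>) * ennreal (\<integral>\<phi>. exp (- (t * cos \<phi>)) \<partial>arcm (?a + 1))"
        using pc_pos[OF a(3)] by (simp add: ennreal_mult')
      also have "ennreal (\<integral>\<phi>. exp (- (t * cos \<phi>)) \<partial>arcm (?a + 1)) = (\<integral>\<^sup>+\<phi>. ennreal (exp (- (t * cos \<phi>))) \<partial>arcm (?a + 1))"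
        using integrable_arcm_exp[OF a(2), of t] True by (intro nn_integral_eq_integral[symmetric]) auto
      finally show ?thesis using True by simp
    qed simp
  qed
  also have "\<dots> = ennreal (pc \<alpha>) * (\<integral>\<^sup>+t. (\<integral>\<^sup>+\<phi>. ?e t \<phi> \<partial>arcm (?a + 1)) \<partial>lborel)"
    by (rule nn_integral_cmult) measurable
  also have "(\<integral>\<^sup>+t. (\<integral>\<^sup>+\<phi>. ?e t \<phi> \<partial>arcm (?a + 1)) \<partial>lborel)
     = (\<integral>\<^sup>+\<phi>. (\<integral>\<^sup>+t. ?e t \<phi> \<partial>lborel) \<partial>arcm (?a + 1))"
    by (rule Fubini') measurable
  also have "\<dots> = (\<integral>\<^sup>+\<phi>. ennreal (2 * cos \<phi>) * (\<integral>\<^sup>+t. ?e t \<phi> \<partial>lborel) \<partial>arcm ?a)"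
    by (rule nn_integral_arcm_Suc) measurable
  also have "\<dots> = (\<integral>\<^sup>+\<phi>. ennreal 2 \<partial>arcm ?a)"
  proof (rule nn_integral_cong_AE)
    have "ennreal (2 * cos \<phi>) * (\<integral>\<^sup>+t. ?e t \<phi> \<partial>lborel) = ennreal 2"
      if "\<phi> \<in> rarc" for \<phi>
      using cos_arc_pos[OF that] by (simp add: nn_integral_exp_Ioi ennreal_mult'[symmetric])
    then show "AE \<phi> in arcm ?a. ennreal (2 * cos \<phi>) * (\<integral>\<^sup>+t. ?e t \<phi> \<partial>lborel) = ennreal 2"
      using AE_arcm by (rule eventually_mono[rotated])
  qed
  also have "\<dots> = ennreal (2 * ?m)" by (simp add: A.emeasure_eq_measure ennreal_mult)
  finally have le: "?j \<le> ennreal (2 * pc \<alpha> * ?m)"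
    using pc_pos[OF a(3)] by (simp add: ennreal_mult'[symmetric] mult_ac)
  show I: "set_integrable lborel {0<..} (rbes \<alpha>)" unfolding set_integrable_def
  proof (rule integrableI_bounded)
    have "(\<integral>\<^sup>+t. ennreal (norm (indicator {0<..} t *\<^sub>R rbes \<alpha> t)) \<partial>lborel) \<le> ennreal (2 * pc \<alpha> * ?m)"
      using le by (simp add: abs_mult)
    also have "\<dots> < \<infinity>" by simp
    finally show "(\<integral>\<^sup>+t. ennreal (norm (indicator {0<..} t *\<^sub>R rbes \<alpha> t)) \<partial>lborel) < \<infinity>" .
  qed simp
  have "ennreal (LINT t:{0<..}|lborel. \<bar>rbes \<alpha> t\<bar>) = ?j"
    unfolding set_lebesgue_integral_def using set_integrable_abs[OF I]
    by (subst nn_integral_eq_integral) (auto simp: set_integrable_def)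
  then have "ennreal (LINT t:{0<..}|lborel. \<bar>rbes \<alpha> t\<bar>) \<le> ennreal (2 * pc \<alpha> * ?m)"
    using le by (simp only:)
  then show "(LINT t:{0<..}|lborel. \<bar>rbes \<alpha> t\<bar>) \<le> 2 * pc \<alpha> * ?m"
    using pc_pos[OF a(3)] by (subst (asm) ennreal_le_iff) auto
qed

section \<open>The integral of \<open>rbes\<close> over \<open>{0..R}\<close> and its conditional
  limit\<close>

lemma set_integral_Ioc_eq_Icc:
  fixes f :: "real \<Rightarrow> real"
  assumes "f \<in> borel_measurable borel"
  shows "(LINT t:{a<..b}|lborel. f t) = (LINT t:{a..b}|lborel. f t)"
  unfolding set_lebesgue_integral_def
proof (rule integral_cong_AE)
  show "AE t in lborel. indicator {a<..b} t *\<^sub>R f t = indicator {a..b} t *\<^sub>R f t"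
    using AE_lborel_singleton[of a] by eventually_elim (auto split: split_indicator)
qed (use assms in auto)

definition rbes_int :: "real \<Rightarrow> real \<Rightarrow> real" where "rbes_int \<alpha> R = (LINT t:{0..R}|lborel. rbes \<alpha> t)"

text \<open>The t-integral of exp(-t q) up to R is (1 - exp(-R q))/q, bounded by 2 on the arc, so
  dominated convergence applies even when \<open>rbes\<close> itself is not absolutely integrable.
  The division by q lowers the Fourier index to the diagonal one, whose coefficient is
  \<pi>.\<close>

lemma rbes_int_tendsto:
  assumes al: "\<alpha> > -1/2"
  shows "(rbes_int \<alpha> \<longlongrightarrow> pi * pc \<alpha>) at_top"
proof -
  let ?x = "\<lambda>R \<phi>. exp (- (complex_of_real R * cis \<phi>))"
  let ?M = "arcm (\<alpha> - 1/2)"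
  have a: "\<alpha> - 1/2 > -1" using al by simp
  interpret finite_measure ?M by (rule finite_measure_arcm[OF a])
  let ?s = "\<lambda>R \<phi>. cis ((\<alpha> + 1/2) * \<phi>) * ((1 - exp (- (of_real R * cis \<phi>))) / cis \<phi>)"
  have eq: "complex_of_real (rbes_int \<alpha> R) = of_real (pc \<alpha>) * (\<integral>\<phi>. ?s R \<phi> \<partial>?M)" if R: "R \<ge> 0" for R
  proof -
    let ?F = "\<lambda>\<phi> t. indicator {0..R} t *\<^sub>R (cis ((\<alpha> + 1/2) * \<phi>) * exp (- (complex_of_real t * cis \<phi>)))"
    have h: "integrable lborel (indicator {0..R} :: real \<Rightarrow> real)" by (rule integrable_real_indicator) (auto simp: emeasure_lborel_Icc_eq)
    have m: "case_prod ?F \<in> borel_measurable (borel \<Otimes>\<^sub>M borel)" by measurable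
    have le: "norm (?F \<phi> t) \<le> indicator {0..R} t" if "\<phi> \<in> rarc" for \<phi> t
      using exp_cis_le_1[OF that, of t] by (auto simp: norm_mult split: split_indicator)
    have inner: "(\<integral>t. ?F \<phi> t \<partial>lborel) = ?s R \<phi>" for \<phi>
    proof -
      let ?E = "\<lambda>t. exp (- (complex_of_real t * cis \<phi>))"
      have "has_bochner_integral lborel (\<lambda>t. indicator {0..R} t *\<^sub>R ?E t) ((- ?E R / cis \<phi>) - (- ?E 0 / cis \<phi>))"
      proof (rule has_bochner_integral_FTC_Icc[OF R])
        fix t
        have "((\<lambda>z. - exp (- (z * cis \<phi>)) / cis \<phi>) has_field_derivative ?E t) (at (complex_of_real t))"
          by (auto intro!: derivative_eq_intros)
        from has_vector_derivative_real_field[OF this]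
        show "((\<lambda>t. - ?E t / cis \<phi>) has_vector_derivative ?E t) (at t within {0..R})"
          by (rule has_vector_derivative_at_within)
      qed (intro continuous_intros)
      then have "(\<integral>t. indicator {0..R} t *\<^sub>R ?E t \<partial>lborel) = (1 - ?E R) / cis \<phi>"
        by (simp add: has_bochner_integral_iff diff_divide_distrib)
      moreover have "(\<integral>t. ?F \<phi> t \<partial>lborel) = cis ((\<alpha> + 1/2) * \<phi>) * (\<integral>t. indicator {0..R} t *\<^sub>R ?E t \<partial>lborel)"
        by (subst integral_mult_right_zero[symmetric]) (simp add: scaleR_conv_of_real mult_ac)
      ultimately show ?thesis by simp
    qed
    have "complex_of_real (rbes_int \<alpha> R) = (\<integral>t. indicator {0..R} t *\<^sub>R complex_of_real (rbes \<alpha> t) \<partial>lborel)"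
      unfolding rbes_int_def set_lebesgue_integral_def by (subst integral_complex_of_real[symmetric]) (simp add: scaleR_conv_of_real)
    also have "\<dots> = (\<integral>t. of_real (pc \<alpha>) * (\<integral>\<phi>. ?F \<phi> t \<partial>?M) \<partial>lborel)"
      using al by (intro Bochner_Integration.integral_cong refl) (simp add: rbes_def bser_angular)
    also have "\<dots> = of_real (pc \<alpha>) * (\<integral>t. (\<integral>\<phi>. ?F \<phi> t \<partial>?M) \<partial>lborel)"
      by (rule integral_mult_right_zero)
    also have "(\<integral>t. (\<integral>\<phi>. ?F \<phi> t \<partial>?M) \<partial>lborel) = (\<integral>\<phi>. (\<integral>t. ?F \<phi> t \<partial>lborel) \<partial>?M)"
      by (rule arcm_Fubini(1)[OF a h m le])
    finally show ?thesis by (simp only: inner)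
  qed
  let ?l = "\<lambda>\<phi>. cis ((\<alpha> + 1/2) * \<phi>) * ((1 - 0) / cis \<phi>)"
  have "((\<lambda>R. \<integral>\<phi>. ?s R \<phi> \<partial>?M) \<longlongrightarrow> (\<integral>\<phi>. ?l \<phi> \<partial>?M)) at_top"
  proof (rule integral_dominated_convergence_at_top)
    show "\<forall>\<^sub>F R in at_top. AE \<phi> in ?M. norm (?s R \<phi>) \<le> 2"
    proof (rule eventually_mono[OF eventually_ge_at_top[of 0]])
      fix R :: real assume R: "R \<ge> 0"
      have "norm (?s R \<phi>) \<le> 2" if "\<phi> \<in> rarc" for \<phi>
      proof -
        have "norm (1 - ?x R \<phi>) \<le> 1 + exp (- (R * cos \<phi>))"
          using norm_triangle_ineq4[of 1 "?x R \<phi>"] by simp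
        then have "norm (1 - ?x R \<phi>) \<le> 2"
          using exp_cis_le_1[OF that R] by linarith
        then show ?thesis by (simp add: norm_mult norm_divide)
      qed
      then show "AE \<phi> in ?M. norm (?s R \<phi>) \<le> 2"
        using AE_arcm by (rule eventually_mono[rotated])
    qed
    have "((\<lambda>R. ?s R \<phi>) \<longlongrightarrow> ?l \<phi>) at_top" if "\<phi> \<in> rarc" for \<phi>
    proof -
      have c: "cos \<phi> > 0" by (rule cos_arc_pos[OF that])
      have "((\<lambda>R. exp (- (R * cos \<phi>))) \<longlongrightarrow> 0) at_top" using c by real_asymp
      then have "((\<lambda>R. norm (?x R \<phi>)) \<longlongrightarrow> 0) at_top" by simp
      then have "((\<lambda>R. ?x R \<phi>) \<longlongrightarrow> 0) at_top" by (rule tendsto_norm_zero_cancel)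
      then show ?thesis by (intro tendsto_intros) auto
    qed
    then show "AE \<phi> in ?M. ((\<lambda>R. ?s R \<phi>) \<longlongrightarrow> ?l \<phi>) at_top"
      using AE_arcm by (rule eventually_mono[rotated])
  qed auto
  also have "(\<integral>\<phi>. ?l \<phi> \<partial>?M) = arc_coeff (\<alpha> - 1/2) (\<alpha> - 1/2)"
    unfolding arc_coeff_def by (intro Bochner_Integration.integral_cong refl) (simp add: cis_divide algebra_simps)
  also have "\<dots> = of_real pi" by (rule arc_coeff_diag[OF a])
  finally have "((\<lambda>R. of_real (pc \<alpha>) * (\<integral>\<phi>. ?s R \<phi> \<partial>?M)) \<longlongrightarrow> of_real (pc \<alpha>) * of_real pi) at_top"
    by (intro tendsto_intros)
  then have "((\<lambda>R. complex_of_real (rbes_int \<alpha> R)) \<longlongrightarrow> of_real (pc \<alpha>) * of_real pi) at_top"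
    by (rule Lim_transform_eventually) (rule eventually_mono[OF eventually_ge_at_top[of 0]], simp add: eq)
  then have "((\<lambda>R. complex_of_real (rbes_int \<alpha> R)) \<longlongrightarrow> of_real (pi * pc \<alpha>)) at_top"
    by (simp add: mult.commute)
  then show ?thesis by (subst (asm) tendsto_of_real_iff)
qed

lemma set_integrable_rbes_Icc: "set_integrable lborel {a..b} (rbes \<alpha>)"
  by (intro borel_integrable_atLeastAtMost' continuous_on_rbes continuous_on_id)

lemma abs_rbes_int_le:
  assumes "\<alpha> > -1/2" "R \<ge> 0"
  shows "\<bar>rbes_int \<alpha> R\<bar> \<le> rbes_bound \<alpha> * R" "(LINT t:{0..R}|lborel. \<bar>rbes \<alpha> t\<bar>) \<le> rbes_bound \<alpha> * R"
proof -
  have "(LINT t:{0..R}|lborel. \<bar>rbes \<alpha> t\<bar>) \<le> (LINT t:{0..R}|lborel. rbes_bound \<alpha>)"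
    by (intro set_integral_mono set_integrable_abs set_integrable_rbes_Icc borel_integrable_atLeastAtMost' continuous_intros abs_rbes_le assms)
  also have "\<dots> = rbes_bound \<alpha> * R" using assms by (simp add: set_lebesgue_integral_def)
  finally show 1: "(LINT t:{0..R}|lborel. \<bar>rbes \<alpha> t\<bar>) \<le> rbes_bound \<alpha> * R" .
  have "\<bar>rbes_int \<alpha> R\<bar> \<le> (LINT t:{0..R}|lborel. \<bar>rbes \<alpha> t\<bar>)"
    unfolding rbes_int_def using set_integral_norm_bound[OF set_integrable_rbes_Icc[of 0 R \<alpha>]] by simp
  with 1 show "\<bar>rbes_int \<alpha> R\<bar> \<le> rbes_bound \<alpha> * R" by linarith
qed

lemma borel_measurable_rbes_int [measurable]: "rbes_int \<alpha> \<in> borel_measurable borel"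
proof -
  have "rbes_int \<alpha> = (\<lambda>R. \<integral>t. (if 0 \<le> t \<and> t \<le> R then rbes \<alpha> t else 0) \<partial>lborel)"
    unfolding rbes_int_def set_lebesgue_integral_def
    by (intro ext Bochner_Integration.integral_cong refl) (auto split: split_indicator)
  also have "\<dots> \<in> borel_measurable borel" by measurable
  finally show ?thesis .
qed


text \<open>The function H of the overview. As a Lebesgue integral it is used only where \<alpha> >
  1/2 gives absolute convergence; otherwise limits of integrals over \<open>{0<..R}\<close> take its
  place.\<close>

definition rbes_conv :: "real \<Rightarrow> real \<Rightarrow> real \<Rightarrow> real" where
  "rbes_conv \<alpha> \<beta> y = (LINT v:{0<..}|lborel. rbes \<alpha> v * rbes \<beta> (y / v))"

lemma rbes_FTC: "x \<ge> 0 \<Longrightarrow> (LINT v:{0..x}|lborel. v / 2 * rbes (\<beta> + 1) v) = rbes \<beta> 0 - rbes \<beta> x"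
proof -
  assume x: "x \<ge> 0"
  have "has_bochner_integral lborel (\<lambda>v. indicator {0..x} v *\<^sub>R (v / 2 * rbes (\<beta> + 1) v)) (- rbes \<beta> x - (- rbes \<beta> 0))"
  proof (rule has_bochner_integral_FTC_Icc[OF x])
    fix v
    have "((\<lambda>v. - rbes \<beta> v) has_real_derivative v / 2 * rbes (\<beta> + 1) v) (at v within {0..x})"
      using DERIV_minus[OF DERIV_subset[OF DERIV_rbes]] by force
    then show "((\<lambda>v. - rbes \<beta> v) has_vector_derivative v / 2 * rbes (\<beta> + 1) v) (at v within {0..x})"
      by (simp add: has_real_derivative_iff_has_vector_derivative)
  qed (intro continuous_intros, auto)
  then show ?thesis unfolding set_lebesgue_integral_def by (simp add: has_bochner_integral_iff)
qed

text \<open>Both sides are iterated integrals of \<open>rbes \<alpha> c * (v/2) * rbes (\<beta> + 1) v\<close> over the region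
  \<open>c \<le> R\<close>, \<open>v c \<le> y\<close>.\<close>

lemma rbes_product_cutoff:
  assumes al: "\<alpha> > -1/2" and be: "\<beta> > -1/2" and y: "y > 0" and R: "R > 0"
  shows "(LINT c:{0<..R}|lborel. rbes \<alpha> c * rbes \<beta> (y / c)) =
    rGamma (\<beta> + 1) * rbes_int \<alpha> R - (LINT v:{0<..}|lborel. v / 2 * rbes (\<beta> + 1) v * rbes_int \<alpha> (min R (y / v)))"
proof -
  let ?j = "\<lambda>v. v / 2 * rbes (\<beta> + 1) v"
  let ?J = "\<lambda>v. rbes_bound \<alpha> * y / 2 * (indicator {0<..} v *\<^sub>R rbes (\<beta> + 1) v)"
  define G where "G v c = (if 0 < c \<and> c \<le> R \<and> 0 < v \<and> v * c \<le> y then rbes \<alpha> c * (?j v) else 0)" for v c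
  have Gm [measurable]: "case_prod G \<in> borel_measurable (lborel \<Otimes>\<^sub>M lborel)"
    unfolding G_def[abs_def] by measurable
  have Gc: "G v c = indicator {0<..} v * (?j v) * (indicator {0<..min R (y / v)} c *\<^sub>R rbes \<alpha> c)" for v c
    by (auto simp: G_def field_simps split: split_indicator)
  have Gv: "G v c = indicator {0<..R} c * rbes \<alpha> c * (indicator {0<..y / c} v *\<^sub>R (?j v))" for v c
    by (auto simp: G_def field_simps split: split_indicator)
  have int_c: "(\<integral>c. G v c \<partial>lborel) = indicator {0<..} v *\<^sub>R (?j v * rbes_int \<alpha> (min R (y / v)))" for v
  proof -
    have "(\<integral>c. G v c \<partial>lborel) = indicator {0<..} v * (?j v) * (LINT c:{0<..min R (y / v)}|lborel. rbes \<alpha> c)"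
      unfolding Gc set_lebesgue_integral_def by (rule integral_mult_right_zero)
    then show ?thesis by (simp add: set_integral_Ioc_eq_Icc rbes_int_def)
  qed
  have ni: "integrable lborel (\<lambda>c. indicator {0<..m} c *\<^sub>R rbes \<alpha> c)" for m
  proof -
    have "set_integrable lborel {0<..m} (rbes \<alpha>)"
      by (rule set_integrable_subset[OF set_integrable_rbes_Icc[of 0 m]]) auto
    then show ?thesis by (simp add: set_integrable_def)
  qed
  have "integrable (lborel \<Otimes>\<^sub>M lborel) (case_prod G)"
  proof (rule lborel_pair.Fubini_integrable[OF Gm])
    have "integrable lborel (\<lambda>v. ?J v)"
      using rbes_integrable(1)[of "\<beta> + 1"] be by (intro integrable_mult_right) (simp add: set_integrable_def)
    then show "integrable lborel (\<lambda>v. \<integral>c. norm (case_prod G (v, c)) \<partial>lborel)"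
    proof (rule Bochner_Integration.integrable_bound)
      show "AE v in lborel. norm (\<integral>c. norm (case_prod G (v, c)) \<partial>lborel) \<le> norm (?J v)"
      proof (rule AE_I2)
        fix v :: real
        show "norm (\<integral>c. norm (case_prod G (v, c)) \<partial>lborel) \<le> norm (?J v)"
        proof (cases "v > 0")
          case True
          define m where "m = min R (y / v)"
          \<comment> \<open>The inequality v m \<le> y trades the unbounded factor v for the
            constant y, leaving \<open>rbes (\<beta> + 1)\<close>, which is integrable because
            \<beta> + 1 > 1/2.\<close>
          have m: "m \<ge> 0" "v * m \<le> y" using True y R by (auto simp: m_def min_def field_simps)
          have "(\<integral>c. norm (case_prod G (v, c)) \<partial>lborel) = \<bar>?j v\<bar> * (LINT c:{0<..m}|lborel. \<bar>rbes \<alpha> c\<bar>)"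
            unfolding set_lebesgue_integral_def
            by (subst integral_mult_right_zero[symmetric]) (use True in \<open>auto simp: Gc abs_mult m_def intro!: Bochner_Integration.integral_cong\<close>)
          also have "(LINT c:{0<..m}|lborel. \<bar>rbes \<alpha> c\<bar>) = (LINT c:{0..m}|lborel. \<bar>rbes \<alpha> c\<bar>)"
            by (rule set_integral_Ioc_eq_Icc) measurable
          also have "\<bar>?j v\<bar> * \<dots> \<le> \<bar>?j v\<bar> * (rbes_bound \<alpha> * m)"
            using m by (intro mult_left_mono abs_rbes_int_le al) auto
          also have "\<dots> = (v * m) * (rbes_bound \<alpha> / 2 * \<bar>rbes (\<beta> + 1) v\<bar>)"
            using True by (simp add: abs_mult)
          also have "\<dots> \<le> y * (rbes_bound \<alpha> / 2 * \<bar>rbes (\<beta> + 1) v\<bar>)"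
            using m rbes_bound_nonneg[OF al] by (intro mult_right_mono) auto
          finally show ?thesis using True y rbes_bound_nonneg[OF al] by (simp add: abs_mult integral_nonneg mult_ac)
        qed (simp add: Gc)
      qed
    qed measurable
    show "AE v in lborel. integrable lborel (\<lambda>c. case_prod G (v, c))"
      using ni by (simp add: Gc)
  qed
  then have swap: "(\<integral>c. (\<integral>v. G v c \<partial>lborel) \<partial>lborel) = (\<integral>v. (\<integral>c. G v c \<partial>lborel) \<partial>lborel)"
    by (rule lborel_pair.Fubini_integral)
  have int_v: "(\<integral>v. G v c \<partial>lborel) = indicator {0<..R} c *\<^sub>R (rbes \<beta> 0 * rbes \<alpha> c) - indicator {0<..R} c *\<^sub>R (rbes \<alpha> c * rbes \<beta> (y / c))" for c
  proof (cases "0 < c \<and> c \<le> R")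
    case True
    have "(\<integral>v. G v c \<partial>lborel) = indicator {0<..R} c * rbes \<alpha> c * (LINT v:{0<..y / c}|lborel. ?j v)"
      unfolding Gv set_lebesgue_integral_def by (rule integral_mult_right_zero)
    also have "(LINT v:{0<..y / c}|lborel. ?j v) = (LINT v:{0..y / c}|lborel. ?j v)"
      by (rule set_integral_Ioc_eq_Icc) measurable
    also have "\<dots> = rbes \<beta> 0 - rbes \<beta> (y / c)"
      using True y by (intro rbes_FTC) auto
    finally show ?thesis using True by (simp add: algebra_simps)
  qed (auto simp: Gv)
  have i1: "integrable lborel (\<lambda>c. indicator {0<..R} c *\<^sub>R (rbes \<beta> 0 * rbes \<alpha> c))"
  proof -
    have "integrable lborel (\<lambda>c. rbes \<beta> 0 * (indicator {0<..R} c *\<^sub>R rbes \<alpha> c))"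
      by (intro integrable_mult_right ni)
    then show ?thesis by (simp add: mult_ac)
  qed
  have i2: "integrable lborel (\<lambda>c. indicator {0<..R} c *\<^sub>R (rbes \<alpha> c * rbes \<beta> (y / c)))"
  proof (rule Bochner_Integration.integrable_bound)
    show "integrable lborel (\<lambda>c. rbes_bound \<beta> * (indicator {0<..R} c *\<^sub>R rbes \<alpha> c))"
      by (intro integrable_mult_right ni)
    show "AE c in lborel. norm (indicator {0<..R} c *\<^sub>R (rbes \<alpha> c * rbes \<beta> (y / c))) \<le> norm (rbes_bound \<beta> * (indicator {0<..R} c *\<^sub>R rbes \<alpha> c))"
      using abs_rbes_le[OF be] rbes_bound_nonneg[OF be]
      by (intro AE_I2) (auto simp: abs_mult mult.commute[of "rbes_bound _"] intro!: mult_left_mono split: split_indicator)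
  qed measurable
  have "(\<integral>c. (\<integral>v. G v c \<partial>lborel) \<partial>lborel) = rbes \<beta> 0 * rbes_int \<alpha> R - (LINT c:{0<..R}|lborel. rbes \<alpha> c * rbes \<beta> (y / c))"
  proof -
    have "(\<integral>c. indicator {0<..R} c *\<^sub>R (rbes \<beta> 0 * rbes \<alpha> c) \<partial>lborel) = rbes \<beta> 0 * (LINT c:{0<..R}|lborel. rbes \<alpha> c)"
      unfolding set_lebesgue_integral_def by (subst integral_mult_right_zero[symmetric]) (simp add: mult_ac)
    also have "(LINT c:{0<..R}|lborel. rbes \<alpha> c) = rbes_int \<alpha> R"
      by (simp add: set_integral_Ioc_eq_Icc rbes_int_def)
    finally show ?thesis
      unfolding int_v Bochner_Integration.integral_diff[OF i1 i2] by (simp only: set_lebesgue_integral_def)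
  qed
  then show ?thesis using swap unfolding int_c set_lebesgue_integral_def rbes_0 by linarith
qed

text \<open>Absorbs the factor v and makes the range of integration independent of v, as the second
  exchange of integrals in \<open>rbes_product_limit\<close> requires.\<close>

lemma rbes_int_scale:
  assumes v: "v > 0" and y: "y > 0"
  shows "v * rbes_int \<alpha> (y / v) = (LINT s:{0..y}|lborel. rbes \<alpha> (s / v))"
proof -
  have "rbes_int \<alpha> (y / v) = \<bar>1 / v\<bar> *\<^sub>R (\<integral>s. indicator {0..y / v} (0 + 1 / v * s) *\<^sub>R rbes \<alpha> (0 + 1 / v * s) \<partial>lborel)"
    unfolding rbes_int_def set_lebesgue_integral_def by (rule lborel_integral_real_affine) (use v in auto)
  also have "(\<lambda>s. indicator {0..y / v} (0 + 1 / v * s) *\<^sub>R rbes \<alpha> (0 + 1 / v * s)) = (\<lambda>s. indicator {0..y} s *\<^sub>R rbes \<alpha> (s / v))"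
    using v by (auto simp: field_simps split: split_indicator)
  finally show ?thesis using v by (simp add: set_lebesgue_integral_def)
qed

text \<open>The second factor is bounded and the first is integrable. The bound does not depend on
  y, and its constants are explicit for the growth estimate.\<close>

lemma rbes_conv_integrable:
  assumes "\<alpha> > 1/2" "\<beta> > -1/2"
  shows "set_integrable lborel {0<..} (\<lambda>v. rbes \<alpha> v * rbes \<beta> (y / v))"
    and "\<bar>rbes_conv \<alpha> \<beta> y\<bar> \<le> rbes_bound \<beta> * (2 * pc \<alpha> * measure (arcm (\<alpha> - 3/2)) UNIV)"
proof -
  have I: "set_integrable lborel {0<..} (\<lambda>v. rbes_bound \<beta> * \<bar>rbes \<alpha> v\<bar>)"
    by (intro set_integrable_mult_right set_integrable_abs rbes_integrable assms)
  have le: "\<bar>rbes \<alpha> v * rbes \<beta> (y / v)\<bar> \<le> rbes_bound \<beta> * \<bar>rbes \<alpha> v\<bar>" for v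
    unfolding abs_mult mult.commute[of "rbes_bound _"] by (intro mult_left_mono abs_rbes_le assms) auto
  show J: "set_integrable lborel {0<..} (\<lambda>v. rbes \<alpha> v * rbes \<beta> (y / v))"
  proof (rule set_integrable_bound[OF I])
    show "AE v in lborel. v \<in> {0<..} \<longrightarrow> norm (rbes \<alpha> v * rbes \<beta> (y / v)) \<le> norm (rbes_bound \<beta> * \<bar>rbes \<alpha> v\<bar>)"
      using le by (intro AE_I2 impI) (simp add: order_trans[OF _ abs_ge_self] abs_mult rbes_bound_nonneg[OF assms(2)])
  qed (simp add: set_borel_measurable_def)
  have "\<bar>rbes_conv \<alpha> \<beta> y\<bar> \<le> (LINT v:{0<..}|lborel. \<bar>rbes \<alpha> v * rbes \<beta> (y / v)\<bar>)"
    unfolding rbes_conv_def using set_integral_norm_bound[OF J] by simp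
  also have "\<dots> \<le> (LINT v:{0<..}|lborel. rbes_bound \<beta> * \<bar>rbes \<alpha> v\<bar>)"
    by (intro set_integral_mono set_integrable_abs J I le)
  also have "\<dots> = rbes_bound \<beta> * (LINT v:{0<..}|lborel. \<bar>rbes \<alpha> v\<bar>)" by simp
  also have "\<dots> \<le> rbes_bound \<beta> * (2 * pc \<alpha> * measure (arcm (\<alpha> - 3/2)) UNIV)"
    by (intro mult_left_mono rbes_integrable assms rbes_bound_nonneg)
  finally show "\<bar>rbes_conv \<alpha> \<beta> y\<bar> \<le> rbes_bound \<beta> * (2 * pc \<alpha> * measure (arcm (\<alpha> - 3/2)) UNIV)" .
qed

lemma borel_measurable_rbes_conv [measurable]: "rbes_conv \<alpha> \<beta> \<in> borel_measurable borel"
  unfolding rbes_conv_def[abs_def] set_lebesgue_integral_def by measurable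

text \<open>After the cutoff identity all conditional convergence sits in the single term
  \<open>rbes_int \<alpha> R\<close>, whose limit is known. The other term converges absolutely, so
  dominated convergence and then Fubini apply.\<close>

lemma rbes_product_limit:
  assumes al: "\<alpha> > -1/2" and be: "\<beta> > -1/2" and y: "y > 0"
  shows "((\<lambda>R. LINT c:{0<..R}|lborel. rbes \<alpha> c * rbes \<beta> (y / c)) \<longlongrightarrow>
    rGamma (\<beta> + 1) * (pi * pc \<alpha>) - 1/2 * (LINT s:{0..y}|lborel. rbes_conv (\<beta> + 1) \<alpha> s)) at_top"
proof -
  let ?J = "\<lambda>v. indicator {0<..} v *\<^sub>R rbes (\<beta> + 1) v"
  let ?R = "LINT s:{0..y}|lborel. rbes_conv (\<beta> + 1) \<alpha> s"
  let ?g = "\<lambda>R v. indicator {0<..} v *\<^sub>R (v / 2 * rbes (\<beta> + 1) v * rbes_int \<alpha> (min R (y / v)))"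
  let ?l = "\<lambda>v. indicator {0<..} v *\<^sub>R (v / 2 * rbes (\<beta> + 1) v * rbes_int \<alpha> (y / v))"
  have "((\<lambda>R. \<integral>v. ?g R v \<partial>lborel) \<longlongrightarrow> (\<integral>v. ?l v \<partial>lborel)) at_top"
  proof (rule integral_dominated_convergence_at_top)
    show "integrable lborel (\<lambda>v. rbes_bound \<alpha> * y / 2 * (indicator {0<..} v *\<^sub>R \<bar>rbes (\<beta> + 1) v\<bar>))"
      using set_integrable_abs[OF rbes_integrable(1)[of "\<beta> + 1"]] be by (intro integrable_mult_right) (simp add: set_integrable_def)
    show "\<forall>\<^sub>F R in at_top. AE v in lborel. norm (?g R v) \<le> rbes_bound \<alpha> * y / 2 * (indicator {0<..} v *\<^sub>R \<bar>rbes (\<beta> + 1) v\<bar>)"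
    proof (rule eventually_mono[OF eventually_ge_at_top[of 0]], rule AE_I2)
      fix R v :: real assume R: "R \<ge> 0"
      show "norm (?g R v) \<le> rbes_bound \<alpha> * y / 2 * (indicator {0<..} v *\<^sub>R \<bar>rbes (\<beta> + 1) v\<bar>)"
      proof (cases "v > 0")
        case True
        define m where "m = min R (y / v)"
        have m: "m \<ge> 0" "v * m \<le> y" using True y R by (auto simp: m_def min_def field_simps)
        have "norm (?g R v) = \<bar>v / 2 * rbes (\<beta> + 1) v\<bar> * \<bar>rbes_int \<alpha> m\<bar>"
          using True by (simp add: abs_mult m_def)
        also have "\<dots> \<le> \<bar>v / 2 * rbes (\<beta> + 1) v\<bar> * (rbes_bound \<alpha> * m)"
          using m by (intro mult_left_mono abs_rbes_int_le al) auto
        also have "\<dots> = (v * m) * (rbes_bound \<alpha> / 2 * \<bar>rbes (\<beta> + 1) v\<bar>)"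
          using True by (simp add: abs_mult)
        also have "\<dots> \<le> y * (rbes_bound \<alpha> / 2 * \<bar>rbes (\<beta> + 1) v\<bar>)"
          using m rbes_bound_nonneg[OF al] by (intro mult_right_mono) auto
        finally show ?thesis using True by (simp add: mult_ac)
      qed simp
    qed
    have "((\<lambda>R. ?g R v) \<longlongrightarrow> ?l v) at_top" for v
      by (rule tendsto_eventually) (rule eventually_mono[OF eventually_ge_at_top[of "y / v"]], simp add: min_def)
    then show "AE v in lborel. ((\<lambda>R. ?g R v) \<longlongrightarrow> ?l v) at_top" by simp
  qed measurable
  then have "((\<lambda>R. rGamma (\<beta> + 1) * rbes_int \<alpha> R - (\<integral>v. ?g R v \<partial>lborel)) \<longlongrightarrow> rGamma (\<beta> + 1) * (pi * pc \<alpha>) - (\<integral>v. ?l v \<partial>lborel)) at_top"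
    by (intro tendsto_intros rbes_int_tendsto al)
  then have lim: "((\<lambda>R. LINT c:{0<..R}|lborel. rbes \<alpha> c * rbes \<beta> (y / c)) \<longlongrightarrow> rGamma (\<beta> + 1) * (pi * pc \<alpha>) - (\<integral>v. ?l v \<partial>lborel)) at_top"
    by (rule Lim_transform_eventually)
       (rule eventually_mono[OF eventually_gt_at_top[of 0]], rule sym, simp only: rbes_product_cutoff[OF al be y, unfolded set_lebesgue_integral_def] set_lebesgue_integral_def)
  \<comment> \<open>Integrating over s returns twice \<open>?l\<close>; integrating over v gives
    \<open>rbes_conv (\<beta> + 1) \<alpha> s\<close>. Here the two parameters exchange
    places.\<close>
  define G where "G v s = (?J v) * (indicator {0..y} s *\<^sub>R rbes \<alpha> (s / v))" for v s
  have Gm [measurable]: "case_prod G \<in> borel_measurable (lborel \<Otimes>\<^sub>M lborel)"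
    unfolding G_def[abs_def] by measurable
  have Gs: "(\<integral>s. G v s \<partial>lborel) = 2 * ?l v" for v
  proof (cases "v > 0")
    case True
    have "(\<integral>s. G v s \<partial>lborel) = (?J v) * (LINT s:{0..y}|lborel. rbes \<alpha> (s / v))"
      unfolding G_def set_lebesgue_integral_def by (rule integral_mult_right_zero)
    then show ?thesis unfolding rbes_int_scale[OF True y, symmetric] by simp
  qed (simp add: G_def)
  have Gv: "(\<integral>v. G v s \<partial>lborel) = indicator {0..y} s *\<^sub>R rbes_conv (\<beta> + 1) \<alpha> s" for s
    unfolding rbes_conv_def set_lebesgue_integral_def by (subst integral_scaleR_right[symmetric]) (simp add: G_def mult_ac)
  have "integrable (lborel \<Otimes>\<^sub>M lborel) (case_prod G)"
  proof (rule lborel_pair.Fubini_integrable[OF Gm])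
    have I: "integrable lborel (\<lambda>s. indicator {0..y} s * rbes_bound \<alpha>)"
      by (intro integrable_mult_left integrable_real_indicator) (auto simp: emeasure_lborel_Icc_eq)
    have le: "norm (G v s) \<le> \<bar>?J v\<bar> * (indicator {0..y} s * rbes_bound \<alpha>)" for v s
      unfolding G_def real_norm_def abs_mult
      by (intro mult_mono) (use abs_rbes_le[OF al] in \<open>auto split: split_indicator\<close>)
    have J: "integrable lborel (\<lambda>s. G v s)" for v
    proof (rule Bochner_Integration.integrable_bound)
      show "integrable lborel (\<lambda>s. \<bar>?J v\<bar> * (indicator {0..y} s * rbes_bound \<alpha>))"
        by (intro integrable_mult_right I)
      show "AE s in lborel. norm (G v s) \<le> norm (\<bar>?J v\<bar> * (indicator {0..y} s * rbes_bound \<alpha>))"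
        by (intro AE_I2 order_trans[OF le]) simp
    qed measurable
    then show "AE v in lborel. integrable lborel (\<lambda>s. case_prod G (v, s))" by simp
    have "integrable lborel (\<lambda>v. \<bar>?J v\<bar> * (y * rbes_bound \<alpha>))"
      using rbes_integrable(1)[of "\<beta> + 1"] be by (intro integrable_mult_left integrable_abs) (simp add: set_integrable_def)
    then show "integrable lborel (\<lambda>v. \<integral>s. norm (case_prod G (v, s)) \<partial>lborel)"
    proof (rule Bochner_Integration.integrable_bound)
      show "AE v in lborel. norm (\<integral>s. norm (case_prod G (v, s)) \<partial>lborel) \<le> norm (\<bar>?J v\<bar> * (y * rbes_bound \<alpha>))"
      proof (rule AE_I2)
        fix v
        have "(\<integral>s. norm (case_prod G (v, s)) \<partial>lborel) \<le> (\<integral>s. \<bar>?J v\<bar> * (indicator {0..y} s * rbes_bound \<alpha>) \<partial>lborel)"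
          using le[of v] J[of v] I by (intro integral_mono integrable_mult_right) auto
        also have "\<dots> = \<bar>?J v\<bar> * (y * rbes_bound \<alpha>)"
          using y by simp
        finally show "norm (\<integral>s. norm (case_prod G (v, s)) \<partial>lborel) \<le> norm (\<bar>?J v\<bar> * (y * rbes_bound \<alpha>))"
          using y rbes_bound_nonneg[OF al] by (simp add: integral_nonneg abs_mult)
      qed
    qed measurable
  qed
  then have "(\<integral>s. (\<integral>v. G v s \<partial>lborel) \<partial>lborel) = (\<integral>v. (\<integral>s. G v s \<partial>lborel) \<partial>lborel)"
    by (rule lborel_pair.Fubini_integral)
  then have "?R = 2 * (\<integral>v. ?l v \<partial>lborel)"
    unfolding Gs Gv set_lebesgue_integral_def by (simp only: integral_mult_right_zero)
  then have "(\<integral>v. ?l v \<partial>lborel) = 1/2 * ?R" by simp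
  with lim show ?thesis by (simp only:)
qed

lemma set_integral_Ioc_tendsto:
  fixes f :: "real \<Rightarrow> real"
  assumes [measurable]: "f \<in> borel_measurable borel" and f: "set_integrable lborel {0<..} f"
  shows "((\<lambda>R. LINT t:{0<..R}|lborel. f t) \<longlongrightarrow> (LINT t:{0<..}|lborel. f t)) at_top"
  unfolding set_lebesgue_integral_def
proof (rule integral_dominated_convergence_at_top)
  show "integrable lborel (\<lambda>t. norm (indicator {0<..} t *\<^sub>R f t))"
    using f by (simp add: set_integrable_def)
  show "\<forall>\<^sub>F R in at_top. AE t in lborel. norm (indicator {0<..R} t *\<^sub>R f t) \<le> norm (indicator {0<..} t *\<^sub>R f t)"
    by (intro always_eventually allI AE_I2) (auto split: split_indicator)
  have "((\<lambda>R. indicator {0<..R} t *\<^sub>R f t) \<longlongrightarrow> indicator {0<..} t *\<^sub>R f t) at_top" for t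
    by (rule tendsto_eventually) (rule eventually_mono[OF eventually_ge_at_top[of t]], auto split: split_indicator)
  then show "AE t in lborel. ((\<lambda>R. indicator {0<..R} t *\<^sub>R f t) \<longlongrightarrow> indicator {0<..} t *\<^sub>R f t) at_top" by simp
qed measurable

text \<open>The differential relation between H functions together with the initial value, in
  integrated form, so that nothing is differentiated under the integral. For \<alpha> > 1/2 the
  limit of the truncated integrals is the integral itself.\<close>

lemma rbes_conv_rec:
  assumes al: "\<alpha> > 1/2" and be: "\<beta> > -1/2" and y: "y > 0"
  shows "rbes_conv \<alpha> \<beta> y = rGamma (\<beta> + 1) * (pi * pc \<alpha>) - 1/2 * (LINT s:{0..y}|lborel. rbes_conv (\<beta> + 1) \<alpha> s)"
proof -
  have "((\<lambda>R. LINT c:{0<..R}|lborel. rbes \<alpha> c * rbes \<beta> (y / c)) \<longlongrightarrow> rbes_conv \<alpha> \<beta> y) at_top"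
    unfolding rbes_conv_def by (rule set_integral_Ioc_tendsto) (use rbes_conv_integrable[OF al be] in auto)
  then show ?thesis
    using rbes_product_limit[of \<alpha> \<beta> y] al be y tendsto_unique[OF trivial_limit_at_top_linorder] by auto
qed

text \<open>Closed form of the value at y = 0. Only the pairs \<alpha> = \<beta> and \<alpha> =
  \<beta> + 1 occur in the iteration, and for these \<Gamma>(\<alpha> + 1/2) \<Gamma>(\<beta> + 1)
  is the product in the duplication formula.\<close>

lemma rbes_conv_constant:
  assumes "\<beta> > -1/2" "\<alpha> = \<beta> \<or> \<alpha> = \<beta> + 1"
  shows "rGamma (\<beta> + 1) * (pi * pc \<alpha>) = 2 powr (\<alpha> + \<beta>) * rGamma (\<alpha> + \<beta> + 1)"
proof -
  have "Gamma (\<alpha> + 1/2) * Gamma (\<beta> + 1) = 2 powr (- (\<alpha> + \<beta>)) * sqrt pi * Gamma (\<alpha> + \<beta> + 1)"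
    using assms(2)
  proof
    assume "\<alpha> = \<beta>"
    then show ?thesis
      using Gamma_legendre_duplication_real[of "\<beta> + 1/2"] assms(1) by (simp add: algebra_simps)
  next
    assume "\<alpha> = \<beta> + 1"
    then show ?thesis
      using Gamma_legendre_duplication_real[of "\<beta> + 1"] assms(1) by (simp add: algebra_simps)
  qed
  moreover have "Gamma (\<alpha> + 1/2) > 0" "Gamma (\<beta> + 1) > 0" "Gamma (\<alpha> + \<beta> + 1) > 0"
    using assms by (auto intro!: Gamma_real_pos)
  moreover have "pi = sqrt pi * sqrt pi" by simp
  ultimately show ?thesis
    unfolding pc_def rGamma_inverse_Gamma powr_minus
    by (simp add: divide_simps) (simp add: algebra_simps)
qed

section \<open>Solving the recursion by uniqueness\<close>

lemma set_integrable_bounded_Icc: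
  fixes f :: "real \<Rightarrow> real"
  assumes [measurable]: "f \<in> borel_measurable borel" and f: "\<And>s. s \<in> {a..b} \<Longrightarrow> \<bar>f s\<bar> \<le> K"
  shows "set_integrable lborel {a..b} f"
proof (rule set_integrable_bound)
  show "set_integrable lborel {a..b} (\<lambda>_. K)" by (intro borel_integrable_atLeastAtMost' continuous_intros)
  show "AE s in lborel. s \<in> {a..b} \<longrightarrow> norm (f s) \<le> norm K"
    using f by (intro AE_I2) (auto intro: order_trans[OF _ abs_ge_self])
qed (simp add: set_borel_measurable_def)

context
  fixes \<mu> :: real
  assumes mu: "\<mu> > -1/2"
begin

text \<open>The iteration \<open>(\<alpha>, \<beta>) \<mapsto> (\<beta> + 1, \<alpha>)\<close> started at \<open>(\<mu>, \<mu>)\<close>, and the functions satisfying the same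
  recursion in closed form. Both grow at most like \<open>2\<^sup>k\<close>, which forces them to coincide. At \<open>k = 0\<close>
  the integral defining \<open>Hk\<close> need not converge absolutely.\<close>

definition Hk :: "nat \<Rightarrow> real \<Rightarrow> real" where
  "Hk k = rbes_conv (\<mu> + real ((k + 1) div 2)) (\<mu> + real (k div 2))"

definition Lk :: "nat \<Rightarrow> real \<Rightarrow> real" where
  "Lk k y = 2 powr (2 * \<mu> + real k) * bser (2 * \<mu> + real k) y"

lemma Lk_rec:
  assumes y: "y \<ge> 0"
  shows "Lk k y = 2 powr (2 * \<mu> + real k) * rGamma (2 * \<mu> + real k + 1) - 1/2 * (LINT s:{0..y}|lborel. Lk (Suc k) s)"
proof -
  let ?p = "2 powr (2 * \<mu> + real k)"
  have p: "2 powr (2 * \<mu> + real (Suc k)) = 2 * ?p"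
    using powr_add[of 2 "2 * \<mu> + real k" 1] by (simp add: algebra_simps)
  have "has_bochner_integral lborel (\<lambda>s. indicator {0..y} s *\<^sub>R Lk (Suc k) s) (- 2 * Lk k y - (- 2 * Lk k 0))"
  proof (rule has_bochner_integral_FTC_Icc[OF y])
    fix s
    have "((\<lambda>s. - 2 * Lk k s) has_real_derivative - 2 * (?p * - bser (2 * \<mu> + real k + 1) s)) (at s)"
      unfolding Lk_def by (intro DERIV_cmult has_field_derivative_bser)
    also have "- 2 * (?p * - bser (2 * \<mu> + real k + 1) s) = Lk (Suc k) s"
      unfolding Lk_def p by (simp add: algebra_simps)
    finally show "((\<lambda>s. - 2 * Lk k s) has_vector_derivative Lk (Suc k) s) (at s within {0..y})"
      by (auto simp: has_real_derivative_iff_has_vector_derivative intro: has_vector_derivative_at_within)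
  qed (unfold Lk_def, intro continuous_intros)
  then have "(LINT s:{0..y}|lborel. Lk (Suc k) s) = 2 * Lk k 0 - 2 * Lk k y"
    unfolding set_lebesgue_integral_def by (simp only: has_bochner_integral_iff)
  moreover have "Lk k 0 = ?p * rGamma (2 * \<mu> + real k + 1)"
    by (simp add: Lk_def bser_0)
  ultimately show ?thesis by linarith
qed

lemma Hk_rec:
  assumes k: "k \<ge> 1" and y: "y > 0"
  shows "Hk k y = 2 powr (2 * \<mu> + real k) * rGamma (2 * \<mu> + real k + 1) - 1/2 * (LINT s:{0..y}|lborel. Hk (Suc k) s)"
proof -
  let ?A = "\<mu> + real ((k + 1) div 2)" and ?B = "\<mu> + real (k div 2)"
  \<comment> \<open>For k \<ge> 1 the first index is at least \<mu> + 1, hence in the range of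
    absolute convergence.\<close>
  have A: "?A > 1/2" using k mu by (simp add: le_div_geq)
  have B: "?B > -1/2" using mu by (simp add: add_strict_increasing2)
  have AB: "?A = ?B \<or> ?A = ?B + 1" by (cases "even k") (auto elim!: evenE oddE)
  have sum: "?A + ?B = 2 * \<mu> + real k" by (cases "even k") (auto elim!: evenE oddE)
  have S: "rbes_conv (?B + 1) ?A = Hk (Suc k)" unfolding Hk_def by (simp add: algebra_simps)
  show ?thesis
    using rbes_conv_rec[OF A B y] unfolding rbes_conv_constant[OF B AB] sum S by (simp add: Hk_def)
qed

text \<open>Both factors of the bound in \<open>rbes_conv_integrable\<close> contain the mass of a
  weight, which at most doubles with each unit of the order, while the constants \<open>pc\<close>
  stay bounded. The two numbers of doublings add up to k - 1.\<close>

lemma Hk_bounded: "\<exists>K\<ge>0. \<forall>k\<ge>1. \<forall>y. \<bar>Hk k y\<bar> \<le> K * 2 ^ k"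
proof -
  have a: "\<mu> - 1/2 > -1" using mu by simp
  define m where "m = measure (arcm (\<mu> - 1/2)) UNIV"
  have m0: "m \<ge> 0" by (simp add: m_def)
  have mass: "measure (arcm (\<mu> - 1/2 + real j)) UNIV \<le> 2 ^ j * m" for j
  proof (induction j)
    case (Suc j)
    have "measure (arcm (\<mu> - 1/2 + real (Suc j))) UNIV = measure (arcm (\<mu> - 1/2 + real j + 1)) UNIV" by (simp add: algebra_simps)
    also have "\<dots> \<le> 2 * measure (arcm (\<mu> - 1/2 + real j)) UNIV" by (rule measure_arcm_Suc_le) (use a in simp)
    also have "\<dots> \<le> 2 ^ Suc j * m" using Suc by simp
    finally show ?case .
  qed (simp add: m_def)
  obtain G where G: "G \<ge> 0" "\<And>j. \<bar>rGamma (\<mu> - 1/2 + real j + 1)\<bar> \<le> G"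
    using rGamma_shift_bounded by blast
  define P where "P = inverse (sqrt pi) * G"
  have P0: "P \<ge> 0" using G by (simp add: P_def)
  have pcP: "pc (\<mu> + real j) \<le> P" for j
  proof -
    have "pc (\<mu> + real j) = inverse (sqrt pi) * rGamma (\<mu> - 1/2 + real j + 1)"
      by (simp add: pc_def rGamma_inverse_Gamma algebra_simps)
    also have "\<dots> \<le> P" unfolding P_def using G(2)[of j] by (intro mult_left_mono) auto
    finally show ?thesis .
  qed
  have gen: "\<mu> + real j > -1/2" for j using mu by (simp add: add_strict_increasing2)
  have "\<bar>Hk k y\<bar> \<le> (2 * P * m * P * m) * 2 ^ k" if k: "k \<ge> 1" for k y
  proof -
    obtain j where j: "(k + 1) div 2 = Suc j" using k by (cases "(k + 1) div 2") auto
    have A: "\<mu> + real (Suc j) > 1/2" using gen[of j] by simp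
    have H: "\<bar>Hk k y\<bar> \<le> rbes_bound (\<mu> + real (k div 2)) * (2 * pc (\<mu> + real (Suc j)) * measure (arcm (\<mu> + real (Suc j) - 3/2)) UNIV)"
      unfolding Hk_def j by (rule rbes_conv_integrable(2)[OF A gen])
    have J: "rbes_bound (\<mu> + real (k div 2)) \<le> P * (2 ^ (k div 2) * m)"
    proof -
      have e: "\<mu> + real (k div 2) - 1/2 = \<mu> - 1/2 + real (k div 2)" by simp
      show ?thesis unfolding rbes_bound_def e
        using mass[of "k div 2"] pcP[of "k div 2"] P0 pc_pos[OF gen] by (intro mult_mono) (auto simp: less_imp_le)
    qed
    have Q: "2 * pc (\<mu> + real (Suc j)) * measure (arcm (\<mu> + real (Suc j) - 3/2)) UNIV \<le> 2 * P * (2 ^ j * m)"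
    proof -
      have e: "\<mu> + real (Suc j) - 3/2 = \<mu> - 1/2 + real j" by simp
      show ?thesis unfolding e
        using mass[of j] pcP[of "Suc j"] P0 pc_pos[OF gen[of "Suc j"]] by (intro mult_mono) (auto simp: less_imp_le)
    qed
    have "\<bar>Hk k y\<bar> \<le> P * (2 ^ (k div 2) * m) * (2 * P * (2 ^ j * m))"
      by (rule order_trans[OF H mult_mono[OF J Q]]) (use P0 m0 pc_pos[OF gen[of "Suc j"]] in auto)
    also have "P * (2 ^ (k div 2) * m) * (2 * P * (2 ^ j * m)) = (2 * P * m * P * m) * 2 ^ (k div 2 + j)"
      by (simp add: power_add)
    also have "\<dots> \<le> (2 * P * m * P * m) * 2 ^ k"
      using P0 m0 j by (intro mult_left_mono power_increasing) auto
    finally show ?thesis .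
  qed
  then show ?thesis using P0 m0 by (intro exI[of _ "2 * P * m * P * m"]) auto
qed

text \<open>For all k and j the coefficients use values of one sequence,
  \<open>rGamma (2 * \<mu> + real (k + j) + 1)\<close>, which is bounded. So \<open>bser\<close> is
  bounded by G exp(Y) uniformly in k, and the power of 2 in \<open>Lk\<close> gives the
  growth.\<close>

lemma Lk_bounded: "\<exists>K\<ge>0. \<forall>k. \<forall>y\<in>{0..Y}. \<bar>Lk k y\<bar> \<le> K * 2 ^ k"
proof -
  obtain G where G: "G \<ge> 0" "\<And>j. \<bar>rGamma (2 * \<mu> + real j + 1)\<bar> \<le> G"
    using rGamma_shift_bounded by blast
  have "\<bar>Lk k y\<bar> \<le> (2 powr (2 * \<mu>) * (G * exp Y)) * 2 ^ k" if y: "y \<in> {0..Y}" for k y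
  proof -
    have c: "norm (bcoeff (2 * \<mu> + real k) j * y ^ j) \<le> G * (y ^ j /\<^sub>R fact j)" for j
    proof -
      have "norm (bcoeff (2 * \<mu> + real k) j * y ^ j) = \<bar>rGamma (2 * \<mu> + real (k + j) + 1)\<bar> * (y ^ j / fact j)"
        using y by (simp add: bcoeff_def abs_mult add_ac)
      also have "\<dots> \<le> G * (y ^ j / fact j)" using y by (intro mult_right_mono G) auto
      finally show ?thesis by (simp add: divide_inverse mult_ac)
    qed
    have "\<bar>bser (2 * \<mu> + real k) y\<bar> \<le> (\<Sum>j. G * (y ^ j /\<^sub>R fact j))"
      unfolding bser_def of_real_eq_id id_apply real_norm_def[symmetric]
      by (rule norm_suminf_le) (intro c summable_mult summable_exp_generic)+
    also have "\<dots> = G * exp y" using exp_converges[of y] by (subst suminf_mult) (auto simp: sums_iff)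
    also have "\<dots> \<le> G * exp Y" using y G by (intro mult_left_mono) auto
    finally have l: "\<bar>bser (2 * \<mu> + real k) y\<bar> \<le> G * exp Y" .
    have "\<bar>Lk k y\<bar> = 2 powr (2 * \<mu>) * 2 ^ k * \<bar>bser (2 * \<mu> + real k) y\<bar>"
      by (simp add: Lk_def abs_mult powr_add powr_realpow)
    also have "\<dots> \<le> 2 powr (2 * \<mu>) * 2 ^ k * (G * exp Y)" by (intro mult_left_mono l) auto
    finally show ?thesis by (simp add: mult_ac)
  qed
  then show ?thesis using G by (intro exI[of _ "2 powr (2 * \<mu>) * (G * exp Y)"]) auto
qed

lemma borel_measurable_seq [measurable]: "Hk k \<in> borel_measurable borel" "Lk k \<in> borel_measurable borel"
  unfolding Hk_def Lk_def[abs_def] by measurable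

text \<open>The differences satisfy D_k(s) = -1/2 times the integral of D_(k+1) over 0 to s.
  Starting n levels up from the bound K 2^(k+n), n integrations give K 2^(k+n) (s/2)^n / n! = K 2^k
  s^n / n!, which tends to 0.\<close>

lemma Hk_eq_Lk:
  assumes k: "k \<ge> 1" and y: "y > 0"
  shows "Hk k y = Lk k y"
proof -
  obtain K1 where K1: "K1 \<ge> 0" "\<And>k y. k \<ge> 1 \<Longrightarrow> \<bar>Hk k y\<bar> \<le> K1 * 2 ^ k" using Hk_bounded by blast
  obtain K2 where K2: "K2 \<ge> 0" "\<And>k s. s \<in> {0..y} \<Longrightarrow> \<bar>Lk k s\<bar> \<le> K2 * 2 ^ k" using Lk_bounded by blast
  define K where "K = K1 + K2"
  have bound: "\<bar>Hk k s - Lk k s\<bar> \<le> K * 2 ^ k" if "k \<ge> 1" "s \<in> {0..y}" for k s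
    using K1(2)[OF that(1), of s] K2(2)[OF that(2), of k] abs_triangle_ineq4[of "Hk k s" "Lk k s"]
    by (simp add: K_def algebra_simps)
  have I: "set_integrable lborel {0..s} (Hk k)" "set_integrable lborel {0..s} (Lk k)" if "k \<ge> 1" "s \<le> y" for k s
    by (rule set_integrable_bounded_Icc[where K = "K1 * 2 ^ k"], measurable, use K1 that in blast)
       (rule set_integrable_bounded_Icc[where K = "K2 * 2 ^ k"], measurable, use K2 that in auto)
  have "\<bar>Hk k s - Lk k s\<bar> \<le> K * 2 ^ (k + n) * (s / 2) ^ n / fact n" if "k \<ge> 1" "s \<in> {0<..y}" for n k s
    using that
  proof (induction n arbitrary: k s)
    case 0
    then show ?case using bound[of k s] by simp
  next
    case (Suc n)
    let ?D = "\<lambda>s. Hk (Suc k) s - Lk (Suc k) s"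
    let ?c = "K * 2 ^ (Suc k + n) / 2 ^ n / fact n"
    have D: "set_integrable lborel {0..s} ?D"
      using Suc.prems by (intro set_integral_diff(1) I) auto
    have "Hk k s - Lk k s = - (1/2) * (LINT t:{0..s}|lborel. ?D t)"
      using Suc.prems by (subst set_integral_diff(2)) (auto simp: Hk_rec Lk_rec I algebra_simps)
    then have "\<bar>Hk k s - Lk k s\<bar> = 1/2 * \<bar>LINT t:{0..s}|lborel. ?D t\<bar>" by (simp add: abs_mult)
    also have "\<bar>LINT t:{0..s}|lborel. ?D t\<bar> \<le> (LINT t:{0..s}|lborel. \<bar>?D t\<bar>)"
      using set_integral_norm_bound[OF D] by simp
    \<comment> \<open>The induction hypothesis covers positive arguments only, so the end point 0 is
      dropped.\<close>
    also have "\<dots> = (LINT t:{0<..s}|lborel. \<bar>?D t\<bar>)"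
      by (rule set_integral_Ioc_eq_Icc[symmetric]) measurable
    also have "\<dots> \<le> (LINT t:{0<..s}|lborel. ?c * t ^ n)"
    proof (rule set_integral_mono)
      show "set_integrable lborel {0<..s} (\<lambda>t. \<bar>?D t\<bar>)"
        by (rule set_integrable_subset[OF set_integrable_abs[OF D]]) auto
      have "set_integrable lborel {0..s} (\<lambda>t. ?c * t ^ n)"
        by (intro borel_integrable_atLeastAtMost' continuous_intros)
      then show "set_integrable lborel {0<..s} (\<lambda>t. ?c * t ^ n)"
        by (rule set_integrable_subset) auto
      fix t assume "t \<in> {0<..s}"
      then show "\<bar>?D t\<bar> \<le> ?c * t ^ n"
        using Suc.IH[of "Suc k" t] Suc.prems by (simp add: power_divide)
    qed
    also have "\<dots> = (LINT t:{0..s}|lborel. ?c * t ^ n)" by (rule set_integral_Ioc_eq_Icc) measurable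
    also have "\<dots> = ?c * (LINT t:{0..s}|lborel. t ^ n)" by simp
    also have "(LINT t:{0..s}|lborel. t ^ n) = s ^ Suc n / real (Suc n)"
      using integral_power[of 0 s n] Suc.prems by (simp add: set_lebesgue_integral_def mult.commute)
    finally have "\<bar>Hk k s - Lk k s\<bar> \<le> 1/2 * (?c * (s ^ Suc n / real (Suc n)))" by simp
    also have "\<dots> = K * 2 ^ (k + Suc n) * (s / 2) ^ Suc n / fact (Suc n)"
      by (simp add: power_divide divide_simps)
    finally show ?case .
  qed
  from this[OF k] y have le: "\<bar>Hk k y - Lk k y\<bar> \<le> K * 2 ^ k * (y ^ n /\<^sub>R fact n)" for n
    by (force simp: power_add power_divide field_simps)
  have "(\<lambda>n. K * 2 ^ k * (y ^ n /\<^sub>R fact n)) \<longlonglongrightarrow> K * 2 ^ k * 0"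
    by (intro tendsto_intros summable_LIMSEQ_zero summable_exp_generic)
  then have "\<bar>Hk k y - Lk k y\<bar> \<le> 0"
    using le by (intro LIMSEQ_le_const[where X = "\<lambda>n. K * 2 ^ k * (y ^ n /\<^sub>R fact n)"]) auto
  then show ?thesis by simp
qed

text \<open>One last step of the recursion, from k = 1 down to the pair (\<mu>, \<mu>), in which the
  limit of truncated integrals stands for an integral that need not converge absolutely.\<close>

lemma rbes_product_limit_value:
  assumes y: "y > 0"
  shows "((\<lambda>R. LINT c:{0<..R}|lborel. rbes \<mu> c * rbes \<mu> (y / c)) \<longlongrightarrow> 4 powr \<mu> * bser (2 * \<mu>) y) at_top"
proof -
  have "(LINT s:{0..y}|lborel. rbes_conv (\<mu> + 1) \<mu> s) = (LINT s:{0<..y}|lborel. Hk 1 s)"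
    by (subst set_integral_Ioc_eq_Icc) (auto simp: Hk_def)
  also have "\<dots> = (LINT s:{0<..y}|lborel. Lk 1 s)"
    by (intro set_lebesgue_integral_cong) (auto simp: Hk_eq_Lk)
  also have "\<dots> = (LINT s:{0..y}|lborel. Lk 1 s)" by (rule set_integral_Ioc_eq_Icc) measurable
  finally have "rGamma (\<mu> + 1) * (pi * pc \<mu>) - 1/2 * (LINT s:{0..y}|lborel. rbes_conv (\<mu> + 1) \<mu> s) = Lk 0 y"
    using rbes_conv_constant[of \<mu> \<mu>] mu y Lk_rec[of y 0] by simp
  also have "Lk 0 y = 4 powr \<mu> * bser (2 * \<mu>) y"
    using powr_powr[of 2 2 \<mu>] by (simp add: Lk_def)
  finally show ?thesis using rbes_product_limit[OF mu mu y] by simp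
qed

end

section \<open>Passage to Bessel functions\<close>

lemma besselJ_log_bser:
  "besselJ_log \<nu> w = exp (of_real \<nu> * (w - of_real (ln 2))) * bser \<nu> ((exp w / 2)\<^sup>2)"
proof -
  have "(-1) ^ k / fact k * rGamma (of_real \<nu> + of_nat k + 1) = (of_real (bcoeff \<nu> k) :: complex)" for k
  proof -
    have "of_real \<nu> + of_nat k + 1 = complex_of_real (\<nu> + real k + 1)" by simp
    then show ?thesis by (simp only: rGamma_complex_of_real bcoeff_def) simp
  qed
  then show ?thesis unfolding besselJ_log_def bser_def by (simp add: power_mult)
qed

lemma besselJ_log_of_real_ln:
  "besselJ_log \<nu> (of_real l) = of_real ((exp l / 2) powr \<nu> * bser \<nu> ((exp l / 2)\<^sup>2))"
proof -
  have "exp (complex_of_real \<nu> * (of_real l - of_real (ln 2))) = of_real (exp (\<nu> * (l - ln 2)))"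
    by (simp add: exp_of_real flip: of_real_diff of_real_mult)
  also have "exp (\<nu> * (l - ln 2)) = (exp l / 2) powr \<nu>"
    by (simp add: powr_def ln_div)
  finally have 1: "exp (complex_of_real \<nu> * (of_real l - of_real (ln 2))) = of_real ((exp l / 2) powr \<nu>)" .
  have "(exp (complex_of_real l) / 2)\<^sup>2 = of_real ((exp l / 2)\<^sup>2)" by (simp add: exp_of_real)
  then show ?thesis unfolding besselJ_log_bser 1 by (simp only: bser_of_real of_real_mult)
qed

lemma besselJ_of_real_pos:
  assumes "x > 0"
  shows "besselJ \<nu> (of_real x) = of_real ((x / 2) powr \<nu> * rbes \<nu> x)"
  using besselJ_log_of_real_ln[of \<nu> "ln x"] assms by (simp add: besselJ_def Ln_of_real rbes_def)

text \<open>A form of Hake's theorem: on an unbounded range the gauge integral exists as soon as the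
  integrals over \<open>{0..R}\<close> converge, so the absolutely convergent pieces may be Lebesgue
  integrals.\<close>

lemma improper_has_integral:
  fixes f :: "real \<Rightarrow> real"
  assumes int: "\<And>R. R > 0 \<Longrightarrow> set_integrable lborel {0..R} f"
    and lim: "((\<lambda>R. LINT t:{0..R}|lborel. f t) \<longlongrightarrow> L) at_top"
  shows "(f has_integral L) {0..}"
  unfolding has_integral_alt'
proof (intro conjI allI impI)
  have I: "f integrable_on {0..R}" "integral {0..R} f = (LINT t:{0..R}|lborel. f t)" if "R > 0" for R
    using set_borel_integral_eq_integral[OF int[OF that]] by auto
  fix a b :: real
  have "f integrable_on {max 0 a..b}"
    by (rule integrable_on_subinterval[OF I(1)[of "\<bar>b\<bar> + 1"]]) auto
  moreover have "{0..} \<inter> {a..b} = {max 0 a..b}" by auto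
  ultimately show "(\<lambda>x. if x \<in> {0..} then f x else 0) integrable_on cbox a b"
    unfolding cbox_interval integrable_restrict_Int by simp
next
  fix e :: real assume "e > 0"
  then obtain R0 where R0: "\<And>R. R \<ge> R0 \<Longrightarrow> \<bar>(LINT t:{0..R}|lborel. f t) - L\<bar> < e"
    using tendstoD[OF lim] by (auto simp: eventually_at_top_linorder dist_real_def)
  \<comment> \<open>The point B - 1 = |R0| + 1 lies in the ball, so any admissible upper limit b is
    positive and beyond R0.\<close>
  define B where "B = \<bar>R0\<bar> + 2"
  have "norm (integral (cbox a b) (\<lambda>x. if x \<in> {0..} then f x else 0) - L) < e" if ab: "ball 0 B \<subseteq> cbox a b" for a b
  proof -
    have "0 \<in> ball 0 B" "B - 1 \<in> ball 0 B" by (auto simp: B_def)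
    with ab have "0 \<in> cbox a b" "B - 1 \<in> cbox a b" by blast+
    then have b: "a \<le> 0" "b \<ge> B - 1" by auto
    then have "{0..} \<inter> {a..b} = {0..b}" by auto
    then have "integral (cbox a b) (\<lambda>x. if x \<in> {0..} then f x else 0) = integral {0..b} f"
      unfolding cbox_interval integral_restrict_Int by (simp only:)
    also have "\<dots> = (LINT t:{0..b}|lborel. f t)"
      using set_borel_integral_eq_integral[OF int[of b]] b by (simp add: B_def)
    finally show ?thesis using R0[of b] b by (simp add: B_def)
  qed
  then show "\<exists>B>0. \<forall>a b. ball 0 B \<subseteq> cbox a b \<longrightarrow> norm (integral (cbox a b) (\<lambda>x. if x \<in> {0..} then f x else 0) - L) < e"
    by (intro exI[of _ B]) (auto simp: B_def)
qed

text \<open>The substitution t = c^2/4 reduces this to \<open>lfac_bser_limit\<close> with X =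
  x^2.\<close>

lemma besselJ_integral_square:
  assumes nu: "\<nu> > -1/2" and x: "x > 0"
  shows "((\<lambda>c. besselJ (2 * \<nu>) (of_real c * of_real x) * besselJ \<nu> (of_real (c ^ 2 / 4)) * of_real c)
    has_integral 2 * besselJ_log \<nu> (2 * Ln (of_real x))) {0..}"
proof -
  let ?B = "\<lambda>c. besselJ (2 * \<nu>) (of_real c * of_real x) * besselJ \<nu> (of_real (c ^ 2 / 4)) * of_real c"
  let ?p = "\<lambda>c. (c * x / 2) powr (2 * \<nu>)"
  let ?q = "\<lambda>c. (c\<^sup>2 / 4 / 2) powr \<nu>"
  let ?X = "x\<^sup>2"
  have X: "?X > 0" using x by simp
  let ?h = "\<lambda>t. lfac \<nu> ?X t * rbes \<nu> t"
  let ?C = "2 * (?X / 2) powr \<nu>"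
  have [measurable]: "lfac \<nu> ?X \<in> borel_measurable borel" by (rule lfac_measurable[OF nu X])
  have hI: "set_integrable lborel {0<..R} ?h" for R
  proof (rule set_integrable_bound)
    show "set_integrable lborel {0<..R} (\<lambda>t. rbes_bound \<nu> * lfac \<nu> ?X t)"
      by (intro set_integrable_mult_right lfac_set_integrable nu X)
    show "AE t in lborel. t \<in> {0<..R} \<longrightarrow> norm (?h t) \<le> norm (rbes_bound \<nu> * lfac \<nu> ?X t)"
      using abs_rbes_le[OF nu] rbes_bound_nonneg[OF nu]
      by (intro AE_I2) (auto simp: abs_mult mult.commute[of "rbes_bound _"] intro!: mult_left_mono)
  qed (simp add: set_borel_measurable_def)
  have hI': "set_integrable lborel {0..R} ?h" for R
  proof -
    have "integrable lborel (\<lambda>t. indicator {0<..R} t *\<^sub>R ?h t) \<longleftrightarrow> integrable lborel (\<lambda>t. indicator {0..R} t *\<^sub>R ?h t)"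
    proof (rule integrable_cong_AE)
      show "AE t in lborel. indicator {0<..R} t *\<^sub>R ?h t = indicator {0..R} t *\<^sub>R ?h t"
        using AE_lborel_singleton[of 0] by eventually_elim (auto split: split_indicator)
    qed measurable
    then show ?thesis using hI[of R] unfolding set_integrable_def by blast
  qed
  have sub: "set_integrable lborel {0..R} (\<lambda>c. ?h (c\<^sup>2 / 4) * (c / 2))"
    "(LINT c:{0..R}|lborel. ?h (c\<^sup>2 / 4) * (c / 2)) = (LINT t:{0..R\<^sup>2 / 4}|lborel. ?h t)" if R: "R \<ge> 0" for R
  proof -
    have d: "((\<lambda>c. c\<^sup>2 / 4) has_real_derivative c / 2) (at c)" for c :: real
      by (auto intro!: derivative_eq_intros)
    have i: "set_integrable lborel {0\<^sup>2 / 4..R\<^sup>2 / 4} ?h" using hI' by simp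
    note S = integral_substitution[where g = "\<lambda>c. c\<^sup>2 / 4" and g' = "\<lambda>c. c / 2" and a = 0 and b = R, OF i d _ _ R]
    show "set_integrable lborel {0..R} (\<lambda>c. ?h (c\<^sup>2 / 4) * (c / 2))"
      by (rule S(1)) (auto intro!: continuous_intros)
    have "(\<integral>t. ?h t * indicator {0\<^sup>2 / 4..R\<^sup>2 / 4} t \<partial>lborel) = (\<integral>c. ?h (c\<^sup>2 / 4) * (c / 2) * indicator {0..R} c \<partial>lborel)"
      by (rule S(2)) (auto intro!: continuous_intros)
    then show "(LINT c:{0..R}|lborel. ?h (c\<^sup>2 / 4) * (c / 2)) = (LINT t:{0..R\<^sup>2 / 4}|lborel. ?h t)"
      unfolding set_lebesgue_integral_def by (simp add: mult_ac)
  qed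
  have "((\<lambda>T. LINT t:{0..T}|lborel. ?h t) \<longlongrightarrow> rbes \<nu> ?X) at_top"
    using lfac_bser_limit[OF nu X] by (simp add: rbes_def[symmetric] set_integral_Ioc_eq_Icc)
  then have "((\<lambda>R. LINT t:{0..R\<^sup>2 / 4}|lborel. ?h t) \<longlongrightarrow> rbes \<nu> ?X) at_top"
    by (rule filterlim_compose) real_asymp
  then have "((\<lambda>R. LINT c:{0..R}|lborel. ?h (c\<^sup>2 / 4) * (c / 2)) \<longlongrightarrow> rbes \<nu> ?X) at_top"
    by (rule Lim_transform_eventually) (rule eventually_mono[OF eventually_ge_at_top[of 0]], simp only: sub)
  then have "((\<lambda>R. LINT c:{0..R}|lborel. ?C * (?h (c\<^sup>2 / 4) * (c / 2))) \<longlongrightarrow> ?C * rbes \<nu> ?X) at_top"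
    by (simp only: set_integral_mult_right) (intro tendsto_intros)
  then have "((\<lambda>c. ?C * (?h (c\<^sup>2 / 4) * (c / 2))) has_integral ?C * rbes \<nu> ?X) {0..}"
    by (rule improper_has_integral[rotated]) (intro set_integrable_mult_right sub, simp)
  then have "((\<lambda>c. complex_of_real (?C * (?h (c\<^sup>2 / 4) * (c / 2)))) has_integral of_real (?C * rbes \<nu> ?X)) {0..}"
    by (rule has_integral_of_real)
  moreover have "complex_of_real (?C * (?h (c\<^sup>2 / 4) * (c / 2))) = ?B c"
    if "c \<in> {0..}" for c
  proof (cases "c = 0")
    case False
    with that have c: "c > 0" by simp
    have 1: "besselJ (2 * \<nu>) (of_real c * of_real x) = of_real (?p c * rbes (2 * \<nu>) (c * x))"
      using besselJ_of_real_pos[of "c * x" "2 * \<nu>"] c x by simp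
    have 2: "besselJ \<nu> (of_real (c ^ 2 / 4)) = of_real (?q c * rbes \<nu> (c\<^sup>2 / 4))"
      using c by (intro besselJ_of_real_pos) simp
    have j: "rbes (2 * \<nu>) (c * x) = bser (2 * \<nu>) (?X * (c\<^sup>2 / 4))"
      by (simp add: rbes_def power2_eq_square field_simps)
    \<comment> \<open>With t = c^2/4 the powers combine to (X/2)^\<nu> t^(2\<nu>), the last factor
      being the one in \<open>lfac\<close>. The 2 in \<open>?C\<close> compensates dt = (c/2)
      dc.\<close>
    have p: "?p c * ?q c = (?X / 2) powr \<nu> * (c\<^sup>2 / 4) powr (2 * \<nu>)"
    proof -
      have sq: "(a::real) powr (2 * \<nu>) = (a\<^sup>2) powr \<nu>" if "a > 0" for a
        using powr_powr[of a 2 \<nu>] that by simp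
      have "?p c * ?q c = ((c * x / 2)\<^sup>2) powr \<nu> * ?q c"
        using c x by (simp only: sq divide_pos_pos mult_pos_pos zero_less_numeral)
      also have "\<dots> = ((c * x / 2)\<^sup>2 * (c\<^sup>2 / 4 / 2)) powr \<nu>"
        using c x by (intro powr_mult[symmetric])
      also have "(c * x / 2)\<^sup>2 * (c\<^sup>2 / 4 / 2) = (?X / 2) * (c\<^sup>2 / 4)\<^sup>2"
        by (simp add: power2_eq_square)
      also have "\<dots> powr \<nu> = (?X / 2) powr \<nu> * ((c\<^sup>2 / 4)\<^sup>2) powr \<nu>"
        using c x by (intro powr_mult)
      also have "((c\<^sup>2 / 4)\<^sup>2) powr \<nu> = (c\<^sup>2 / 4) powr (2 * \<nu>)" using c by (subst sq) auto
      finally show ?thesis .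
    qed
    have "?p c * rbes (2 * \<nu>) (c * x) * (?q c * rbes \<nu> (c\<^sup>2 / 4)) * c
       = (?p c * ?q c) * (bser (2 * \<nu>) (?X * (c\<^sup>2 / 4)) * rbes \<nu> (c\<^sup>2 / 4) * c)"
      unfolding j by (simp only: mult_ac)
    also have "\<dots> = ?C * (?h (c\<^sup>2 / 4) * (c / 2))"
      unfolding p lfac_def[OF nu X] by simp
    finally have E: "?p c * rbes (2 * \<nu>) (c * x) * (?q c * rbes \<nu> (c\<^sup>2 / 4)) * c
        = ?C * (?h (c\<^sup>2 / 4) * (c / 2))" .
    show ?thesis unfolding 1 2 unfolding of_real_mult[symmetric] E ..
  qed simp
  ultimately have "(?B
    has_integral of_real (?C * rbes \<nu> ?X)) {0..}"
    by (rule has_integral_eq[rotated])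
  moreover have "2 * besselJ_log \<nu> (2 * Ln (of_real x)) = of_real (?C * rbes \<nu> ?X)"
  proof -
    have "2 * Ln (complex_of_real x) = of_real (2 * ln x)" using x by (simp add: Ln_of_real)
    moreover have "exp (2 * ln x) = ?X" using x by (simp add: exp_double)
    ultimately show ?thesis using besselJ_log_of_real_ln[of \<nu> "2 * ln x"] by (simp add: rbes_def)
  qed
  ultimately show ?thesis by (simp only:)
qed

text \<open>Replacing c by c/x moves x into the other factor, so the product limit is taken at y =
  x/4. The powers of c cancel and leave (x/16)^\<mu>.\<close>

lemma besselJ_integral_inverse:
  assumes mu: "\<mu> > -1/2" and x: "x > 0"
  shows "((\<lambda>c. besselJ \<mu> (of_real c * of_real x) * besselJ \<mu> (of_real (1 / (4 * c))))
    has_integral of_real ((x / 4) powr \<mu> / x * bser (2 * \<mu>) (x / 4))) {0..}"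
proof -
  let ?p = "\<lambda>c. (c * x / 2) powr \<mu>"
  let ?q = "\<lambda>c. (1 / (4 * c) / 2) powr \<mu>"
  let ?l = "4 powr \<mu> * bser (2 * \<mu>) (x / 4)"
  let ?g = "\<lambda>c. rbes \<mu> (c * x) * rbes \<mu> (1 / (4 * c))"
  let ?C = "(x / 16) powr \<mu>"
  have gI: "set_integrable lborel {0..R} ?g" for R
  proof (rule set_integrable_bounded_Icc)
    fix s show "\<bar>?g s\<bar> \<le> rbes_bound \<mu> * rbes_bound \<mu>"
      unfolding abs_mult by (intro mult_mono abs_rbes_le mu rbes_bound_nonneg) auto
  qed measurable
  have scale: "(LINT c:{0..R}|lborel. ?g c) = 1 / x * (LINT c:{0<..R * x}|lborel. rbes \<mu> c * rbes \<mu> (x / 4 / c))" for R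
  proof -
    have "(LINT c:{0<..R * x}|lborel. rbes \<mu> c * rbes \<mu> (x / 4 / c)) = (\<integral>c. indicator {0<..R * x} c *\<^sub>R (rbes \<mu> c * rbes \<mu> (x / 4 / c)) \<partial>lborel)"
      by (simp add: set_lebesgue_integral_def)
    also have "\<dots> = \<bar>x\<bar> *\<^sub>R (\<integral>c. indicator {0<..R * x} (0 + x * c) *\<^sub>R (rbes \<mu> (0 + x * c) * rbes \<mu> (x / 4 / (0 + x * c))) \<partial>lborel)"
      by (rule lborel_integral_real_affine) (use x in auto)
    also have "(\<lambda>c. indicator {0<..R * x} (0 + x * c) *\<^sub>R (rbes \<mu> (0 + x * c) * rbes \<mu> (x / 4 / (0 + x * c)))) = (\<lambda>c. indicator {0<..R} c *\<^sub>R ?g c)"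
    proof
      fix c
      have "indicator {0<..R * x} (0 + x * c) = (indicator {0<..R} c :: real)"
        using x by (simp add: indicator_def zero_less_mult_iff mult.commute[of x])
      moreover have "x / 4 / (0 + x * c) = 1 / (4 * c)" using x by simp
      ultimately show "indicator {0<..R * x} (0 + x * c) *\<^sub>R (rbes \<mu> (0 + x * c) * rbes \<mu> (x / 4 / (0 + x * c))) = indicator {0<..R} c *\<^sub>R ?g c"
        by (simp only: add_0 mult.commute[of x])
    qed
    also have "(\<integral>c. indicator {0<..R} c *\<^sub>R ?g c \<partial>lborel) = (LINT c:{0<..R}|lborel. ?g c)"
      by (simp add: set_lebesgue_integral_def)
    also have "\<dots> = (LINT c:{0..R}|lborel. ?g c)" by (rule set_integral_Ioc_eq_Icc) measurable
    finally show ?thesis using x by simp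
  qed
  have "((\<lambda>R. LINT c:{0<..R}|lborel. rbes \<mu> c * rbes \<mu> (x / 4 / c)) \<longlongrightarrow> ?l) at_top"
    using x by (intro rbes_product_limit_value mu) simp
  then have "((\<lambda>R. LINT c:{0<..R * x}|lborel. rbes \<mu> c * rbes \<mu> (x / 4 / c)) \<longlongrightarrow> ?l) at_top"
    by (rule filterlim_compose) (use x in real_asymp)
  then have "((\<lambda>R. LINT c:{0..R}|lborel. ?g c) \<longlongrightarrow> 1 / x * ?l) at_top"
    unfolding scale by (intro tendsto_intros)
  then have "((\<lambda>R. LINT c:{0..R}|lborel. ?C * ?g c) \<longlongrightarrow> ?C * (1 / x * ?l)) at_top"
    by (simp only: set_integral_mult_right) (intro tendsto_intros)
  then have "((\<lambda>c. ?C * ?g c) has_integral ?C * (1 / x * ?l)) {0..}"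
    by (rule improper_has_integral[rotated]) (intro set_integrable_mult_right gI)
  also have "?C * (1 / x * ?l) = (x / 4) powr \<mu> / x * bser (2 * \<mu>) (x / 4)"
  proof -
    have "(x / 4) powr \<mu> = (x / 16) powr \<mu> * 4 powr \<mu>" using powr_mult[of "x / 16" 4 \<mu>] x by simp
    then show ?thesis by simp
  qed
  finally have "((\<lambda>c. complex_of_real (?C * ?g c)) has_integral of_real ((x / 4) powr \<mu> / x * bser (2 * \<mu>) (x / 4))) {0..}"
    by (rule has_integral_of_real)
  then show ?thesis
  \<comment> \<open>The point c = 0 is exempted: there 1/(4c) is 0 by convention and
    \<open>besselJ\<close> takes its default value, so the two integrands need not agree.\<close>
  proof (rule has_integral_spike_finite[of "{0}", rotated -1])
    fix c :: real assume "c \<in> {0..} - {0}"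
    then have c: "c > 0" by simp
    have 1: "besselJ \<mu> (of_real c * of_real x) = of_real (?p c * rbes \<mu> (c * x))"
      using besselJ_of_real_pos[of "c * x" \<mu>] c x by simp
    have 2: "besselJ \<mu> (of_real (1 / (4 * c))) = of_real (?q c * rbes \<mu> (1 / (4 * c)))"
      using c by (intro besselJ_of_real_pos) simp
    have "?p c * ?q c = (c * x / 2 * (1 / (4 * c) / 2)) powr \<mu>"
      using c x by (intro powr_mult[symmetric])
    also have "c * x / 2 * (1 / (4 * c) / 2) = x / 16" using c by (simp add: field_simps)
    finally have p: "?p c * ?q c = ?C" .
    have "?p c * rbes \<mu> (c * x) * (?q c * rbes \<mu> (1 / (4 * c))) = ?C * ?g c"
      unfolding p[symmetric] by (simp only: mult_ac)
    then show "besselJ \<mu> (of_real c * of_real x) * besselJ \<mu> (of_real (1 / (4 * c))) = complex_of_real (?C * ?g c)"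
      unfolding 1 2 by (simp only: of_real_mult[symmetric])
  qed simp
qed

section \<open>Analytic continuation from the positive axis to the slit plane\<close>

lemma holomorphic_on_bser [holomorphic_intros]:
  "f holomorphic_on S \<Longrightarrow> (\<lambda>z. bser \<beta> (f z)) holomorphic_on S"
  using holomorphic_on_compose_gen[of f S "bser \<beta>" UNIV] has_field_derivative_bser[of \<beta>]
  by (auto simp: o_def holomorphic_on_def field_differentiable_def intro: has_field_derivative_at_within)

text \<open>Halving the argument of z stays within the principal strip, so Ln (csqrt z) = Ln z / 2.
  The square root then enters only through \<open>Ln\<close> and an entire function of z, which
  makes holomorphy evident.\<close>

lemma besselJ_csqrt:
  assumes "z \<noteq> 0"
  shows "besselJ \<beta> (csqrt z) = exp (of_real \<beta> * (Ln z / 2 - of_real (ln 2))) * bser \<beta> (z / 4)"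
proof -
  have e: "csqrt z = exp (Ln z / 2)" using assms by (rule csqrt_exp_Ln)
  have "- pi < Im (Ln z) / 2" "Im (Ln z) / 2 \<le> pi"
    using Im_Ln_le_pi[OF assms] mpi_less_Im_Ln[OF assms] pi_gt_zero by linarith+
  then have L: "Ln (exp (Ln z / 2)) = Ln z / 2" by (intro Ln_exp) auto
  have S: "(exp (Ln z / 2) / 2)\<^sup>2 = z / 4"
    using assms by (simp add: power_divide exp_double[symmetric])
  show ?thesis unfolding e besselJ_def besselJ_log_bser L S by simp
qed

theorem theorem18:
  fixes \<nu> \<mu> :: real and z :: complex
  assumes "\<nu> \<ge> - 1 / 4" and "\<mu> > - 1 / 2" and "z \<notin> \<real>\<^sub>\<le>\<^sub>0"
  shows "has_continued_integral
           (\<lambda>z c. besselJ (2 * \<nu>) (of_real c * z) * besselJ \<nu> (of_real (c ^ 2 / 4)) * of_real c)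
           z (2 * besselJ_log \<nu> (2 * Ln z)) \<and>
         has_continued_integral
           (\<lambda>z c. besselJ \<mu> (of_real c * z) * besselJ \<mu> (of_real (1 / (4 * c))))
           z (inverse z * besselJ (2 * \<mu>) (csqrt z))"
proof
  show "has_continued_integral
           (\<lambda>z c. besselJ (2 * \<nu>) (of_real c * z) * besselJ \<nu> (of_real (c ^ 2 / 4)) * of_real c)
           z (2 * besselJ_log \<nu> (2 * Ln z))"
    unfolding has_continued_integral_def
  \<comment> \<open>The claimed value is itself the continuation. Using 2 Ln z rather than Ln (z^2)
    keeps it holomorphic across the imaginary axis, where z^2 meets the cut of the principal
    branch.\<close>
  proof (intro exI[of _ "\<lambda>z. 2 * besselJ_log \<nu> (2 * Ln z)"] conjI allI impI refl)
    show "(\<lambda>z. 2 * besselJ_log \<nu> (2 * Ln z)) holomorphic_on - \<real>\<^sub>\<le>\<^sub>0"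
      unfolding besselJ_log_bser by (intro holomorphic_intros) auto
    show "((\<lambda>c. besselJ (2 * \<nu>) (of_real c * of_real x) * besselJ \<nu> (of_real (c ^ 2 / 4)) * of_real c)
        has_integral 2 * besselJ_log \<nu> (2 * Ln (of_real x))) {0..}" if "x > 0" for x
      using assms(1) that by (intro besselJ_integral_square) auto
  qed
  show "has_continued_integral
           (\<lambda>z c. besselJ \<mu> (of_real c * z) * besselJ \<mu> (of_real (1 / (4 * c))))
           z (inverse z * besselJ (2 * \<mu>) (csqrt z))"
    unfolding has_continued_integral_def
  proof (intro exI[of _ "\<lambda>z. inverse z * besselJ (2 * \<mu>) (csqrt z)"] conjI allI impI refl)
    have "(\<lambda>z. inverse z * (exp (of_real (2 * \<mu>) * (Ln z / 2 - of_real (ln 2))) * bser (2 * \<mu>) (z / 4))) holomorphic_on - \<real>\<^sub>\<le>\<^sub>0"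
      by (intro holomorphic_intros) auto
    then show "(\<lambda>z. inverse z * besselJ (2 * \<mu>) (csqrt z)) holomorphic_on - \<real>\<^sub>\<le>\<^sub>0"
    proof (rule holomorphic_transform)
      fix z :: complex assume "z \<in> - \<real>\<^sub>\<le>\<^sub>0"
      then have z0: "z \<noteq> 0" by auto
      show "inverse z * (exp (of_real (2 * \<mu>) * (Ln z / 2 - of_real (ln 2))) * bser (2 * \<mu>) (z / 4)) = inverse z * besselJ (2 * \<mu>) (csqrt z)"
        by (rule arg_cong[where f = "\<lambda>w. inverse z * w", OF besselJ_csqrt[OF z0, symmetric]])
    qed
    fix x :: real assume x: "x > 0"
    have "inverse (complex_of_real x) * besselJ (2 * \<mu>) (csqrt (of_real x)) = of_real ((x / 4) powr \<mu> / x * bser (2 * \<mu>) (x / 4))"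
    proof -
      have "exp (of_real (2 * \<mu>) * (Ln (complex_of_real x) / 2 - of_real (ln 2))) = complex_of_real (exp (2 * \<mu> * (ln x / 2 - ln 2)))"
      proof -
        have "of_real (2 * \<mu>) * (Ln (complex_of_real x) / 2 - of_real (ln 2)) = complex_of_real (2 * \<mu> * (ln x / 2 - ln 2))"
          using x by (simp add: Ln_of_real)
        then show ?thesis by (simp only: exp_of_real)
      qed
      also have "2 * \<mu> * (ln x / 2 - ln 2) = \<mu> * ln (x / 4)"
      proof -
        have "ln (x / 4) = ln x - 2 * ln 2" using x ln_realpow[of 2 2] by (simp add: ln_div)
        then show ?thesis by (simp only:) (simp add: right_diff_distrib)
      qed
      also have "exp (\<mu> * ln (x / 4)) = (x / 4) powr \<mu>" using x by (simp add: powr_def)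
      finally have "exp (of_real (2 * \<mu>) * (Ln (complex_of_real x) / 2 - of_real (ln 2))) = complex_of_real ((x / 4) powr \<mu>)" .
      moreover have "bser (2 * \<mu>) (complex_of_real x / 4) = of_real (bser (2 * \<mu>) (x / 4))"
        using bser_of_real[of "2 * \<mu>" "x / 4", where 'a = complex] by simp
      moreover have z0: "complex_of_real x \<noteq> 0" using x by simp
      ultimately have "inverse (complex_of_real x) * besselJ (2 * \<mu>) (csqrt (of_real x))
          = inverse (of_real x) * (of_real ((x / 4) powr \<mu>) * of_real (bser (2 * \<mu>) (x / 4)))"
        by (simp only: besselJ_csqrt[OF z0])
      then show ?thesis by (simp only: of_real_mult of_real_inverse divide_inverse mult_ac)
    qed
    then show "((\<lambda>c. besselJ \<mu> (of_real c * of_real x) * besselJ \<mu> (of_real (1 / (4 * c))))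
        has_integral inverse (of_real x) * besselJ (2 * \<mu>) (csqrt (of_real x))) {0..}"
      using besselJ_integral_inverse[OF _ x, of \<mu>] assms(2) by (simp only: divide_minus_left)
  qed
qed

end
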